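(* Let $n\ge d\ge 2$ be integers and let $\boldsymbol{\mu}=(\mu_1,\dots,\mu_d)$ be a $d$-part partition of $n$. Then $\mathcal{P}_{n,d}^{\boldsymbol{\mu}}$ is a Zariski open subset of a subvariety of $R_n^{d+1}\simeq \mathsf{k}^{(d+1)(n+1)}$. Furthermore, $\mathcal{P}_{n,d}^{\boldsymbol{\mu}}$ is irreducible of dimension $$\dim(\mathcal{P}_{n,d}^{\boldsymbol{\mu}})=(d+1)(n+1)-\sum_{i>j}\max(0,\mu_i-\mu_j-1).$$
   Context: $\mathsf{k}$ is an arbitrary infinite field, $R=\mathsf{k}[s,t]$ with the standard grading, and $R_n$ is the space of homogeneous polynomials of degree $n$. A $d$-part partition is a tuple of integers $\boldsymbol{\mu}=(\mu_1,\dots,\mu_d)$ with $1\le\mu_1\le\cdots\le\mu_d$; put $|\boldsymbol{\mu}|=\mu_1+\cdots+\mu_d$; it is a partition of $n$ if $|\boldsymbol{\mu}|=n$. For linearly independent $a_0,\dots,a_d\in R_n$ with $I=\langle a_0,\dots,a_d\rangle\subseteq R$, there is a graded exact sequence $0\to\bigoplus_{i=1}^d R(-n-\mu_i)\to R(-n)^{d+1}\xrightarrow{(a_0,\dots,a_d)} I\to 0$ with uniquely determined integers $1\le\mu_1\le\cdots\le\mu_d$; the tuple $\boldsymbol{\mu}=(\mu_1,\dots,\mu_d)$ is called the $\boldsymbol{\mu}$-type (or type) of $(a_0,\dots,a_d)$. One has $|\boldsymbol{\mu}|=n-\deg\gcd(a_0,\dots,a_d)$. $\mathcal{P}_{n,d}\subseteq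 R_n^{d+1}$ is the set of $(a_0,\dots,a_d)$ that are linearly independent and relatively prime, and for a $d$-part partition $\boldsymbol{\mu}$ of $n$, $\mathcal{P}_{n,d}^{\boldsymbol{\mu}}\subseteq\mathcal{P}_{n,d}$ is the subset of those of type $\boldsymbol{\mu}$. "Subvariety" means Zariski closed subset. Sums over $i>j$ range over $1\le j<i\le d$. *)

theory Defs
  imports "HOL-Analysis.Analysis" "HOL-Computational_Algebra.Polynomial"
begin

section \<open>Binary forms\<close>

text \<open>
  The ring \<open>R = k[s,t]\<close> is \<^typ>\<open>'k poly poly\<close>: the inner variable is \<open>s\<close>, the outer variable
  is \<open>t\<close>, so the coefficient of \<open>s ^ i * t ^ j\<close> in \<open>p\<close> is \<open>coeff (coeff p j) i\<close>.
\<close>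

definition forms :: "nat \<Rightarrow> 'k::field poly poly set" where
  "forms n = {p. \<forall>i j. coeff (coeff p j) i \<noteq> 0 \<longrightarrow> i + j = n}"

text \<open>
  The space of tuples \<open>(a 0, \<dots>, a d)\<close> of forms of degree \<open>n\<close>. Tuples are extensional functions,
  so that two tuples agreeing on \<open>{..d}\<close> are equal.
\<close>

definition form_tuples :: "nat \<Rightarrow> nat \<Rightarrow> (nat \<Rightarrow> 'k::field poly poly) set" where
  "form_tuples n d = {..d} \<rightarrow>\<^sub>E forms n"

definition lin_indep_tuple :: "nat \<Rightarrow> (nat \<Rightarrow> 'k::field poly poly) \<Rightarrow> bool" where
  "lin_indep_tuple d a \<longleftrightarrow>
     (\<forall>c :: nat \<Rightarrow> 'k. (\<Sum>i\<le>d. smult [:c i:] (a i)) = 0 \<longrightarrow> (\<forall>i\<le>d. c i = 0))"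

definition rel_prime_tuple :: "nat \<Rightarrow> (nat \<Rightarrow> 'k::field poly poly) \<Rightarrow> bool" where
  "rel_prime_tuple d a \<longleftrightarrow> (\<forall>c. (\<forall>i\<le>d. c dvd a i) \<longrightarrow> is_unit c)"


section \<open>Partitions and the type of a tuple\<close>

text \<open>
  A partition \<open>(\<mu>\<^sub>1, \<dots>, \<mu>\<^sub>d)\<close> is the list of its parts in increasing order, so \<open>\<mu>\<^sub>i\<close> is
  \<open>\<mu> ! (i - 1)\<close>.
\<close>

definition is_partition :: "nat \<Rightarrow> nat list \<Rightarrow> bool" where
  "is_partition d \<mu> \<longleftrightarrow> length \<mu> = d \<and> sorted \<mu> \<and> (\<forall>m\<in>set \<mu>. 1 \<le> m)"

definition is_partition_of :: "nat \<Rightarrow> nat \<Rightarrow> nat list \<Rightarrow> bool" where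
  "is_partition_of n d \<mu> \<longleftrightarrow> is_partition d \<mu> \<and> sum_list \<mu> = n"

text \<open>
  A graded (degree-preserving) homomorphism from the direct sum of the \<open>R(-n-\<mu>\<^sub>j)\<close> to
  \<open>R(-n)\<^sup>d\<^sup>+\<^sup>1\<close> is a matrix \<open>P\<close> whose \<open>j\<close>-th column consists of forms of degree \<open>\<mu>\<^sub>j\<close>. The two
  remaining conjuncts are exactness of
  \<open>0 \<rightarrow> \<Oplus>\<^sub>j R(-n-\<mu>\<^sub>j) \<rightarrow> R(-n)\<^sup>d\<^sup>+\<^sup>1 \<rightarrow> I \<rightarrow> 0\<close> at the first and at the second module;
  surjectivity onto the ideal \<open>I\<close> generated by the \<open>a i\<close> holds by definition of \<open>I\<close>.
\<close>

definition graded_resolution ::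
    "nat \<Rightarrow> (nat \<Rightarrow> 'k::field poly poly) \<Rightarrow> nat list \<Rightarrow> (nat \<Rightarrow> nat \<Rightarrow> 'k poly poly) \<Rightarrow> bool" where
  "graded_resolution d a \<mu> P \<longleftrightarrow>
     (\<forall>i\<le>d. \<forall>j<length \<mu>. P i j \<in> forms (\<mu> ! j)) \<and>
     (\<forall>h. (\<forall>i\<le>d. (\<Sum>j<length \<mu>. P i j * h j) = 0) \<longrightarrow> (\<forall>j<length \<mu>. h j = 0)) \<and>
     (\<forall>g. (\<Sum>i\<le>d. a i * g i) = 0 \<longleftrightarrow> (\<exists>h. \<forall>i\<le>d. g i = (\<Sum>j<length \<mu>. P i j * h j)))"

definition has_type :: "nat \<Rightarrow> (nat \<Rightarrow> 'k::field poly poly) \<Rightarrow> nat list \<Rightarrow> bool" where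
  "has_type d a \<mu> \<longleftrightarrow> is_partition d \<mu> \<and> (\<exists>P. graded_resolution d a \<mu> P)"

definition param_tuples :: "nat \<Rightarrow> nat \<Rightarrow> (nat \<Rightarrow> 'k::field poly poly) set" where
  "param_tuples n d = {a \<in> form_tuples n d. lin_indep_tuple d a \<and> rel_prime_tuple d a}"

definition param_tuples_of_type ::
    "nat \<Rightarrow> nat \<Rightarrow> nat list \<Rightarrow> (nat \<Rightarrow> 'k::field poly poly) set" where
  "param_tuples_of_type n d \<mu> = {a \<in> param_tuples n d. has_type d a \<mu>}"


section \<open>The Zariski topology\<close>

text \<open>
  The polynomial functions in a set \<open>X\<close> of coordinate functions. Zero loci only depend on
  polynomials as functions, so no type of polynomials in arbitrarily many variables is needed.
\<close>

inductive_set polyfuns :: "('p \<Rightarrow> 'k::field) set \<Rightarrow> ('p \<Rightarrow> 'k) set"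
  for X :: "('p \<Rightarrow> 'k) set" where
  const: "(\<lambda>_. c) \<in> polyfuns X"
| coord: "x \<in> X \<Longrightarrow> x \<in> polyfuns X"
| add: "f \<in> polyfuns X \<Longrightarrow> g \<in> polyfuns X \<Longrightarrow> (\<lambda>p. f p + g p) \<in> polyfuns X"
| mult: "f \<in> polyfuns X \<Longrightarrow> g \<in> polyfuns X \<Longrightarrow> (\<lambda>p. f p * g p) \<in> polyfuns X"

definition zero_locus :: "'p set \<Rightarrow> ('p \<Rightarrow> 'k::field) set \<Rightarrow> 'p set" where
  "zero_locus S F = {p \<in> S. \<forall>f\<in>F. f p = 0}"

definition zariski :: "'p set \<Rightarrow> ('p \<Rightarrow> 'k::field) set \<Rightarrow> 'p topology" where
  "zariski S X = topology (\<lambda>U. \<exists>F \<subseteq> polyfuns X. U = S - zero_locus S F)"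

lemma istopology_zariski: "istopology (\<lambda>U. \<exists>F \<subseteq> polyfuns X. U = S - zero_locus S F)"
  unfolding istopology_def
proof (intro conjI allI impI)
  fix U V
  assume "\<exists>F \<subseteq> polyfuns X. U = S - zero_locus S F" "\<exists>F \<subseteq> polyfuns X. V = S - zero_locus S F"
  then obtain F G where F: "F \<subseteq> polyfuns X" "U = S - zero_locus S F"
    and G: "G \<subseteq> polyfuns X" "V = S - zero_locus S G" by blast
  let ?H = "{\<lambda>p. f p * g p | f g. f \<in> F \<and> g \<in> G}"
  have "?H \<subseteq> polyfuns X" using F(1) G(1) by (auto intro!: polyfuns.mult)
  moreover have "U \<inter> V = S - zero_locus S ?H"
    unfolding F(2) G(2) zero_locus_def by auto (metis mult_eq_0_iff)
  ultimately show "\<exists>H \<subseteq> polyfuns X. U \<inter> V = S - zero_locus S H" by blast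
next
  fix \<U>
  assume "\<forall>U\<in>\<U>. \<exists>F \<subseteq> polyfuns X. U = S - zero_locus S F"
  then obtain F where F: "\<And>U. U \<in> \<U> \<Longrightarrow> F U \<subseteq> polyfuns X \<and> U = S - zero_locus S (F U)"
    by metis
  have "(\<Union>U\<in>\<U>. F U) \<subseteq> polyfuns X" using F by blast
  moreover have "\<Union>\<U> = (\<Union>U\<in>\<U>. S - zero_locus S (F U))" using F by auto
  moreover have "\<dots> = S - zero_locus S (\<Union>U\<in>\<U>. F U)" unfolding zero_locus_def by auto
  ultimately show "\<exists>H \<subseteq> polyfuns X. \<Union>\<U> = S - zero_locus S H" by metis
qed

lemma openin_zariski:
  "openin (zariski S X) U \<longleftrightarrow> (\<exists>F \<subseteq> polyfuns X. U = S - zero_locus S F)"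
  unfolding zariski_def topology_inverse'[OF istopology_zariski] ..

lemma topspace_zariski [simp]: "topspace (zariski S X) = S"
proof -
  have "S = S - zero_locus S {\<lambda>_. 1}" by (simp add: zero_locus_def)
  then have "openin (zariski S X) S"
    unfolding openin_zariski by (intro exI[of _ "{\<lambda>_. 1}"]) (simp add: polyfuns.const)
  then show ?thesis
    by (metis (no_types, lifting) Diff_subset openin_subset openin_topspace openin_zariski subset_antisym)
qed

lemma closedin_zariski:
  "closedin (zariski S X) V \<longleftrightarrow> (\<exists>F \<subseteq> polyfuns X. V = zero_locus S F)"
proof -
  have "V \<subseteq> S \<Longrightarrow> S - V = S - zero_locus S F \<longleftrightarrow> V = zero_locus S F" for F
    unfolding zero_locus_def by blast
  then show ?thesis
    unfolding closedin_def openin_zariski topspace_zariski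
    by (metis (no_types, lifting) mem_Collect_eq subsetI zero_locus_def)
qed

text \<open>
  The \<open>(d+1)(n+1)\<close> coefficients of a tuple are the coordinates identifying the space of tuples
  of forms with affine space.
\<close>

definition form_coords :: "nat \<Rightarrow> nat \<Rightarrow> ((nat \<Rightarrow> 'k::field poly poly) \<Rightarrow> 'k) set" where
  "form_coords n d = {\<lambda>a. coeff (coeff (a i) j) (n - j) | i j. i \<le> d \<and> j \<le> n}"

definition form_zariski :: "nat \<Rightarrow> nat \<Rightarrow> (nat \<Rightarrow> 'k::field poly poly) topology" where
  "form_zariski n d = zariski (form_tuples n d) (form_coords n d)"

definition irreducible_space :: "'p topology \<Rightarrow> bool" where
  "irreducible_space T \<longleftrightarrow> topspace T \<noteq> {} \<and>
     (\<forall>C D. closedin T C \<longrightarrow> closedin T D \<longrightarrow> topspace T = C \<union> D \<longrightarrow>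
        topspace T = C \<or> topspace T = D)"

text \<open>
  Krull dimension of a topological space: the supremum of the lengths \<open>m\<close> of chains
  \<open>C 0 \<subset> \<dots> \<subset> C m\<close> of irreducible closed subsets. The empty space has dimension \<open>-\<infinity>\<close>.
\<close>

definition krull_dim :: "'p topology \<Rightarrow> ereal" where
  "krull_dim T = Sup {ereal (real m) | m. \<exists>C.
     (\<forall>i\<le>m. closedin T (C i) \<and> irreducible_space (subtopology T (C i))) \<and>
     (\<forall>i<m. C i \<subset> C (Suc i))}"

end

theory Submission
  imports Defs "Jordan_Normal_Form.Determinant"
begin

text \<open>
  Setting \<open>s = 1\<close> turns forms of degree \<open>n\<close> into polynomials of degree at most \<open>n\<close> and a graded
  resolution into a \<open>k[t]\<close>-basis of the syzygies with degree bounds. Such a basis with degrees \<open>\<mu>\<close>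
  exists iff, for all \<open>m \<le> n\<close>, the syzygies of degree \<open>m\<close> have dimension \<open>\<Sum>\<^sub>j max 0 (m + 1 - \<mu>\<^sub>j)\<close>;
  since the rank of a matrix is lower semicontinuous, the stratum is locally closed. By
  Hilbert--Burch the stratum consists of the tuples of maximal minors, up to a scalar, of the
  matrices with columns of degrees \<open>\<mu>\<close> (those whose minors generate in degree \<open>2 n\<close>), so any two of its
  points lie on a polynomial curve almost all of whose points are in the stratum; over an infinite
  field this gives irreducibility.

  For the dimension, fix a point and, for each \<open>j\<close>, a complement of its syzygies of degree \<open>\<mu>\<^sub>j\<close>.
  Perturbing the columns of its syzygy matrix within these complements gives a slice, and near the point
  every tuple of the stratum comes from the slice and a scalar. The number of parameters bounds the
  length of chains, because a chain of length \<open>m\<close> yields \<open>m\<close> algebraically independent functions.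
  Conversely, the closures of the images of a flag of coordinate subspaces of the slice form a chain:
  they are separated by the closed conditions that the syzygies of degree \<open>\<mu>\<^sub>j\<close> meet a given subspace.
  Over an arbitrary infinite field this explicit chain is needed: for the \<open>k\<close>-points of a general
  variety the topological dimension can be smaller than the transcendence degree.
\<close>

text \<open>Setting s = 1 loses the point s = 0; the degree bounds keep it. Surjectivity onto all
  polynomials of degree at most 2 n, \<open>surj_at d n a n\<close>, excludes common zeros
  everywhere, at s = 0 too, and is a single rank condition. The degree n is chosen because every
  part of \<mu> is at most n: from there on surjectivity persists and determines the dimensions of
  the syzygies, so finitely many ranks decide the type.

  A basis with prescribed degrees comes from a Nakayama argument at t = 0: syzygies with linearly
  independent constant terms are independent over k[t], and the growth of the Hilbert function at
  \<mu>_j leaves room for one more.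

  The count behind the formula: matrices with columns of degrees \<mu>_j form a space of dimension
  (d + 1)(n + d); automorphisms of the graded free module, of dimension d^2 plus the sum of max(0,
  \<mu>_i - \<mu>_j - 1), change the minors only by a scalar; the scalar adds 1. The slice replaces
  this quotient by linear algebra, column by column: \<open>hilb d \<mu> (\<mu> ! j)\<close> is the
  dimension of the space of syzygies that contains column j.\<close>

no_notation vector_scalar_mult (infixl \<open>*s\<close> 70)
hide_const (open) module.smult

lemma is_partition_ofD:
  assumes "is_partition_of n d \<mu>"
  shows "length \<mu> = d" "sum_list \<mu> = n" "\<forall>m\<in>set \<mu>. 1 \<le> m" "sorted \<mu>"
  using assms unfolding is_partition_of_def is_partition_def by blast+

section \<open>Finite-dimensional subspaces\<close>

text \<open>
  Definitions made inside \<^locale>\<open>vector_space\<close> itself would be hidden by their instances for real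
  vector spaces.
\<close>

locale dim_vector_space = vector_space
begin

text \<open>A relation instead of the function \<open>dim\<close>, whose value in infinite dimension
  is a default 0: it includes finiteness and the fact that \<open>S\<close> is a subspace.\<close>

definition has_dim :: "'b set \<Rightarrow> nat \<Rightarrow> bool" where
  "has_dim S r \<longleftrightarrow> (\<exists>B. finite B \<and> \<not> local.dependent B \<and> local.span B = S \<and> card B = r)"

text \<open>Independence of the images in the quotient by \<open>K\<close>. The vectors form an
  indexed family, so a repetition counts as a dependence; \<open>K = {0}\<close> gives the ordinary
  notion.\<close>

definition indep_mod :: "'b set \<Rightarrow> 'i set \<Rightarrow> ('i \<Rightarrow> 'b) \<Rightarrow> bool" where
  "indep_mod K I v \<longleftrightarrow> (\<forall>c. (\<Sum>i\<in>I. c i *s v i) \<in> K \<longrightarrow> (\<forall>i\<in>I. c i = 0))"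

definition gen_mod :: "'b set \<Rightarrow> 'i set \<Rightarrow> ('i \<Rightarrow> 'b) \<Rightarrow> 'b set \<Rightarrow> bool" where
  "gen_mod K I v S \<longleftrightarrow> (\<forall>x\<in>S. \<exists>c. x - (\<Sum>i\<in>I. c i *s v i) \<in> K)"

lemma has_dim_subspace: "has_dim S r \<Longrightarrow> subspace S"
  unfolding has_dim_def using subspace_span by blast

lemma has_dim_zero: "has_dim {0} 0"
  unfolding has_dim_def by (rule exI[of _ "{}"]) (auto simp: independent_empty)

lemma has_dim_unique: "has_dim S r \<Longrightarrow> has_dim S r' \<Longrightarrow> r = r'"
  unfolding has_dim_def by (metis dim_span_eq_card_independent)

lemma has_dim_mono:
  assumes "has_dim S r" "subspace K" "K \<subseteq> S"
  obtains k where "has_dim K k" "k \<le> r"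
proof -
  obtain B where B: "finite B" "span B = S" "card B = r"
    using assms(1) unfolding has_dim_def by blast
  obtain A where A: "A \<subseteq> K" "independent A" "K \<subseteq> span A"
    using maximal_independent_subset[of K] by blast
  have "finite A \<and> card A \<le> card B"
    using independent_span_bound[OF B(1) A(2)] A(1) B(2) assms(3) by blast
  moreover have "span A = K" using A assms(2) by (metis span_subspace)
  ultimately show ?thesis using that A(2) B(3) unfolding has_dim_def by blast
qed

lemma sum_delta:
  assumes "finite I" "i \<in> I"
  shows "(\<Sum>j\<in>I. (if j = i then c else 0) *s v j) = c *s v i"
proof -
  have "(\<Sum>j\<in>I. (if j = i then c else 0) *s v j) = (\<Sum>j\<in>I. if j = i then c *s v j else 0)"
    by (rule sum.cong) auto
  then show ?thesis using assms by simp
qed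

text \<open>A relation between a basis of \<open>K\<close> and the \<open>v i\<close> puts the
  combination of the \<open>v i\<close> into \<open>K\<close>, so its coefficients vanish. This
  turns quotient statements into cardinalities of independent sets.\<close>

lemma indep_mod_basis:
  assumes "finite B" "independent B" "span B = K" "finite I" "indep_mod K I v"
  shows "inj_on v I" "B \<inter> v ` I = {}" "independent (B \<union> v ` I)" "card (B \<union> v ` I) = card B + card I"
proof -
  have sK: "subspace K" using assms(3) subspace_span by blast
  have notK: "v i \<notin> K" if "i \<in> I" for i
  proof
    assume "v i \<in> K"
    then have "(\<Sum>j\<in>I. (if j = i then 1 else 0) *s v j) \<in> K"
      using that assms(4) by (simp only: sum_delta) simp
    then show False using assms(5) that unfolding indep_mod_def by fastforce
  qed
  show inj: "inj_on v I"
  proof (rule inj_onI, rule ccontr)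
    fix i j assume ij: "i \<in> I" "j \<in> I" "v i = v j" "i \<noteq> j"
    let ?c = "\<lambda>l. (if l = i then 1 else 0) + (if l = j then -1 else 0 :: 'a)"
    have "(\<Sum>l\<in>I. ?c l *s v l) = 0"
    proof -
      have "(\<Sum>l\<in>I. ?c l *s v l) = 1 *s v i + (-1) *s v j"
        unfolding scale_left_distrib sum.distrib by (simp only: sum_delta[OF assms(4)] ij(1,2))
      then show ?thesis unfolding ij(3) by simp
    qed
    then have "(\<Sum>l\<in>I. ?c l *s v l) \<in> K" using subspace_0[OF sK] by (simp only:)
    then have "\<forall>l\<in>I. ?c l = 0"
      using assms(5)[unfolded indep_mod_def, THEN spec, of ?c] by (rule rev_mp)
    then have "?c i = 0" using ij(1) by (rule bspec)
    then show False using ij(4) by simp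
  qed
  show disj: "B \<inter> v ` I = {}" using notK assms(3) span_base by fastforce
  have split: "(\<Sum>x\<in>B \<union> v ` I. f x *s x) = (\<Sum>x\<in>B. f x *s x) + (\<Sum>i\<in>I. f (v i) *s v i)" for f
    using assms(1,4) disj inj by (simp add: sum.union_disjoint sum.reindex)
  show "independent (B \<union> v ` I)"
  proof (rule independent_if_scalars_zero)
    show "finite (B \<union> v ` I)" using assms by simp
    fix f x assume f: "(\<Sum>x\<in>B \<union> v ` I. f x *s x) = 0" and x: "x \<in> B \<union> v ` I"
    have "(\<Sum>i\<in>I. f (v i) *s v i) = - (\<Sum>x\<in>B. f x *s x)"
      using f unfolding split by (metis add.inverse_unique minus_minus add.commute)
    moreover have "(\<Sum>x\<in>B. f x *s x) \<in> K"
      unfolding assms(3)[symmetric] by (intro span_sum span_scale span_base)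
    ultimately have "(\<Sum>i\<in>I. f (v i) *s v i) \<in> K" using subspace_neg[OF sK] by simp
    then have z: "\<forall>i\<in>I. f (v i) = 0"
      using assms(5)[unfolded indep_mod_def, rule_format, of "\<lambda>i. f (v i)"] by blast
    then have "(\<Sum>x\<in>B. f x *s x) = 0" using f unfolding split by simp
    then have "\<forall>x\<in>B. f x = 0" using independentD[OF assms(2,1)] by blast
    then show "f x = 0" using x z by auto
  qed
  show "card (B \<union> v ` I) = card B + card I"
    using assms(1,4) disj inj by (simp add: card_Un_disjoint card_image)
qed

lemma indep_mod_card_le:
  assumes "has_dim S r" "has_dim K k" "K \<subseteq> S" "finite I" "indep_mod K I v" "v ` I \<subseteq> S"
  shows "k + card I \<le> r"
proof -
  obtain B C where B: "finite B" "independent B" "span B = K" "card B = k"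
    and C: "finite C" "span C = S" "card C = r"
    using assms(1,2) unfolding has_dim_def by blast
  note * = indep_mod_basis[OF B(1-3) assms(4,5)]
  have "B \<union> v ` I \<subseteq> span C" using assms(3,6) B(3) C(2) span_base by blast
  then show ?thesis using independent_span_bound[OF C(1) *(3)] *(4) B(4) C(3) by simp
qed

text \<open>A vector outside the span of the \<open>v i\<close> and a basis of \<open>K\<close>
  would extend them to more than \<open>r\<close> independent vectors in \<open>S\<close>.\<close>

lemma gen_mod_if_card:
  assumes "has_dim S r" "has_dim K k" "K \<subseteq> S" "finite I" "indep_mod K I v" "v ` I \<subseteq> S"
    "r \<le> k + card I"
  shows "gen_mod K I v S"
  unfolding gen_mod_def
proof
  fix x assume x: "x \<in> S"
  obtain B C where B: "finite B" "independent B" "span B = K" "card B = k"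
    and C: "finite C" "span C = S" "card C = r"
    using assms(1,2) unfolding has_dim_def by blast
  note * = indep_mod_basis[OF B(1-3) assms(4,5)]
  have sub: "B \<union> v ` I \<subseteq> S" using assms(3,6) B(3) span_base by blast
  have "x \<in> span (B \<union> v ` I)"
  proof (rule ccontr)
    assume nx: "x \<notin> span (B \<union> v ` I)"
    then have "independent (insert x (B \<union> v ` I))" by (rule independent_insertI[OF _ *(3)])
    moreover have "insert x (B \<union> v ` I) \<subseteq> span C" using sub x C(2) by blast
    ultimately have "finite (insert x (B \<union> v ` I)) \<and> card (insert x (B \<union> v ` I)) \<le> card C"
      by (rule independent_span_bound[OF C(1)])
    moreover have "x \<notin> B \<union> v ` I" using nx span_base[of x] by metis
    then have "card (insert x (B \<union> v ` I)) = Suc (card (B \<union> v ` I))"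
      using B(1) assms(4) by (intro card_insert_disjoint) simp_all
    ultimately show False using assms(7) *(4) B(4) C(3) by simp
  qed
  then obtain f where f: "x = (\<Sum>y\<in>B \<union> v ` I. f y *s y)"
    using span_finite[of "B \<union> v ` I"] B(1) assms(4) by auto
  have "x - (\<Sum>i\<in>I. f (v i) *s v i) = (\<Sum>y\<in>B. f y *s y)"
    unfolding f using B(1) assms(4) *(1,2) by (simp add: sum.union_disjoint sum.reindex)
  also have "\<dots> \<in> K" unfolding B(3)[symmetric] by (intro span_sum span_scale span_base)
  finally show "\<exists>c. x - (\<Sum>i\<in>I. c i *s v i) \<in> K" by (intro exI[of _ "\<lambda>i. f (v i)"])
qed

lemma gen_mod_card_ge:
  assumes "has_dim S r" "has_dim K k" "finite I" "gen_mod K I v S"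
  shows "r \<le> k + card I"
proof -
  obtain B where B: "finite B" "span B = K" "card B = k"
    using assms(2) unfolding has_dim_def by blast
  obtain C where C: "finite C" "independent C" "span C = S" "card C = r"
    using assms(1) unfolding has_dim_def by blast
  have "C \<subseteq> span (B \<union> v ` I)"
  proof
    fix x assume "x \<in> C"
    then have "x \<in> S" using C(3) span_base by blast
    then obtain c where c: "x - (\<Sum>i\<in>I. c i *s v i) \<in> K" using assms(4) unfolding gen_mod_def by blast
    have "x - (\<Sum>i\<in>I. c i *s v i) \<in> span (B \<union> v ` I)" using c B(2) span_mono[of B] by blast
    moreover have "(\<Sum>i\<in>I. c i *s v i) \<in> span (B \<union> v ` I)"
      by (intro span_sum span_scale span_base) auto
    ultimately show "x \<in> span (B \<union> v ` I)" using span_add by fastforce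
  qed
  then have "card C \<le> card (B \<union> v ` I)"
    using independent_span_bound[OF _ C(2), of "B \<union> v ` I"] B(1) assms(3) by simp
  also have "\<dots> \<le> card B + card (v ` I)" by (rule card_Un_le)
  also have "\<dots> \<le> card B + card I" using card_image_le[OF assms(3)] by simp
  finally show ?thesis using B C by simp
qed

lemma complement_family_exists:
  assumes "has_dim S r" "has_dim K k" "K \<subseteq> S"
  obtains e where "e ` {..<r - k} \<subseteq> S" "indep_mod K {..<r - k} e"
proof -
  obtain B where B: "finite B" "independent B" "span B = K" "card B = k"
    using assms(2) unfolding has_dim_def by blast
  have "B \<subseteq> S" using B(3) assms(3) span_base by blast
  then obtain C where C: "B \<subseteq> C" "C \<subseteq> S" "independent C" "S \<subseteq> span C"
    using maximal_independent_subset_extend[OF _ B(2)] by blast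
  have "span C = S" using C has_dim_subspace[OF assms(1)] by (metis span_subspace)
  moreover obtain C' where C': "finite C'" "independent C'" "span C' = S" "card C' = r"
    using assms(1) unfolding has_dim_def by blast
  ultimately have "finite C \<and> card C \<le> r"
    using independent_span_bound[OF C'(1) C(3)] C(2) by auto
  then have fC: "finite C" "card C = r"
    using \<open>span C = S\<close> C(3) C'(2-4) by (auto simp: dim_span_eq_card_independent[symmetric])
  then have "card (C - B) = r - k" using B(1,4) C(1) by (simp add: card_Diff_subset)
  then obtain e where e: "bij_betw e {..<r - k} (C - B)"
    using ex_bij_betw_nat_finite[of "C - B"] fC(1) by (auto simp: atLeast0LessThan)
  show ?thesis
  proof (rule that)
    show "e ` {..<r - k} \<subseteq> S" using e C(2) unfolding bij_betw_def by blast
    show "indep_mod K {..<r - k} e"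
      unfolding indep_mod_def
    proof (intro allI impI)
      fix c assume "(\<Sum>i<r - k. c i *s e i) \<in> K"
      then obtain f where f: "(\<Sum>i<r - k. c i *s e i) = (\<Sum>x\<in>B. f x *s x)"
        using span_finite[OF B(1)] B(3) by auto
      \<comment> \<open>The relation in coordinates on \<open>C\<close>: \<open>- f\<close> on
        \<open>B\<close>, and \<open>c\<close> transported along \<open>e\<close> on the
        rest.\<close>
      define g where "g x = (if x \<in> B then - f x else c (the_inv_into {..<r - k} e x))" for x
      have inj: "inj_on e {..<r - k}" using e by (simp add: bij_betw_def)
      have "(\<Sum>x\<in>C. g x *s x) = (\<Sum>x\<in>B. g x *s x) + (\<Sum>x\<in>C - B. g x *s x)"
        using sum.subset_diff[OF C(1) fC(1)] by (simp add: add.commute)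
      also have "(\<Sum>x\<in>B. g x *s x) = - (\<Sum>x\<in>B. f x *s x)"
        by (simp add: g_def sum_negf)
      also have "(\<Sum>x\<in>C - B. g x *s x) = (\<Sum>i<r - k. g (e i) *s e i)"
        using e unfolding bij_betw_def by (metis (no_types, lifting) sum.reindex_cong)
      also have "\<dots> = (\<Sum>i<r - k. c i *s e i)"
      proof (rule sum.cong[OF refl])
        fix i assume i: "i \<in> {..<r - k}"
        then have "e i \<notin> B" using e unfolding bij_betw_def by blast
        then show "g (e i) *s e i = c i *s e i"
          using i by (simp add: g_def the_inv_into_f_f[OF inj])
      qed
      finally have "(\<Sum>x\<in>C. g x *s x) = 0" using f by simp
      then have z: "g x = 0" if "x \<in> C" for x using independentD[OF C(3) fC(1)] that by blast
      show "\<forall>i\<in>{..<r - k}. c i = 0"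
      proof
        fix i assume i: "i \<in> {..<r - k}"
        then have "e i \<in> C" "e i \<notin> B" using e unfolding bij_betw_def by blast+
        then show "c i = 0" using z[of "e i"] i by (simp add: g_def the_inv_into_f_f[OF inj])
      qed
    qed
  qed
qed

lemma has_dim_if_family:
  assumes "subspace S" "finite I" "v ` I \<subseteq> S" "indep_mod {0} I v" "gen_mod {0} I v S"
  shows "has_dim S (card I)"
proof -
  note * = indep_mod_basis(1,3)[of "{}", OF _ independent_empty _ assms(2,4), simplified]
  have "span (v ` I) = S"
  proof (rule span_subspace[OF assms(3) _ assms(1)], rule subsetI)
    fix x assume "x \<in> S"
    then obtain c where "x = (\<Sum>i\<in>I. c i *s v i)" using assms(5) unfolding gen_mod_def by auto
    moreover have "(\<Sum>i\<in>I. c i *s v i) \<in> span (v ` I)"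
      by (intro span_sum span_scale span_base imageI)
    ultimately show "x \<in> span (v ` I)" by simp
  qed
  then show ?thesis unfolding has_dim_def using *(2) assms(2) by (intro exI[of _ "v ` I"] conjI card_image *(1)) simp_all
qed

end

section \<open>Polynomial functions\<close>

lemma polyfuns_sum:
  "(\<And>i. i \<in> I \<Longrightarrow> f i \<in> polyfuns X) \<Longrightarrow> (\<lambda>p. \<Sum>i\<in>I. f i p) \<in> polyfuns X"
  by (induction I rule: infinite_finite_induct) (auto intro: polyfuns.intros)

lemma polyfuns_prod:
  "(\<And>i. i \<in> I \<Longrightarrow> f i \<in> polyfuns X) \<Longrightarrow> (\<lambda>p. \<Prod>i\<in>I. f i p) \<in> polyfuns X"
  by (induction I rule: infinite_finite_induct) (auto intro: polyfuns.intros)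

lemma polyfuns_power: "f \<in> polyfuns X \<Longrightarrow> (\<lambda>p. f p ^ n) \<in> polyfuns X"
  by (induction n) (auto intro: polyfuns.intros)

lemma polyfuns_diff:
  assumes "f \<in> polyfuns X" "g \<in> polyfuns X"
  shows "(\<lambda>p. f p - g p) \<in> polyfuns X"
  using polyfuns.add[OF assms(1) polyfuns.mult[OF polyfuns.const[of "-1"] assms(2)]] by simp

lemma polyfuns_compose:
  assumes "f \<in> polyfuns X" "\<And>x. x \<in> X \<Longrightarrow> (\<lambda>q. x (\<phi> q)) \<in> polyfuns Y"
  shows "(\<lambda>q. f (\<phi> q)) \<in> polyfuns Y"
  using assms(1) by induction (auto intro: polyfuns.intros assms(2))

lemma polyfuns_line:
  assumes "f \<in> polyfuns {\<lambda>t. t :: 'k::field}"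
  obtains p where "\<And>t. f t = poly p t"
proof -
  have "\<exists>p. \<forall>t. f t = poly p t"
    using assms
  proof induction
    case (const c)
    then show ?case by (intro exI[of _ "[:c:]"]) simp
  next
    case (coord x)
    then show ?case by (intro exI[of _ "[:0, 1:]"]) simp
  next
    case (add f g)
    then obtain p q where "\<forall>t. f t = poly p t" "\<forall>t. g t = poly q t" by blast
    then show ?case by (intro exI[of _ "p + q"]) simp
  next
    case (mult f g)
    then obtain p q where "\<forall>t. f t = poly p t" "\<forall>t. g t = poly q t" by blast
    then show ?case by (intro exI[of _ "p * q"]) simp
  qed
  then show ?thesis using that by blast
qed

text \<open>The source of all finite exceptional sets on lines; wherever the field is assumed
  infinite, it is to avoid such sets.\<close>

lemma polyfuns_line_finite_zeros:
  assumes "f \<in> polyfuns {\<lambda>t. t :: 'k::field}" "f t0 \<noteq> 0"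
  shows "finite {t. f t = 0}"
proof -
  obtain p where p: "\<And>t. f t = poly p t" using polyfuns_line[OF assms(1)] by blast
  then have "p \<noteq> 0" using assms(2) by auto
  then show ?thesis using poly_roots_finite[of p] p by simp
qed

text \<open>Polynomial maps into \<open>k[t]\<close>, read coefficientwise. Closure under sums and
  products makes determinants of polynomial matrices polynomial in the parameters.\<close>

definition coeff_polyfuns :: "('p \<Rightarrow> 'k::field) set \<Rightarrow> ('p \<Rightarrow> 'k poly) \<Rightarrow> bool" where
  "coeff_polyfuns X F \<longleftrightarrow> (\<forall>j. (\<lambda>p. coeff (F p) j) \<in> polyfuns X)"

lemma coeff_polyfuns_const: "coeff_polyfuns X (\<lambda>_. c)"
  by (simp add: coeff_polyfuns_def polyfuns.const)

lemma coeff_polyfuns_add: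
  "coeff_polyfuns X F \<Longrightarrow> coeff_polyfuns X G \<Longrightarrow> coeff_polyfuns X (\<lambda>p. F p + G p)"
  by (simp add: coeff_polyfuns_def polyfuns.add)

lemma coeff_polyfuns_mult:
  "coeff_polyfuns X F \<Longrightarrow> coeff_polyfuns X G \<Longrightarrow> coeff_polyfuns X (\<lambda>p. F p * G p)"
  by (simp add: coeff_polyfuns_def coeff_mult polyfuns_sum polyfuns.mult)

lemma coeff_polyfuns_smult:
  "c \<in> polyfuns X \<Longrightarrow> coeff_polyfuns X F \<Longrightarrow> coeff_polyfuns X (\<lambda>p. smult (c p) (F p))"
  by (simp add: coeff_polyfuns_def polyfuns.mult)

lemma coeff_polyfuns_sum:
  "(\<And>i. i \<in> I \<Longrightarrow> coeff_polyfuns X (F i)) \<Longrightarrow> coeff_polyfuns X (\<lambda>p. \<Sum>i\<in>I. F i p)"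
  by (simp add: coeff_polyfuns_def coeff_sum polyfuns_sum)

lemma coeff_polyfuns_prod:
  "(\<And>i. i \<in> I \<Longrightarrow> coeff_polyfuns X (F i)) \<Longrightarrow> coeff_polyfuns X (\<lambda>p. \<Prod>i\<in>I. F i p)"
  by (induction I rule: infinite_finite_induct) (auto intro: coeff_polyfuns_mult coeff_polyfuns_const)

text \<open>
  Gaussian elimination with a pivot that is nonzero at \<open>p0\<close> turns the family into one with one
  vector less; the function \<open>f\<close> is the product of the successive pivots.
\<close>

lemma independence_is_open:
  fixes w :: "nat \<Rightarrow> 'p \<Rightarrow> 'q \<Rightarrow> 'k::field"
  assumes "\<And>l q. l < r \<Longrightarrow> (\<lambda>p. w l p q) \<in> polyfuns X"
    and "\<And>c. \<forall>q. (\<Sum>l<r. c l * w l p0 q) = 0 \<Longrightarrow> \<forall>l<r. c l = 0"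
  shows "\<exists>f\<in>polyfuns X. f p0 \<noteq> 0 \<and>
    (\<forall>p c. f p \<noteq> 0 \<longrightarrow> (\<forall>q. (\<Sum>l<r. c l * w l p q) = 0) \<longrightarrow> (\<forall>l<r. c l = 0))"
  using assms
proof (induction r arbitrary: w)
  case 0
  then show ?case by (intro bexI[of _ "\<lambda>_. 1"]) (auto intro: polyfuns.const)
next
  case (Suc r)
  have "\<exists>q0. w r p0 q0 \<noteq> 0"
  proof (rule ccontr)
    assume "\<not> ?thesis"
    then have "\<forall>q. (\<Sum>l<Suc r. (if l = r then 1 else 0) * w l p0 q) = 0" by simp
    from Suc.prems(2)[OF this] show False by auto
  qed
  then obtain q0 where q0: "w r p0 q0 \<noteq> 0" by blast
  define u where "u l p q = w r p q0 * w l p q - w l p q0 * w r p q" for l p q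
  have sum_u: "(\<Sum>l<r. c l * u l p q) = (\<Sum>l<Suc r. (if l = r then - (\<Sum>l<r. c l * w l p q0) else c l * w r p q0) * w l p q)"
    for c p q
  proof -
    have "(\<Sum>l<r. c l * u l p q) = (\<Sum>l<r. c l * w r p q0 * w l p q) - (\<Sum>l<r. c l * w l p q0) * w r p q"
      unfolding sum_distrib_right sum_subtractf[symmetric]
      by (rule sum.cong) (simp_all add: u_def algebra_simps)
    then show ?thesis by simp
  qed
  have "\<exists>f\<in>polyfuns X. f p0 \<noteq> 0 \<and>
    (\<forall>p c. f p \<noteq> 0 \<longrightarrow> (\<forall>q. (\<Sum>l<r. c l * u l p q) = 0) \<longrightarrow> (\<forall>l<r. c l = 0))"
  proof (rule Suc.IH)
    show "(\<lambda>p. u l p q) \<in> polyfuns X" if "l < r" for l q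
      unfolding u_def using that Suc.prems(1) by (intro polyfuns_diff polyfuns.mult) auto
    show "\<forall>l<r. c l = 0" if H: "\<forall>q. (\<Sum>l<r. c l * u l p0 q) = 0" for c
    proof (intro allI impI)
      fix l assume l: "l < r"
      then show "c l = 0" using Suc.prems(2)[OF H[unfolded sum_u], rule_format, of l] q0 by simp
    qed
  qed
  then obtain f where f: "f \<in> polyfuns X" "f p0 \<noteq> 0"
    "\<And>p c. f p \<noteq> 0 \<Longrightarrow> \<forall>q. (\<Sum>l<r. c l * u l p q) = 0 \<Longrightarrow> \<forall>l<r. c l = 0" by blast
  show ?case
  proof (intro bexI[of _ "\<lambda>p. f p * w r p q0"] conjI allI impI)
    show "(\<lambda>p. f p * w r p q0) \<in> polyfuns X" using f(1) Suc.prems(1) by (intro polyfuns.mult) auto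
    show "f p0 * w r p0 q0 \<noteq> 0" using f(2) q0 by simp
    fix p c l assume p: "f p * w r p q0 \<noteq> 0" and c: "\<forall>q. (\<Sum>l<Suc r. c l * w l p q) = 0" and l: "l < Suc r"
    have "(\<Sum>l<r. c l * u l p q) = 0" for q
    proof -
      have "(\<Sum>l<r. c l * u l p q) = w r p q0 * (\<Sum>l<Suc r. c l * w l p q) - w r p q * (\<Sum>l<Suc r. c l * w l p q0)"
      proof -
        have "(\<Sum>l<r. c l * u l p q) = w r p q0 * (\<Sum>l<r. c l * w l p q) - w r p q * (\<Sum>l<r. c l * w l p q0)"
          unfolding sum_distrib_left sum_subtractf[symmetric]
          by (rule sum.cong) (simp_all add: u_def algebra_simps)
        moreover have "a * S - b * T = a * (S + e * b) - b * (T + e * a)" for a b S T e :: 'k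
          by (simp add: algebra_simps)
        ultimately show ?thesis unfolding sum.lessThan_Suc by simp
      qed
      then show ?thesis using c by simp
    qed
    then have z: "\<forall>l<r. c l = 0" using f(3)[of p c] p by simp
    then have "c r * w r p q0 = 0" using c[rule_format, of q0] by simp
    then show "c l = 0" using z l p by (auto simp: less_Suc_eq)
  qed
qed

section \<open>The Zariski topology on a set of points\<close>

lemma openin_zariski_subtopology:
  assumes "Z \<subseteq> S"
  shows "openin (subtopology (zariski S X) Z) U \<longleftrightarrow>
    U \<subseteq> Z \<and> (\<forall>z\<in>U. \<exists>f\<in>polyfuns X. f z \<noteq> 0 \<and> (\<forall>y\<in>Z. f y \<noteq> 0 \<longrightarrow> y \<in> U))" (is "?L \<longleftrightarrow> ?R")
proof
  assume ?L
  then obtain F where "F \<subseteq> polyfuns X" "U = (S - zero_locus S F) \<inter> Z"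
    unfolding openin_subtopology openin_zariski by blast
  then show ?R using assms unfolding zero_locus_def by blast
next
  assume R: ?R
  \<comment> \<open>The largest candidate: all functions whose nonvanishing locus in
    \<open>Z\<close> stays inside \<open>U\<close>.\<close>
  define F where "F = {f \<in> polyfuns X. \<forall>y\<in>Z. f y \<noteq> 0 \<longrightarrow> y \<in> U}"
  have "U = (S - zero_locus S F) \<inter> Z"
    using R assms unfolding F_def zero_locus_def by blast
  moreover have "F \<subseteq> polyfuns X" unfolding F_def by blast
  ultimately show ?L unfolding openin_subtopology openin_zariski by blast
qed

lemma openin_zariski_iff:
  "openin (zariski S X) U \<longleftrightarrow>
    U \<subseteq> S \<and> (\<forall>z\<in>U. \<exists>f\<in>polyfuns X. f z \<noteq> 0 \<and> (\<forall>y\<in>S. f y \<noteq> 0 \<longrightarrow> y \<in> U))"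
  using openin_zariski_subtopology[OF order_refl, of S X U] subtopology_topspace[of "zariski S X"] by simp

lemma closedin_zariski_subtopology:
  assumes "Z \<subseteq> S"
  shows "closedin (subtopology (zariski S X) Z) C \<longleftrightarrow>
    C \<subseteq> Z \<and> (\<forall>z\<in>Z - C. \<exists>f\<in>polyfuns X. f z \<noteq> 0 \<and> (\<forall>y\<in>C. f y = 0))"
proof -
  have "topspace (subtopology (zariski S X) Z) = Z" using assms by auto
  moreover have "C \<subseteq> Z \<Longrightarrow> (\<forall>y\<in>Z. f y \<noteq> 0 \<longrightarrow> y \<in> Z - C) \<longleftrightarrow> (\<forall>y\<in>C. f y = 0)" for f :: "'a \<Rightarrow> 'b"
    by blast
  ultimately show ?thesis unfolding closedin_def openin_zariski_subtopology[OF assms]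
    by (cases "C \<subseteq> Z") simp_all
qed

section \<open>Closure and irreducibility in terms of vanishing functions\<close>

lemma topspace_subtopology_zariski: "Z \<subseteq> S \<Longrightarrow> topspace (subtopology (zariski S X) Z) = Z"
  by auto

definition zclosure :: "('p \<Rightarrow> 'k::field) set \<Rightarrow> 'p set \<Rightarrow> 'p set \<Rightarrow> 'p set" where
  "zclosure X P Z = {p \<in> P. \<forall>f\<in>polyfuns X. (\<forall>z\<in>Z. f z = 0) \<longrightarrow> f p = 0}"

lemma closedin_zclosure: "P \<subseteq> S \<Longrightarrow> closedin (subtopology (zariski S X) P) (zclosure X P Z)"
  unfolding closedin_zariski_subtopology zclosure_def by blast

lemma subset_zclosure: "Z \<subseteq> P \<Longrightarrow> Z \<subseteq> zclosure X P Z"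
  unfolding zclosure_def by blast

text \<open>The vanishing ideal of \<open>Z\<close> is prime. This form of irreducibility mentions
  no ambient topology, so it passes freely between subspaces and to closures.\<close>

definition prime_vanishing :: "('p \<Rightarrow> 'k::field) set \<Rightarrow> 'p set \<Rightarrow> bool" where
  "prime_vanishing X Z \<longleftrightarrow> Z \<noteq> {} \<and> (\<forall>f\<in>polyfuns X. \<forall>g\<in>polyfuns X.
     (\<forall>z\<in>Z. f z * g z = 0) \<longrightarrow> (\<forall>z\<in>Z. f z = 0) \<or> (\<forall>z\<in>Z. g z = 0))"

lemma irreducible_space_zariski:
  assumes "Z \<subseteq> S"
  shows "irreducible_space (subtopology (zariski S X) Z) \<longleftrightarrow> prime_vanishing X Z"
proof
  assume irr: "irreducible_space (subtopology (zariski S X) Z)"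
  show "prime_vanishing X Z"
    unfolding prime_vanishing_def
  proof (intro conjI ballI impI)
    show "Z \<noteq> {}" using irr unfolding irreducible_space_def topspace_subtopology_zariski[OF assms] by blast
    fix f g assume fg: "f \<in> polyfuns X" "g \<in> polyfuns X" "\<forall>z\<in>Z. f z * g z = 0"
    have cl: "closedin (subtopology (zariski S X) Z) {z\<in>Z. h z = 0}" if "h \<in> polyfuns X" for h
      using that unfolding closedin_zariski_subtopology[OF assms] by auto
    have "Z = {z\<in>Z. f z = 0} \<union> {z\<in>Z. g z = 0}" using fg(3) by auto
    then have "Z = {z\<in>Z. f z = 0} \<or> Z = {z\<in>Z. g z = 0}"
      using irr cl[OF fg(1)] cl[OF fg(2)] unfolding irreducible_space_def topspace_subtopology_zariski[OF assms]
      by metis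
    then show "(\<forall>z\<in>Z. f z = 0) \<or> (\<forall>z\<in>Z. g z = 0)" by blast
  qed
next
  assume pr: "prime_vanishing X Z"
  show "irreducible_space (subtopology (zariski S X) Z)"
    unfolding irreducible_space_def topspace_subtopology_zariski[OF assms]
  proof (intro conjI allI impI)
    show "Z \<noteq> {}" using pr unfolding prime_vanishing_def by blast
    fix C D assume C: "closedin (subtopology (zariski S X) Z) C" and D: "closedin (subtopology (zariski S X) Z) D"
      and Z: "Z = C \<union> D"
    show "Z = C \<or> Z = D"
    proof (rule ccontr)
      assume "\<not> (Z = C \<or> Z = D)"
      then obtain x y where "x \<in> Z - C" "y \<in> Z - D" using Z by blast
      then obtain f g where fg: "f \<in> polyfuns X" "f x \<noteq> 0" "\<forall>z\<in>C. f z = 0" "g \<in> polyfuns X" "g y \<noteq> 0" "\<forall>z\<in>D. g z = 0"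
        using C D unfolding closedin_zariski_subtopology[OF assms] by metis
      then have "\<forall>z\<in>Z. f z * g z = 0" using Z by auto
      then show False using pr fg \<open>x \<in> Z - C\<close> \<open>y \<in> Z - D\<close> unfolding prime_vanishing_def by blast
    qed
  qed
qed

text \<open>A set and its closure have the same vanishing ideal.\<close>

lemma prime_vanishing_zclosure:
  assumes "prime_vanishing X Z" "Z \<subseteq> P"
  shows "prime_vanishing X (zclosure X P Z)"
proof -
  have *: "(\<forall>z\<in>zclosure X P Z. f z = 0) \<longleftrightarrow> (\<forall>z\<in>Z. f z = 0)" if "f \<in> polyfuns X" for f
    using that assms(2) unfolding zclosure_def by blast
  show ?thesis unfolding prime_vanishing_def
  proof (intro conjI ballI impI)
    show "zclosure X P Z \<noteq> {}" using assms subset_zclosure[OF assms(2)] unfolding prime_vanishing_def by blast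
    fix f g assume fg: "f \<in> polyfuns X" "g \<in> polyfuns X" "\<forall>z\<in>zclosure X P Z. f z * g z = 0"
    then have "\<forall>z\<in>Z. f z * g z = 0" using subset_zclosure[OF assms(2)] by blast
    then show "(\<forall>z\<in>zclosure X P Z. f z = 0) \<or> (\<forall>z\<in>zclosure X P Z. g z = 0)"
      using assms(1) fg unfolding prime_vanishing_def *[OF fg(1)] *[OF fg(2)] by blast
  qed
qed

text \<open>If \<open>f\<close> is nonzero at one end of a path and \<open>g\<close> at the other,
  both are nonzero for all but finitely many parameters; an infinite field has a parameter at which
  the path also lies in \<open>Z\<close>.\<close>

lemma prime_vanishing_if_paths:
  assumes inf: "infinite (UNIV :: 'k::field set)" and ne: "Z \<noteq> {}"
    and paths: "\<And>z1 z2. z1 \<in> Z \<Longrightarrow> z2 \<in> Z \<Longrightarrow> \<exists>\<gamma> :: 'k \<Rightarrow> 'p. (\<forall>x\<in>X. (\<lambda>t. x (\<gamma> t)) \<in> polyfuns {\<lambda>t. t}) \<and>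
      \<gamma> 0 = z1 \<and> \<gamma> 1 = z2 \<and> finite {t. \<gamma> t \<notin> Z}"
  shows "prime_vanishing X Z"
  unfolding prime_vanishing_def
proof (intro conjI ballI impI)
  show "Z \<noteq> {}" by (rule ne)
  fix f g assume f: "f \<in> polyfuns X" and g: "g \<in> polyfuns X" and fg: "\<forall>z\<in>Z. f z * g z = 0"
  show "(\<forall>z\<in>Z. f z = 0) \<or> (\<forall>z\<in>Z. g z = 0)"
  proof (rule ccontr)
    assume "\<not> ?thesis"
    then obtain z1 z2 where z: "z1 \<in> Z" "f z1 \<noteq> 0" "z2 \<in> Z" "g z2 \<noteq> 0" by blast
    obtain \<gamma> where \<gamma>: "\<forall>x\<in>X. (\<lambda>t. x (\<gamma> t)) \<in> polyfuns {\<lambda>t. t}" "\<gamma> 0 = z1" "\<gamma> 1 = z2" "finite {t. \<gamma> t \<notin> Z}"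
      using paths[OF z(1,3)] by blast
    have "finite {t. f (\<gamma> t) = 0}"
      by (rule polyfuns_line_finite_zeros[of _ 0]) (use f \<gamma> z polyfuns_compose[of f X \<gamma>] in auto)
    moreover have "finite {t. g (\<gamma> t) = 0}"
      by (rule polyfuns_line_finite_zeros[of _ 1]) (use g \<gamma> z polyfuns_compose[of g X \<gamma>] in auto)
    moreover have "UNIV \<subseteq> {t. f (\<gamma> t) = 0} \<union> {t. g (\<gamma> t) = 0} \<union> {t. \<gamma> t \<notin> Z}" using fg by auto
    ultimately have "finite (UNIV :: 'k set)" using \<gamma>(4) by (meson finite_UnI finite_subset)
    then show False using inf by blast
  qed
qed

lemma path_in_open:
  assumes "openin (zariski S X) U" "\<And>t. \<gamma> t \<in> S" "\<gamma> t0 \<in> U"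
    "\<forall>x\<in>X. (\<lambda>t. x (\<gamma> t)) \<in> polyfuns {\<lambda>t. t :: 'k::field}"
  shows "finite {t. \<gamma> t \<notin> U}"
proof -
  obtain f where f: "f \<in> polyfuns X" "f (\<gamma> t0) \<noteq> 0" "\<forall>y\<in>S. f y \<noteq> 0 \<longrightarrow> y \<in> U"
    using assms(1,3) unfolding openin_zariski_iff by blast
  have "finite {t. f (\<gamma> t) = 0}"
    by (rule polyfuns_line_finite_zeros[of _ t0]) (use f assms polyfuns_compose[of f X \<gamma>] in auto)
  then show ?thesis by (rule rev_finite_subset) (use f(3) assms(2) in auto)
qed

section \<open>Syzygies of dehomogenized tuples\<close>

interpretation pv: dim_vector_space "smult :: 'k::field \<Rightarrow> 'k poly \<Rightarrow> 'k poly"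
  by unfold_locales (simp_all add: smult_add_right smult_add_left)

interpretation vv: dim_vector_space "\<lambda>c::'k::field. smult [:c:] :: 'k poly poly \<Rightarrow> 'k poly poly"
  by unfold_locales (simp_all add: smult_add_right smult_add_left[symmetric] mult.commute pCons_one)

text \<open>
  A form of degree \<open>m\<close> is identified with its dehomogenization at \<open>s = 1\<close>, a polynomial of degree
  at most \<open>m\<close>, and a tuple \<open>(g 0, \<dots>, g d)\<close> of these with the polynomial whose \<open>i\<close>-th coefficient
  is \<open>g i\<close>.
\<close>

definition vecs :: "nat \<Rightarrow> nat \<Rightarrow> 'k::field poly poly set" where
  "vecs d m = {g. \<forall>i j. coeff (coeff g i) j \<noteq> 0 \<longrightarrow> i \<le> d \<and> j \<le> m}"

definition dotv :: "nat \<Rightarrow> (nat \<Rightarrow> 'k::field poly) \<Rightarrow> 'k poly poly \<Rightarrow> 'k poly" where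
  "dotv d a g = (\<Sum>i\<le>d. a i * coeff g i)"

definition syz :: "nat \<Rightarrow> (nat \<Rightarrow> 'k::field poly) \<Rightarrow> nat \<Rightarrow> 'k poly poly set" where
  "syz d a m = {g \<in> vecs d m. dotv d a g = 0}"

text \<open>In homogeneous terms: the ideal generated by the tuple contains every form of degree n +
  m. The bound on the lift \<open>v\<close> is what retains the information at s = 0.\<close>

definition surj_at :: "nat \<Rightarrow> nat \<Rightarrow> (nat \<Rightarrow> 'k::field poly) \<Rightarrow> nat \<Rightarrow> bool" where
  "surj_at d n a m \<longleftrightarrow> (\<forall>q. degree q \<le> n + m \<longrightarrow> (\<exists>v\<in>vecs d m. dotv d a v = q))"

definition poly_indep :: "nat \<Rightarrow> (nat \<Rightarrow> 'k::field poly poly) \<Rightarrow> bool" where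
  "poly_indep d P \<longleftrightarrow> (\<forall>h. (\<Sum>j<d. smult (h j) (P j)) = 0 \<longrightarrow> (\<forall>j<d. h j = 0))"

text \<open>The bound is put on exponents rather than on \<open>degree (h j)\<close>: it forces
  \<open>h j = 0\<close> when \<open>\<mu> ! j\<close> exceeds \<open>m\<close>, which a truncated
  \<open>m - \<mu> ! j\<close> would not.\<close>

abbreviation graded_comb ::
    "nat \<Rightarrow> nat list \<Rightarrow> (nat \<Rightarrow> 'k::field poly poly) \<Rightarrow> nat \<Rightarrow> 'k poly poly \<Rightarrow> bool" where
  "graded_comb d \<mu> P m g \<equiv> \<exists>h. g = (\<Sum>j<d. smult (h j) (P j)) \<and>
     (\<forall>j<d. \<forall>i. coeff (h j) i \<noteq> 0 \<longrightarrow> i + \<mu> ! j \<le> m)"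

text \<open>What is left of \<open>graded_resolution\<close> after setting s = 1: injectivity
  becomes independence over k[t], exactness in the middle becomes generation with degree
  bounds.\<close>

definition syz_basis :: "nat \<Rightarrow> (nat \<Rightarrow> 'k::field poly) \<Rightarrow> nat list \<Rightarrow> (nat \<Rightarrow> 'k poly poly) \<Rightarrow> bool" where
  "syz_basis d a \<mu> P \<longleftrightarrow> (\<forall>j<d. P j \<in> syz d a (\<mu> ! j)) \<and> poly_indep d P \<and>
     (\<forall>m. \<forall>g\<in>syz d a m. graded_comb d \<mu> P m g)"

text \<open>The Hilbert function of a graded free module over k[s,t] with generators in degrees
  \<open>\<mu> ! j\<close>; truncated subtraction supplies the maximum with 0.\<close>

definition hilb :: "nat \<Rightarrow> nat list \<Rightarrow> nat \<Rightarrow> nat" where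
  "hilb d \<mu> m = (\<Sum>j<d. m + 1 - \<mu> ! j)"

section \<open>Tuples and polynomials of bounded degree\<close>

lemma vecs_iff: "g \<in> vecs d m \<longleftrightarrow> (\<forall>i>d. coeff g i = 0) \<and> (\<forall>i. degree (coeff g i) \<le> m)"
proof
  assume g: "g \<in> vecs d m"
  have "coeff g i = 0" if "i > d" for i
    using g that unfolding vecs_def by (intro poly_eqI) (auto simp flip: not_le)
  moreover have "degree (coeff g i) \<le> m" for i
    using g unfolding vecs_def by (intro degree_le) (auto simp flip: not_le)
  ultimately show "(\<forall>i>d. coeff g i = 0) \<and> (\<forall>i. degree (coeff g i) \<le> m)" by blast
next
  assume r: "(\<forall>i>d. coeff g i = 0) \<and> (\<forall>i. degree (coeff g i) \<le> m)"
  have "i \<le> d \<and> j \<le> m" if "coeff (coeff g i) j \<noteq> 0" for i j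
    using r that le_degree[of "coeff g i" j] by (metis coeff_0 le_trans not_le)
  then show "g \<in> vecs d m" unfolding vecs_def by blast
qed

lemma vecs_subspace: "vv.subspace (vecs d m)"
  by (rule vv.subspaceI) (auto simp: vecs_def, (metis add.left_neutral)+)

lemma vecs_smult:
  assumes "g \<in> vecs d m" "degree q + m \<le> m'"
  shows "smult q g \<in> vecs d m'"
proof -
  have "degree (q * coeff g i) \<le> m'" for i
    using assms degree_mult_le[of q "coeff g i"] unfolding vecs_iff by (meson add_le_cancel_left le_trans)
  then show ?thesis using assms(1) unfolding vecs_iff by simp
qed

lemma vecs_mono: "g \<in> vecs d m \<Longrightarrow> m \<le> m' \<Longrightarrow> g \<in> vecs d m'"
  unfolding vecs_iff by (meson le_trans)

lemma coeff_monom_family: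
  "coeff (coeff (\<Sum>p\<in>{..d} \<times> {..m}. smult [:c p:] (monom (monom 1 (snd p)) (fst p))) i) j =
    (if i \<le> d \<and> j \<le> m then c (i, j) else (0 :: 'k::field))"
proof -
  have "coeff (coeff (\<Sum>p\<in>{..d} \<times> {..m}. smult [:c p:] (monom (monom 1 (snd p)) (fst p))) i) j =
      (\<Sum>p\<in>{..d} \<times> {..m}. if p = (i, j) then c p else 0)"
    unfolding coeff_sum by (rule sum.cong) auto
  also have "\<dots> = (if (i, j) \<in> {..d} \<times> {..m} then c (i, j) else 0)" by (subst sum.delta) auto
  finally show ?thesis by simp
qed

lemma has_dim_vecs: "vv.has_dim (vecs d m :: 'k::field poly poly set) ((d + 1) * (m + 1))"
proof -
  let ?I = "{..d} \<times> {..m}"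
  let ?v = "\<lambda>p. monom (monom (1::'k) (snd p)) (fst p)"
  have "vv.has_dim (vecs d m :: 'k poly poly set) (card ?I)"
  proof (rule vv.has_dim_if_family[OF vecs_subspace])
    show "?v ` ?I \<subseteq> vecs d m" by (auto simp: vecs_def split: if_splits)
    show "vv.indep_mod {0} ?I ?v"
      unfolding vv.indep_mod_def
    proof (intro allI impI)
      fix c :: "nat \<times> nat \<Rightarrow> 'k" assume "(\<Sum>p\<in>?I. smult [:c p:] (?v p)) \<in> {0}"
      then have "(if i \<le> d \<and> j \<le> m then c (i, j) else 0) = 0" for i j
        unfolding coeff_monom_family[symmetric] by simp
      then have "c (i, j) = 0" if "i \<le> d" "j \<le> m" for i j using that by meson
      then show "\<forall>p\<in>?I. c p = 0" by auto
    qed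
    show "vv.gen_mod {0} ?I ?v (vecs d m)"
      unfolding vv.gen_mod_def
    proof
      fix g :: "'k poly poly" assume g: "g \<in> vecs d m"
      have "g = (\<Sum>p\<in>?I. smult [:coeff (coeff g (fst p)) (snd p):] (?v p))"
      proof (intro poly_eqI)
        fix i j
        show "coeff (coeff g i) j = coeff (coeff (\<Sum>p\<in>?I. smult [:coeff (coeff g (fst p)) (snd p):] (?v p)) i) j"
          using g unfolding coeff_monom_family vecs_def by auto
      qed
      then have "g - (\<Sum>p\<in>?I. smult [:coeff (coeff g (fst p)) (snd p):] (?v p)) \<in> {0}"
        unfolding singleton_iff right_minus_eq .
      then show "\<exists>c. g - (\<Sum>p\<in>?I. smult [:c p:] (?v p)) \<in> {0}"
        by (rule exI[of _ "\<lambda>p. coeff (coeff g (fst p)) (snd p)"])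
    qed
  qed simp
  then show ?thesis by (simp add: card_cartesian_product)
qed

lemma coeff_monom_sum: "coeff (\<Sum>i<s. monom (c i) i) j = (if j < s then c j else (0 :: 'a::comm_ring_1))"
  by (simp add: coeff_sum sum.delta if_distrib cong: if_cong)

lemma has_dim_polys: "pv.has_dim {q :: 'k::field poly. degree q \<le> N} (N + 1)"
proof -
  let ?v = "\<lambda>i. monom (1::'k) i"
  have "pv.has_dim {q :: 'k poly. degree q \<le> N} (card {..<N + 1})"
  proof (rule pv.has_dim_if_family)
    show "pv.subspace {q :: 'k poly. degree q \<le> N}"
      by (rule pv.subspaceI) (auto intro: degree_add_le le_trans[OF degree_smult_le])
    show "?v ` {..<N + 1} \<subseteq> {q. degree q \<le> N}" by (auto simp: degree_monom_eq)
    show "pv.indep_mod {0} {..<N + 1} ?v"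
      unfolding pv.indep_mod_def
    proof (intro allI impI ballI)
      fix c :: "nat \<Rightarrow> 'k" and i assume "(\<Sum>i<N + 1. smult (c i) (?v i)) \<in> {0}" "i \<in> {..<N + 1}"
      then show "c i = 0" using coeff_monom_sum[of c "N + 1" i] by (simp add: smult_monom)
    qed
    show "pv.gen_mod {0} {..<N + 1} ?v {q. degree q \<le> N}"
      unfolding pv.gen_mod_def
    proof
      fix q :: "'k poly" assume "q \<in> {q. degree q \<le> N}"
      then have "q - (\<Sum>i<N + 1. smult (coeff q i) (?v i)) \<in> {0}"
        by (auto intro!: poly_eqI simp: smult_monom coeff_monom_sum coeff_eq_0 simp del: sum.lessThan_Suc)
      then show "\<exists>c. q - (\<Sum>i<N + 1. smult (c i) (?v i)) \<in> {0}" by blast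
    qed
  qed simp
  then show ?thesis by simp
qed

section \<open>The pairing with a tuple and its kernel\<close>

lemma dotv_0 [simp]: "dotv d a 0 = 0" by (simp add: dotv_def)
lemma dotv_add: "dotv d a (g + h) = dotv d a g + dotv d a h"
  by (simp add: dotv_def distrib_left sum.distrib)
lemma dotv_diff: "dotv d a (g - h) = dotv d a g - dotv d a h"
  by (simp add: dotv_def right_diff_distrib sum_subtractf)
lemma dotv_smult: "dotv d a (smult q g) = q * dotv d a g"
  by (simp add: dotv_def sum_distrib_left mult_ac)
lemma dotv_sum: "dotv d a (\<Sum>i\<in>I. g i) = (\<Sum>i\<in>I. dotv d a (g i))"
  by (induction I rule: infinite_finite_induct) (auto simp: dotv_add)

lemma dotv_monom: "i \<le> d \<Longrightarrow> dotv d a (monom q i) = a i * q"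
proof -
  assume "i \<le> d"
  moreover have "dotv d a (monom q i) = (\<Sum>l\<le>d. if l = i then a i * q else 0)"
    unfolding dotv_def by (rule sum.cong) auto
  ultimately show ?thesis by simp
qed

lemma degree_dotv:
  assumes "\<forall>i\<le>d. degree (a i) \<le> n" "g \<in> vecs d m"
  shows "degree (dotv d a g) \<le> n + m"
  unfolding dotv_def
proof (rule degree_sum_le)
  fix i assume "i \<in> {..d}"
  then show "degree (a i * coeff g i) \<le> n + m"
    using assms degree_mult_le[of "a i" "coeff g i"] unfolding vecs_iff by (meson add_mono atMost_iff le_trans)
qed simp

lemma syz_subset: "syz d a m \<subseteq> vecs d m" unfolding syz_def by blast

lemma syz_subspace: "vv.subspace (syz d a m)"
  using vecs_subspace[of d m] unfolding vv.subspace_def syz_def by (auto simp: dotv_add dotv_smult)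

lemma syz_smult: "g \<in> syz d a m \<Longrightarrow> degree q + m \<le> m' \<Longrightarrow> smult q g \<in> syz d a m'"
  unfolding syz_def using vecs_smult by (auto simp: dotv_smult)

lemma syz_mono: "g \<in> syz d a m \<Longrightarrow> m \<le> m' \<Longrightarrow> g \<in> syz d a m'"
  unfolding syz_def using vecs_mono by blast

text \<open>Rank and nullity: lifts \<open>e l\<close> of the monomials t^l form a basis of
  \<open>vecs d m\<close> modulo the syzygies.\<close>

lemma surj_syz_dim:
  assumes "\<forall>i\<le>d. degree (a i) \<le> n" "surj_at d n a m"
  shows "vv.has_dim (syz d a m) ((d + 1) * (m + 1) - (n + m + 1))" "n + m + 1 \<le> (d + 1) * (m + 1)"
proof -
  obtain k where k: "vv.has_dim (syz d a m) k"
    using vv.has_dim_mono[OF has_dim_vecs syz_subspace syz_subset] by blast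
  have "\<exists>v\<in>vecs d m. dotv d a v = monom 1 l" if "l < n + m + 1" for l
    using assms(2) that degree_monom_le[of 1 l] unfolding surj_at_def by (metis Suc_eq_plus1 le_trans less_Suc_eq_le)
  then obtain e where e: "\<And>l. l < n + m + 1 \<Longrightarrow> e l \<in> vecs d m \<and> dotv d a (e l) = monom 1 l" by metis
  have dot_e: "dotv d a (\<Sum>l<n + m + 1. smult [:c l:] (e l)) = (\<Sum>l<n + m + 1. monom (c l) l)" for c
    unfolding dotv_sum by (rule sum.cong) (use e in \<open>auto simp: dotv_smult smult_monom\<close>)
  have sub: "e ` {..<n + m + 1} \<subseteq> vecs d m" using e by blast
  have indep: "vv.indep_mod (syz d a m) {..<n + m + 1} e"
    unfolding vv.indep_mod_def
  proof (intro allI impI ballI)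
    fix c l assume c: "(\<Sum>l<n + m + 1. smult [:c l:] (e l)) \<in> syz d a m" and l: "l \<in> {..<n + m + 1}"
    then have "(\<Sum>l<n + m + 1. monom (c l) l) = 0" unfolding dot_e[symmetric] syz_def by blast
    then show "c l = 0" using coeff_monom_sum[of c "n + m + 1" l] l by simp
  qed
  have gen: "vv.gen_mod (syz d a m) {..<n + m + 1} e (vecs d m)"
    unfolding vv.gen_mod_def
  proof
    fix g :: "'a poly poly" assume g: "g \<in> vecs d m"
    let ?s = "\<Sum>l<n + m + 1. smult [:coeff (dotv d a g) l:] (e l)"
    have "?s \<in> vecs d m"
      by (rule vv.subspace_sum[OF vecs_subspace vv.subspace_scale[OF vecs_subspace]]) (use e in auto)
    then have "g - ?s \<in> vecs d m" by (rule vv.subspace_diff[OF vecs_subspace g])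
    moreover have "dotv d a ?s = dotv d a g"
      unfolding dot_e using degree_dotv[OF assms(1) g]
      by (intro poly_eqI) (auto simp: coeff_monom_sum coeff_eq_0 simp del: sum.lessThan_Suc)
    ultimately have "g - ?s \<in> syz d a m" unfolding syz_def by (simp add: dotv_diff)
    then show "\<exists>c. g - (\<Sum>l<n + m + 1. smult [:c l:] (e l)) \<in> syz d a m" by blast
  qed
  have "k + (n + m + 1) = (d + 1) * (m + 1)"
    using vv.indep_mod_card_le[OF has_dim_vecs k syz_subset _ indep sub]
      vv.gen_mod_card_ge[OF has_dim_vecs k _ gen] by simp
  then show "vv.has_dim (syz d a m) ((d + 1) * (m + 1) - (n + m + 1))" "n + m + 1 \<le> (d + 1) * (m + 1)"
    using k by (metis diff_add_inverse2, linarith)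
qed

text \<open>The pairing is injective on a complement of the syzygies, whose dimension is at least
  that of the polynomials of degree at most n + m; so the image fills that space.\<close>

lemma syz_dim_surj:
  assumes "\<forall>i\<le>d. degree (a i) \<le> n" "vv.has_dim (syz d a m) k" "k + (n + m + 1) \<le> (d + 1) * (m + 1)"
  shows "surj_at d n a m"
  unfolding surj_at_def
proof (intro allI impI)
  fix q :: "'a poly" assume q: "degree q \<le> n + m"
  define r where "r = (d + 1) * (m + 1) - k"
  obtain e where e: "e ` {..<r} \<subseteq> vecs d m" "vv.indep_mod (syz d a m) {..<r} e"
    using vv.complement_family_exists[OF has_dim_vecs assms(2) syz_subset] unfolding r_def by metis
  let ?w = "\<lambda>l. dotv d a (e l)"
  have sum_vecs: "(\<Sum>l<r. smult [:c l:] (e l)) \<in> vecs d m" for c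
    by (rule vv.subspace_sum[OF vecs_subspace vv.subspace_scale[OF vecs_subspace]]) (use e in auto)
  have dot: "dotv d a (\<Sum>l<r. smult [:c l:] (e l)) = (\<Sum>l<r. smult (c l) (?w l))" for c
    by (simp add: dotv_sum dotv_smult)
  have "pv.indep_mod {0} {..<r} ?w"
    unfolding pv.indep_mod_def
  proof (intro allI impI)
    fix c assume "(\<Sum>l<r. smult (c l) (?w l)) \<in> {0}"
    then have "(\<Sum>l<r. smult [:c l:] (e l)) \<in> syz d a m"
      using sum_vecs unfolding syz_def dot[symmetric] by simp
    then show "\<forall>l\<in>{..<r}. c l = 0" using e(2) unfolding vv.indep_mod_def by blast
  qed
  moreover have "?w ` {..<r} \<subseteq> {q. degree q \<le> n + m}"
    using e(1) degree_dotv[OF assms(1)] by blast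
  ultimately have "pv.gen_mod {0} {..<r} ?w {q. degree q \<le> n + m}"
    using assms(3) by (intro pv.gen_mod_if_card[OF has_dim_polys pv.has_dim_zero]) (auto simp: r_def)
  then obtain c where "q = (\<Sum>l<r. smult (c l) (?w l))" using q unfolding pv.gen_mod_def by auto
  then show "\<exists>v\<in>vecs d m. dotv d a v = q" using sum_vecs dot by metis
qed

text \<open>For q = c + t q', the constant is already reached in degree m, and t times a lift of q'
  costs one degree.\<close>

lemma surj_at_Suc:
  assumes "surj_at d n a m"
  shows "surj_at d n a (Suc m)"
  unfolding surj_at_def
proof (intro allI impI)
  fix q :: "'a poly" assume q: "degree q \<le> n + Suc m"
  obtain c q' where cq: "q = pCons c q'" by (cases q)
  have "degree q' \<le> n + m" using q unfolding cq by (cases "q' = 0") auto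
  then obtain v' v0 where v: "v' \<in> vecs d m" "dotv d a v' = q'" "v0 \<in> vecs d m" "dotv d a v0 = [:c:]"
    using assms unfolding surj_at_def by (metis degree_pCons_0 le0)
  have "v0 + smult [:0, 1:] v' \<in> vecs d (Suc m)"
    by (intro vv.subspace_add[OF vecs_subspace] vecs_smult[OF v(1)] vecs_mono[OF v(3)]) auto
  moreover have "dotv d a (v0 + smult [:0, 1:] v') = q" using v by (simp add: dotv_add dotv_smult cq)
  ultimately show "\<exists>v\<in>vecs d (Suc m). dotv d a v = q" by blast
qed

lemma surj_at_mono: "surj_at d n a m \<Longrightarrow> m \<le> m' \<Longrightarrow> surj_at d n a m'"
proof (rotate_tac, induction m' rule: dec_induct)
qed (auto intro: surj_at_Suc)

text \<open>For m at least n no part exceeds m, so no subtraction in \<open>hilb\<close> is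
  truncated. The resulting value is the kernel dimension of a surjection onto the polynomials of
  degree at most n + m.\<close>

lemma hilb_large:
  assumes "length \<mu> = d" "sum_list \<mu> = n" "n \<le> m"
  shows "hilb d \<mu> m + (n + m + 1) = (d + 1) * (m + 1)"
proof -
  have s: "(\<Sum>j<d. \<mu> ! j) = n" using assms by (simp add: sum_list_sum_nth atLeast0LessThan)
  have le: "\<mu> ! j \<le> m" if "j < d" for j
    using assms elem_le_sum_list[of j \<mu>] that by simp
  have "hilb d \<mu> m + n = (\<Sum>j<d. (m + 1 - \<mu> ! j) + \<mu> ! j)" unfolding hilb_def sum.distrib s ..
  also have "\<dots> = (\<Sum>j<d. m + 1)" by (rule sum.cong) (use le in \<open>auto simp: le_SucI\<close>)
  also have "\<dots> = d * (m + 1)" by simp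
  finally show ?thesis by simp
qed

section \<open>From k[t]-bases of the syzygies to k-bases in each degree\<close>

lemma smult_sum_right: "smult q (\<Sum>i\<in>I. f i) = (\<Sum>i\<in>I. smult q (f i))"
  by (induction I rule: infinite_finite_induct) (auto simp: smult_add_right)

lemma monomial_family_sum:
  fixes d :: nat
  shows "(\<Sum>p\<in>Sigma {..<d} (\<lambda>j. {..<s j}). smult [:c p:] (smult (monom 1 (snd p)) (P (fst p)))) =
    (\<Sum>j<d. smult (\<Sum>i<s j. monom (c (j, i)) i) (P j :: 'k::field poly poly))"
proof -
  have "(\<Sum>p\<in>Sigma {..<d} (\<lambda>j. {..<s j}). smult [:c p:] (smult (monom 1 (snd p)) (P (fst p)))) =
    (\<Sum>j<d. \<Sum>i<s j. smult [:c (j, i):] (smult (monom 1 i) (P j)))"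
    by (subst sum.Sigma) (simp_all add: case_prod_unfold)
  also have "\<dots> = (\<Sum>j<d. smult (\<Sum>i<s j. monom (c (j, i)) i) (P j))"
    by (simp add: smult_sum smult_monom)
  finally show ?thesis .
qed

lemma monomial_family_indep:
  assumes "poly_indep d P"
  shows "vv.indep_mod {0} (Sigma {..<d} (\<lambda>j. {..<s j})) (\<lambda>p. smult (monom 1 (snd p)) (P (fst p)))"
  unfolding vv.indep_mod_def monomial_family_sum
proof (intro allI impI)
  fix c assume "(\<Sum>j<d. smult (\<Sum>i<s j. monom (c (j, i)) i) (P j)) \<in> {0}"
  then have "\<forall>j<d. (\<Sum>i<s j. monom (c (j, i)) i) = 0"
    using assms[unfolded poly_indep_def, rule_format, of "\<lambda>j. \<Sum>i<s j. monom (c (j, i)) i"] by simp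
  then have "c (j, i) = 0" if "j < d" "i < s j" for i j
    using coeff_monom_sum[of "\<lambda>i. c (j, i)" "s j" i] that by simp
  then show "\<forall>p\<in>Sigma {..<d} (\<lambda>j. {..<s j}). c p = 0" by auto
qed

lemma monomial_family_syz:
  assumes "\<forall>j<d. P j \<in> syz d a (\<mu> ! j)"
  shows "(\<lambda>p. smult (monom 1 (snd p)) (P (fst p))) ` (Sigma {..<d} (\<lambda>j. {..<m + 1 - \<mu> ! j})) \<subseteq> syz d a m"
proof -
  have "smult (monom 1 i) (P j) \<in> syz d a m" if "j < d" "i < m + 1 - \<mu> ! j" for i j
    using assms that by (intro syz_smult[of _ _ _ "\<mu> ! j"]) (auto simp: degree_monom_eq)
  then show ?thesis by auto
qed

text \<open>The multiples of \<open>P j\<close> by t^i with \<open>i + \<mu> ! j \<le> m\<close>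
  form a k-basis.\<close>

lemma syz_basis_dim:
  assumes "syz_basis d a \<mu> P"
  shows "vv.has_dim (syz d a m) (hilb d \<mu> m)"
proof -
  let ?I = "Sigma {..<d} (\<lambda>j. {..<m + 1 - \<mu> ! j})"
  let ?v = "\<lambda>p. smult (monom 1 (snd p)) (P (fst p))"
  have "vv.has_dim (syz d a m) (card ?I)"
  proof (rule vv.has_dim_if_family[OF syz_subspace])
    show "vv.gen_mod {0} ?I ?v (syz d a m)"
      unfolding vv.gen_mod_def
    proof
      fix g assume "g \<in> syz d a m"
      then obtain h where h: "g = (\<Sum>j<d. smult (h j) (P j))" "\<forall>j<d. \<forall>i. coeff (h j) i \<noteq> 0 \<longrightarrow> i + \<mu> ! j \<le> m"
        using assms unfolding syz_basis_def by blast
      have "h j = (\<Sum>i<m + 1 - \<mu> ! j. monom (coeff (h j) i) i)" if "j < d" for j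
      proof (rule poly_eqI)
        fix i
        show "coeff (h j) i = coeff (\<Sum>i<m + 1 - \<mu> ! j. monom (coeff (h j) i) i) i"
          unfolding coeff_monom_sum using h(2) that by fastforce
      qed
      then have "g = (\<Sum>j<d. smult (\<Sum>i<m + 1 - \<mu> ! j. monom (coeff (h j) i) i) (P j))"
        unfolding h(1) by (intro sum.cong) auto
      then have "g - (\<Sum>p\<in>?I. smult [:case p of (j, i) \<Rightarrow> coeff (h j) i:] (?v p)) \<in> {0}"
        using monomial_family_sum[where c = "\<lambda>(j, i). coeff (h j) i" and s = "\<lambda>j. m + 1 - \<mu> ! j" and P = P and d = d]
        unfolding right_minus_eq singleton_iff prod.case by argo
      then show "\<exists>c. g - (\<Sum>p\<in>?I. smult [:c p:] (?v p)) \<in> {0}" by blast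
    qed
    show "vv.indep_mod {0} ?I ?v"
      by (rule monomial_family_indep) (use assms in \<open>simp add: syz_basis_def\<close>)
    show "?v ` ?I \<subseteq> syz d a m"
      by (rule monomial_family_syz) (use assms in \<open>simp add: syz_basis_def\<close>)
  qed simp
  then show ?thesis by (simp add: hilb_def)
qed

text \<open>For m at least n, the monomial multiples of the \<open>P j\<close> are independent and
  as numerous as the dimension of the syzygies, so they generate. Smaller m follows by comparison
  with degree n.\<close>

lemma syz_basis_if_indep:
  assumes "length \<mu> = d" "sum_list \<mu> = n" "\<forall>i\<le>d. degree (a i) \<le> n" "surj_at d n a n"
    "\<forall>j<d. P j \<in> syz d a (\<mu> ! j)" "poly_indep d P"
  shows "syz_basis d a \<mu> P"
proof -
  have large: "graded_comb d \<mu> P m g"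
    if g: "g \<in> syz d a m" and m: "n \<le> m" for g m
  proof -
    let ?I = "Sigma {..<d} (\<lambda>j. {..<m + 1 - \<mu> ! j})"
    let ?v = "\<lambda>p. smult (monom 1 (snd p)) (P (fst p))"
    have "vv.has_dim (syz d a m) (hilb d \<mu> m)"
      using surj_syz_dim(1)[OF assms(3) surj_at_mono[OF assms(4) m]] hilb_large[OF assms(1,2) m]
      by (metis diff_add_inverse2)
    then have "vv.gen_mod {0} ?I ?v (syz d a m)"
      using monomial_family_indep[OF assms(6)] monomial_family_syz[OF assms(5)]
      by (intro vv.gen_mod_if_card[OF _ vv.has_dim_zero]) (auto simp: hilb_def intro: vv.subspace_0[OF syz_subspace])
    then obtain c where c: "g = (\<Sum>j<d. smult (\<Sum>i<m + 1 - \<mu> ! j. monom (c (j, i)) i) (P j))"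
      using g unfolding vv.gen_mod_def monomial_family_sum[where s = "\<lambda>j. m + 1 - \<mu> ! j"] right_minus_eq singleton_iff by blast
    show ?thesis
      by (intro exI conjI, rule c) (auto simp: coeff_monom_sum split: if_splits simp del: sum.lessThan_Suc)
  qed
  have "graded_comb d \<mu> P m g"
    if g: "g \<in> syz d a m" for g m
  proof (cases "n \<le> m")
    case True
    then show ?thesis using large g by blast
  next
    case False
    obtain h where h: "g = (\<Sum>j<d. smult (h j) (P j))"
      using large[OF syz_mono[OF g]] False by (metis linear order_refl)
    \<comment> \<open>Expanding \<open>g\<close> itself in degree n bounds exponents only by n.
      Multiplying by t^(n - m) shifts the exponents, so the bound n on the product becomes the bound
      m on \<open>h\<close>.\<close>
    have "smult (monom 1 (n - m)) g \<in> syz d a n"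
      using syz_smult[OF g, of "monom 1 (n - m)" n] False by (simp add: degree_monom_eq)
    then obtain h' where h': "smult (monom 1 (n - m)) g = (\<Sum>j<d. smult (h' j) (P j))"
      "\<forall>j<d. \<forall>i. coeff (h' j) i \<noteq> 0 \<longrightarrow> i + \<mu> ! j \<le> n" using large by blast
    have "(\<Sum>j<d. smult (monom 1 (n - m) * h j - h' j) (P j)) = 0"
      using h'(1) unfolding h by (simp add: smult_diff_left sum_subtractf smult_sum_right)
    then have eq: "h' j = monom 1 (n - m) * h j" if "j < d" for j
      using assms(6) that unfolding poly_indep_def by force
    have "i + \<mu> ! j \<le> m" if "j < d" "coeff (h j) i \<noteq> 0" for i j
    proof -
      have "coeff (h' j) (i + (n - m)) = coeff (h j) i" unfolding eq[OF that(1)] by (simp add: coeff_monom_mult)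
      then have "i + (n - m) + \<mu> ! j \<le> n" using h'(2) that by metis
      then show ?thesis using False by linarith
    qed
    then show ?thesis using h by blast
  qed
  then show ?thesis unfolding syz_basis_def using assms by blast
qed

text \<open>Once all coefficients of the \<open>h j\<close> below t^i vanish, the coefficient of t^i
  in the relation involves only the constant terms of the \<open>P j\<close>.\<close>

lemma poly_indep_if_const_coeffs:
  assumes "\<And>c. \<forall>r. (\<Sum>j<d. c j * coeff (coeff (P j) r) 0) = 0 \<Longrightarrow> \<forall>j<d. c j = 0"
  shows "poly_indep d P"
  unfolding poly_indep_def
proof (intro allI impI)
  fix h j assume h: "(\<Sum>j<d. smult (h j) (P j)) = 0" and j: "j < d"
  have "\<forall>j<d. coeff (h j) i = 0" for i
  proof (induction i rule: less_induct)
    case (less i)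
    have "(\<Sum>j<d. coeff (h j) i * coeff (coeff (P j) r) 0) = 0" for r
    proof -
      have "0 = coeff (coeff (\<Sum>j<d. smult (h j) (P j)) r) i" unfolding h by simp
      also have "\<dots> = (\<Sum>j<d. \<Sum>l\<le>i. coeff (h j) l * coeff (coeff (P j) r) (i - l))"
        by (simp add: coeff_sum coeff_mult)
      also have "\<dots> = (\<Sum>j<d. coeff (h j) i * coeff (coeff (P j) r) 0)"
      proof (rule sum.cong[OF refl])
        fix j assume "j \<in> {..<d}"
        then have "(\<Sum>l\<in>{..i} - {i}. coeff (h j) l * coeff (coeff (P j) r) (i - l)) = 0"
          using less.IH by (intro sum.neutral) auto
        then show "(\<Sum>l\<le>i. coeff (h j) l * coeff (coeff (P j) r) (i - l)) = coeff (h j) i * coeff (coeff (P j) r) 0"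
          by (subst sum.remove[of _ i]) auto
      qed
      finally show ?thesis by simp
    qed
    then show ?case using assms[of "\<lambda>j. coeff (h j) i"] by blast
  qed
  then show "h j = 0" using j by (intro poly_eqI) simp
qed

section \<open>Existence of a homogeneous basis of the syzygies\<close>

lemma has_dim_smult_x:
  assumes "vv.has_dim S r"
  shows "vv.has_dim (smult [:0, 1:] ` S :: 'k::field poly poly set) r"
proof -
  have S: "vv.subspace S" by (rule vv.has_dim_subspace[OF assms])
  obtain e where e: "e ` {..<r - 0} \<subseteq> S" "vv.indep_mod {0} {..<r - 0} e"
    using vv.complement_family_exists[OF assms vv.has_dim_zero] vv.subspace_0[OF S] by blast
  then have gen: "vv.gen_mod {0} {..<r} e S"
    using vv.gen_mod_if_card[OF assms vv.has_dim_zero _ _ e(2,1)] vv.subspace_0[OF S] by simp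
  let ?x = "smult [:0, 1 :: 'k:]"
  have x_sum: "(\<Sum>l<r. smult [:c l:] (?x (e l))) = ?x (\<Sum>l<r. smult [:c l:] (e l))" for c
    by (simp add: smult_sum_right mult.commute)
  have "vv.has_dim (?x ` S) (card {..<r})"
  proof (rule vv.has_dim_if_family)
    show "vv.subspace (?x ` S)"
    proof (rule vv.subspaceI)
      show "0 \<in> ?x ` S" using vv.subspace_0[OF S] by force
      show "u + w \<in> ?x ` S" if "u \<in> ?x ` S" "w \<in> ?x ` S" for u w
        using that vv.subspace_add[OF S] by (auto simp: smult_add_right[symmetric] simp del: pCons_0_0)
      show "smult [:c:] u \<in> ?x ` S" if u: "u \<in> ?x ` S" for c u
      proof -
        obtain y where "y \<in> S" "u = ?x y" using u by blast
        moreover have "smult [:c:] (?x y) = ?x (smult [:c:] y)" by (simp add: mult.commute)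
        ultimately show ?thesis using vv.subspace_scale[OF S] by blast
      qed
    qed
    show "(\<lambda>l. ?x (e l)) ` {..<r} \<subseteq> ?x ` S" using e(1) by auto
    show "vv.indep_mod {0} {..<r} (\<lambda>l. ?x (e l))"
      using e(2) unfolding vv.indep_mod_def x_sum by auto
    show "vv.gen_mod {0} {..<r} (\<lambda>l. ?x (e l)) (?x ` S)"
      unfolding vv.gen_mod_def x_sum
    proof
      fix u assume "u \<in> ?x ` S"
      then obtain y where y: "y \<in> S" "u = ?x y" by blast
      then obtain c where "y = (\<Sum>l<r. smult [:c l:] (e l))" using gen unfolding vv.gen_mod_def by auto
      then have "u - ?x (\<Sum>l<r. smult [:c l:] (e l)) \<in> {0}" using y(2) by simp
      then show "\<exists>c. u - ?x (\<Sum>l<r. smult [:c l:] (e l)) \<in> {0}" by blast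
    qed
  qed simp
  then show ?thesis by simp
qed

text \<open>Each of the j + 1 indices up to j has a part at most \<open>\<mu> ! j\<close>, so its
  summand grows by 1 in the last step.\<close>

lemma hilb_step:
  assumes "sorted \<mu>" "length \<mu> = d" "j < d" "1 \<le> \<mu> ! j"
  shows "hilb d \<mu> (\<mu> ! j - 1) + (j + 1) \<le> hilb d \<mu> (\<mu> ! j)"
proof -
  have "(\<Sum>i<d. if i \<le> j then 1 else 0 :: nat) = card {i \<in> {..<d}. i \<le> j}"
    by (simp add: sum.If_cases Int_def)
  also have "{i \<in> {..<d}. i \<le> j} = {..j}" using assms(3) by auto
  finally have "hilb d \<mu> (\<mu> ! j - 1) + (j + 1) = (\<Sum>i<d. (\<mu> ! j - 1 + 1 - \<mu> ! i) + (if i \<le> j then 1 else 0))"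
    unfolding hilb_def sum.distrib by simp
  also have "\<dots> \<le> (\<Sum>i<d. \<mu> ! j + 1 - \<mu> ! i)"
  proof (rule sum_mono)
    fix i assume "i \<in> {..<d}"
    then show "(\<mu> ! j - 1 + 1 - \<mu> ! i) + (if i \<le> j then 1 else 0) \<le> \<mu> ! j + 1 - \<mu> ! i"
      using assms sorted_nth_mono[OF assms(1), of i j] by auto
  qed
  finally show ?thesis unfolding hilb_def .
qed

lemma syz_div_x:
  assumes "g \<in> syz d a m" "\<forall>r. coeff (coeff g r) 0 = 0" "1 \<le> m"
  shows "g \<in> smult [:0, 1:] ` syz d a (m - 1)"
proof -
  define g' where "g' = map_poly (\<lambda>q. q div [:0, 1:]) g"
  have c: "coeff g r = [:0, 1:] * coeff g' r" for r
  proof -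
    have "[:0, 1:] dvd coeff g r"
      using assms(2) poly_eq_0_iff_dvd[of "coeff g r" 0] by (simp add: poly_0_coeff_0)
    moreover have "coeff g' r = coeff g r div [:0, 1:]" by (simp add: g'_def coeff_map_poly)
    ultimately show ?thesis by (metis dvd_mult_div_cancel)
  qed
  then have g: "g = smult [:0, 1:] g'" by (intro poly_eqI) simp
  have "coeff (coeff g r) (Suc i) = coeff (coeff g' r) i" for r i unfolding c by simp
  moreover have "i \<le> d \<and> j \<le> m" if "coeff (coeff g i) j \<noteq> 0" for i j
    using assms(1) that unfolding syz_def vecs_def by blast
  ultimately have "i \<le> d \<and> Suc j \<le> m" if "coeff (coeff g' i) j \<noteq> 0" for i j using that by metis
  then have "g' \<in> vecs d (m - 1)" unfolding vecs_def by fastforce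
  moreover have "dotv d a g' = 0" using assms(1) unfolding syz_def g by (simp add: dotv_smult)
  ultimately show ?thesis using g unfolding syz_def by blast
qed

text \<open>The basis is chosen greedily with independent constant terms. If no choice were left for
  column j, the syzygies of degree \<open>\<mu> ! j\<close> would be generated by t times those of
  one degree less and the j earlier columns, contradicting \<open>hilb_step\<close>.\<close>

lemma syz_basis_exists:
  assumes mu: "length \<mu> = d" "sorted \<mu>" "\<forall>m\<in>set \<mu>. 1 \<le> m" "sum_list \<mu> = n"
    and deg: "\<forall>i\<le>d. degree (a i) \<le> n"
    and dims: "\<And>m. m \<le> n \<Longrightarrow> vv.has_dim (syz d a m) (hilb d \<mu> m)"
  shows "surj_at d n a n" "\<exists>P. syz_basis d a \<mu> P"
proof -
  show surj: "surj_at d n a n"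
    using syz_dim_surj[OF deg dims[OF order_refl]] hilb_large[OF mu(1,4) order_refl] by simp
  have le: "\<mu> ! j \<le> n" "1 \<le> \<mu> ! j" if "j < d" for j
    using mu elem_le_sum_list[of j \<mu>] that by auto
  have "\<exists>P. (\<forall>i<j. P i \<in> syz d a (\<mu> ! i)) \<and>
      (\<forall>c. (\<forall>r. (\<Sum>i<j. c i * coeff (coeff (P i) r) 0) = 0) \<longrightarrow> (\<forall>i<j. c i = 0))" if "j \<le> d" for j
    using that
  proof (induction j)
    case 0
    then show ?case by simp
  next
    case (Suc j)
    then obtain P where P: "\<forall>i<j. P i \<in> syz d a (\<mu> ! i)"
      "\<And>c. \<forall>r. (\<Sum>i<j. c i * coeff (coeff (P i) r) 0) = 0 \<Longrightarrow> \<forall>i<j. c i = 0" by auto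
    let ?m = "\<mu> ! j"
    have j: "j < d" "?m \<le> n" "1 \<le> ?m" using Suc.prems le by auto
    have "\<exists>g\<in>syz d a ?m. \<nexists>c. \<forall>r. coeff (coeff g r) 0 = (\<Sum>i<j. c i * coeff (coeff (P i) r) 0)"
    proof (rule ccontr)
      assume *: "\<not> ?thesis"
      have "vv.gen_mod (smult [:0, 1:] ` syz d a (?m - 1)) {..<j} P (syz d a ?m)"
        unfolding vv.gen_mod_def
      proof
        fix g assume g: "g \<in> syz d a ?m"
        then obtain c where c: "\<And>r. coeff (coeff g r) 0 = (\<Sum>i<j. c i * coeff (coeff (P i) r) 0)"
          using * by blast
        have "(\<Sum>i<j. smult [:c i:] (P i)) \<in> syz d a ?m"
        proof (rule vv.subspace_sum[OF syz_subspace vv.subspace_scale[OF syz_subspace]])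
          fix i assume "i \<in> {..<j}"
          then show "P i \<in> syz d a ?m"
            using P(1) sorted_nth_mono[OF mu(2), of i j] j(1) mu(1) by (auto intro: syz_mono)
        qed
        then have "g - (\<Sum>i<j. smult [:c i:] (P i)) \<in> syz d a ?m"
          by (rule vv.subspace_diff[OF syz_subspace g])
        moreover have "coeff (coeff (g - (\<Sum>i<j. smult [:c i:] (P i))) r) 0 = 0" for r
          by (simp add: coeff_sum c)
        ultimately show "\<exists>c. g - (\<Sum>i<j. smult [:c i:] (P i)) \<in> smult [:0, 1:] ` syz d a (?m - 1)"
          using syz_div_x[OF _ _ j(3)] by blast
      qed
      moreover have "vv.has_dim (smult [:0, 1:] ` syz d a (?m - 1)) (hilb d \<mu> (?m - 1))"
        using has_dim_smult_x[OF dims] j(2) by simp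
      ultimately have "hilb d \<mu> ?m \<le> hilb d \<mu> (?m - 1) + j"
        using vv.gen_mod_card_ge[OF dims[OF j(2)]] by fastforce
      then show False using hilb_step[OF mu(2,1) j(1,3)] by simp
    qed
    then obtain g where g: "g \<in> syz d a ?m"
      "\<nexists>c. \<forall>r. coeff (coeff g r) 0 = (\<Sum>i<j. c i * coeff (coeff (P i) r) 0)" by blast
    define Q where "Q = P(j := g)"
    have Q: "Q i = P i" if "i < j" for i using that by (simp add: Q_def)
    have "\<forall>i<Suc j. c i = 0" if c: "\<forall>r. (\<Sum>i<Suc j. c i * coeff (coeff (Q i) r) 0) = 0" for c
    proof -
      have c': "(\<Sum>i<j. c i * coeff (coeff (P i) r) 0) + c j * coeff (coeff g r) 0 = 0" for r
        using c[rule_format, of r] by (simp add: Q_def)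
      have "c j = 0"
      proof (rule ccontr)
        assume cj: "c j \<noteq> 0"
        have "coeff (coeff g r) 0 = (\<Sum>i<j. (- c i / c j) * coeff (coeff (P i) r) 0)" for r
        proof -
          have "coeff (coeff g r) 0 = - (\<Sum>i<j. c i * coeff (coeff (P i) r) 0) / c j"
            using c'[of r] cj by (simp add: field_simps eq_neg_iff_add_eq_0)
          also have "\<dots> = (\<Sum>i<j. (- c i / c j) * coeff (coeff (P i) r) 0)"
            by (simp add: sum_divide_distrib sum_negf)
          finally show ?thesis .
        qed
        then have "\<exists>c. \<forall>r. coeff (coeff g r) 0 = (\<Sum>i<j. c i * coeff (coeff (P i) r) 0)"
          by (intro exI[of _ "\<lambda>i. - c i / c j"] allI)
        then show False using g(2) by contradiction
      qed
      moreover from this have "\<forall>i<j. c i = 0" using P(2)[of c] c' by simp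
      ultimately show ?thesis by (simp add: less_Suc_eq)
    qed
    moreover have "\<forall>i<Suc j. Q i \<in> syz d a (\<mu> ! i)" using P(1) g(1) by (simp add: Q_def less_Suc_eq)
    ultimately show ?case by blast
  qed
  from this[OF order_refl] obtain P where P: "\<forall>i<d. P i \<in> syz d a (\<mu> ! i)"
    "\<And>c. \<forall>r. (\<Sum>i<d. c i * coeff (coeff (P i) r) 0) = 0 \<Longrightarrow> \<forall>i<d. c i = 0" by blast
  have "poly_indep d P" by (rule poly_indep_if_const_coeffs) (rule P(2))
  then show "\<exists>P. syz_basis d a \<mu> P" using syz_basis_if_indep[OF mu(1,4) deg surj P(1)] by blast
qed

no_notation vec_nth (infixl \<open>$\<close> 90)

section \<open>Maximal minors\<close>

definition bordered :: "nat \<Rightarrow> (nat \<Rightarrow> 'k::field poly poly) \<Rightarrow> 'k poly poly \<Rightarrow> 'k poly mat" where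
  "bordered d P v = mat (Suc d) (Suc d) (\<lambda>(i, j). coeff (if j = 0 then v else P (j - 1)) i)"

text \<open>The signed maximal minor omitting row \<open>i\<close>: bordering by a unit vector picks
  out one cofactor, including its sign.\<close>

definition minor :: "nat \<Rightarrow> (nat \<Rightarrow> 'k::field poly poly) \<Rightarrow> nat \<Rightarrow> 'k poly" where
  "minor d P i = det (bordered d P (monom 1 i))"

lemma bordered_carrier: "bordered d P v \<in> carrier_mat (Suc d) (Suc d)"
  by (simp add: bordered_def)

text \<open>Laplace expansion along the first column, whose cofactors do not involve
  \<open>v\<close>.\<close>

lemma det_bordered: "det (bordered d P v) = dotv d (minor d P) v"
proof -
  define C where "C i = cofactor (bordered d P 0) i 0" for i
  have cof: "cofactor (bordered d P v) i 0 = C i" for v i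
    unfolding C_def cofactor_def
    by (intro arg_cong[of _ _ "\<lambda>A. _ * det A"] eq_matI) (auto simp: mat_delete_def bordered_def)
  have ex: "det (bordered d P v) = (\<Sum>i\<le>d. coeff v i * C i)" for v
    unfolding laplace_expansion_column[OF bordered_carrier zero_less_Suc] cof lessThan_Suc_atMost
    by (rule sum.cong) (auto simp: bordered_def)
  have "minor d P i = C i" if "i \<le> d" for i
  proof -
    have "minor d P i = (\<Sum>l\<le>d. if l = i then C l else 0)"
      unfolding minor_def ex by (rule sum.cong) auto
    then show ?thesis using that by simp
  qed
  then show ?thesis unfolding ex dotv_def by (intro sum.cong) auto
qed

lemma dotv_minor_column:
  assumes "j < d"
  shows "dotv d (minor d P) (P j) = 0"
proof -
  have "det (bordered d P (P j)) = 0"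
    by (rule det_identical_columns[OF bordered_carrier, of 0 "Suc j"])
      (use assms in \<open>auto simp: bordered_def intro!: eq_vecI\<close>)
  then show ?thesis by (simp add: det_bordered)
qed

lemma bordered_mult_vec:
  assumes "w \<in> carrier_vec (Suc d)" "i \<le> d"
  shows "(bordered d P v *\<^sub>v w) $ i = coeff (smult (w $ 0) v + (\<Sum>j<d. smult (w $ Suc j) (P j))) i"
proof -
  have "(bordered d P v *\<^sub>v w) $ i = (\<Sum>j<Suc d. (bordered d P v) $$ (i, j) * w $ j)"
    using assms by (simp add: scalar_prod_def bordered_def atLeast0LessThan)
  also have "\<dots> = coeff v i * w $ 0 + (\<Sum>j<d. coeff (P j) i * w $ Suc j)"
    unfolding sum.lessThan_Suc_shift using assms by (simp add: bordered_def)
  finally show ?thesis by (simp add: coeff_sum mult.commute)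
qed

text \<open>Pairing a kernel vector of the bordered matrix with \<open>a\<close> kills every
  \<open>P j\<close> and leaves \<open>w $ 0 * a i = 0\<close>; the remaining entries would be a
  relation among the \<open>P j\<close>.\<close>

lemma minors_nonzero:
  assumes "poly_indep d P" "\<forall>j<d. dotv d a (P j) = 0" "i \<le> d" "a i \<noteq> 0"
    and supp: "\<forall>j<d. \<forall>l>d. coeff (P j) l = 0"
  shows "minor d P i \<noteq> 0"
proof
  assume "minor d P i = 0"
  then obtain w where w: "w \<in> carrier_vec (Suc d)" "w \<noteq> 0\<^sub>v (Suc d)"
    "bordered d P (monom 1 i) *\<^sub>v w = 0\<^sub>v (Suc d)"
    using det_0_iff_vec_prod_zero[OF bordered_carrier] unfolding minor_def by metis
  let ?s = "smult (w $ 0) (monom 1 i) + (\<Sum>j<d. smult (w $ Suc j) (P j))"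
  have s: "coeff ?s l = 0" if "l \<le> d" for l
    using bordered_mult_vec[OF w(1) that, of P "monom 1 i"] w(3) that by simp
  then have "dotv d a ?s = 0" unfolding dotv_def by (intro sum.neutral) auto
  then have "w $ 0 * a i = 0"
    using assms by (simp add: dotv_add dotv_smult dotv_sum dotv_monom)
  then have w0: "w $ 0 = 0" using assms by simp
  have "coeff ?s l = 0" if "l > d" for l
    using supp that by (simp add: w0 coeff_sum)
  then have "?s = 0" using s by (intro poly_eqI) (metis coeff_0 not_le)
  then have "\<forall>j<d. w $ Suc j = 0"
    using assms(1)[unfolded poly_indep_def, rule_format, of "\<lambda>j. w $ Suc j"] w0 by simp
  then have "w = 0\<^sub>v (Suc d)" using w(1) w0 by (intro eq_vecI) (auto simp: less_Suc_eq_0_disj)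
  then show False using w(2) by blast
qed

text \<open>All the \<open>P j\<close> and the Koszul syzygy lie in the kernel of \<open>a\<close>, so their determinant vanishes.\<close>

lemma minor_proportional:
  assumes ker: "\<forall>j<d. dotv d a (P j) = 0" and ij: "i \<le> d" "j \<le> d"
  shows "minor d P i * a j = minor d P j * a i"
proof (cases "\<forall>l\<le>d. a l = 0")
  case True
  then show ?thesis using ij by simp
next
  case False
  then obtain l where l: "l \<le> d" "a l \<noteq> 0" by blast
  define v where "v = monom (a j) i - monom (a i) j"
  have v: "dotv d a v = 0" unfolding v_def by (simp add: dotv_diff dotv_monom ij mult.commute)
  let ?B = "bordered d P v"
  let ?a = "vec (Suc d) a"
  have "?B\<^sup>T *\<^sub>v ?a = 0\<^sub>v (Suc d)"
  proof (rule eq_vecI)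
    fix c assume c: "c < dim_vec (0\<^sub>v (Suc d) :: 'a poly vec)"
    then have "(?B\<^sup>T *\<^sub>v ?a) $ c = (\<Sum>l<Suc d. coeff (if c = 0 then v else P (c - 1)) l * a l)"
      by (simp add: scalar_prod_def bordered_def atLeast0LessThan)
    also have "\<dots> = dotv d a (if c = 0 then v else P (c - 1))"
      unfolding dotv_def lessThan_Suc_atMost by (simp add: mult.commute)
    also have "\<dots> = 0" using v ker c by auto
    finally show "(?B\<^sup>T *\<^sub>v ?a) $ c = 0\<^sub>v (Suc d) $ c" using c by simp
  qed (simp add: bordered_def)
  moreover have "?a \<noteq> 0\<^sub>v (Suc d)"
  proof
    assume "?a = 0\<^sub>v (Suc d)"
    then have "?a $ l = 0\<^sub>v (Suc d) $ l" by simp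
    then show False using l by simp
  qed
  ultimately have "det (?B\<^sup>T) = 0"
    using det_0_iff_vec_prod_zero[of "?B\<^sup>T" "Suc d"] bordered_carrier[of d P v] by (metis transpose_carrier_mat vec_carrier)
  then have "dotv d (minor d P) v = 0"
    using det_transpose[OF bordered_carrier[of d P v]] by (simp add: det_bordered)
  then show ?thesis unfolding v_def by (simp add: dotv_diff dotv_monom ij)
qed

lemma degree_minor:
  assumes "\<forall>j<d. P j \<in> vecs d (\<mu> ! j)" "length \<mu> = d" "i \<le> d"
  shows "degree (minor d P i) \<le> sum_list \<mu>"
proof -
  let ?B = "bordered d P (monom 1 i)"
  \<comment> \<open>Degree bounds for the columns; the bordering column consists of constants. Each
    Leibniz term takes one entry from every column.\<close>
  define b where "b j = (if j = 0 then 0 else \<mu> ! (j - 1))" for j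
  have sum_b: "(\<Sum>j\<in>{0..<Suc d}. b j) = sum_list \<mu>"
    unfolding sum.atLeast0_lessThan_Suc_shift using assms(2)
    by (simp add: b_def sum_list_sum_nth)
  have entry: "degree (?B $$ (r, c)) \<le> b c" if "r < Suc d" "c < Suc d" for r c
    using assms(1) that unfolding bordered_def b_def vecs_iff by auto
  have "degree (signof p * (\<Prod>r = 0..<Suc d. ?B $$ (r, p r))) \<le> sum_list \<mu>"
    if p: "p permutes {0..<Suc d}" for p
  proof -
    have "degree (signof p * (\<Prod>r = 0..<Suc d. ?B $$ (r, p r))) \<le> degree (\<Prod>r = 0..<Suc d. ?B $$ (r, p r))"
      by (cases "evenperm p") (auto simp: sign_def)
    also have "\<dots> \<le> (\<Sum>r = 0..<Suc d. degree (?B $$ (r, p r)))"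
      using degree_prod_sum_le[of "{0..<Suc d}" "\<lambda>r. ?B $$ (r, p r)"] by (simp add: o_def)
    also have "\<dots> \<le> (\<Sum>r = 0..<Suc d. b (p r))"
    proof (rule sum_mono)
      fix r assume r: "r \<in> {0..<Suc d}"
      then have "p r \<in> {0..<Suc d}" using p by (simp only: permutes_in_image)
      then show "degree (?B $$ (r, p r)) \<le> b (p r)" using entry r by simp
    qed
    also have "\<dots> = (\<Sum>j\<in>{0..<Suc d}. b j)" using sum.permute[OF p, of b] by (simp add: o_def)
    finally show ?thesis unfolding sum_b .
  qed
  then show ?thesis
    unfolding minor_def det_def'[OF bordered_carrier] by (intro degree_sum_le) (auto simp: finite_permutations)
qed

text \<open>Proportionality gives a common factor only over the fraction field. A tuple
  \<open>u\<close> with pairing 1 makes it a polynomial \<open>e\<close>, and comparing degrees at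
  an entry of full degree n makes \<open>e\<close> a constant.\<close>

lemma hilbert_burch:
  assumes mu: "length \<mu> = d" "sum_list \<mu> = n" and deg: "\<forall>i\<le>d. degree (a i) \<le> n"
    and surj: "surj_at d n a n" and P: "\<forall>j<d. P j \<in> syz d a (\<mu> ! j)" and indep: "poly_indep d P"
  shows "\<exists>c. c \<noteq> 0 \<and> (\<forall>i\<le>d. a i = smult c (minor d P i))"
proof -
  let ?b = "minor d P"
  have ker: "\<forall>j<d. dotv d a (P j) = 0" and vP: "\<forall>j<d. P j \<in> vecs d (\<mu> ! j)"
    using P unfolding syz_def by auto
  obtain u where u: "dotv d a u = 1" using surj unfolding surj_at_def by (metis degree_1 le0)
  define e where "e = dotv d ?b u"
  have be: "?b j = a j * e" if "j \<le> d" for j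
  proof -
    have "?b j = ?b j * dotv d a u" using u by simp
    also have "\<dots> = (\<Sum>i\<le>d. (?b j * a i) * coeff u i)" by (simp add: dotv_def sum_distrib_left mult_ac)
    also have "\<dots> = (\<Sum>i\<le>d. a j * (?b i * coeff u i))"
      by (rule sum.cong) (use minor_proportional[OF ker that] in \<open>simp_all add: mult_ac\<close>)
    finally show ?thesis by (simp add: e_def dotv_def sum_distrib_left)
  qed
  obtain v where v: "v \<in> vecs d n" "dotv d a v = monom 1 (n + n)"
    using surj unfolding surj_at_def by (metis degree_monom_le)
  \<comment> \<open>Otherwise no combination with coefficients of degree at most n could reach t^(2
    n); this is nonvanishing at s = 0.\<close>
  have "\<exists>i\<le>d. degree (a i) = n \<and> a i \<noteq> 0"
  proof (rule ccontr)
    assume *: "\<not> ?thesis"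
    have "coeff (a i * coeff v i) (n + n) = 0" if "i \<le> d" for i
    proof (cases "a i = 0")
      case False
      then have "degree (a i) < n" using deg that * by (metis le_neq_implies_less)
      then have "degree (a i * coeff v i) < n + n"
        using degree_mult_le[of "a i" "coeff v i"] v(1) unfolding vecs_iff
        by (meson add_less_le_mono le_less_trans)
      then show ?thesis by (rule coeff_eq_0)
    qed simp
    then have "coeff (dotv d a v) (n + n) = 0" by (simp add: dotv_def coeff_sum)
    then show False unfolding v(2) by simp
  qed
  then obtain i where i: "i \<le> d" "degree (a i) = n" "a i \<noteq> 0" by blast
  have "?b i \<noteq> 0"
    using minors_nonzero[OF indep ker i(1,3)] vP unfolding vecs_iff by blast
  then have e0: "e \<noteq> 0" using be[OF i(1)] by auto
  have "degree (?b i) = n + degree e" using be[OF i(1)] i e0 by (simp add: degree_mult_eq)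
  then have "degree e = 0" using degree_minor[OF vP mu(1) i(1)] mu(2) by simp
  then obtain c where c: "e = [:c:]" using degree_eq_zeroE by blast
  have "a j = smult (1 / c) (?b j)" if "j \<le> d" for j
    using be[OF that] c e0 by simp
  then show ?thesis using c e0 by (intro exI[of _ "1 / c"]) auto
qed

text \<open>The columns are syzygies of their own minors. A relation among them over k[t] would make
  all bordered determinants vanish, hence every pairing with \<open>a\<close>, against
  surjectivity.\<close>

lemma syz_basis_of_minors:
  assumes mu: "length \<mu> = d" "sum_list \<mu> = n"
    and P: "\<forall>j<d. P j \<in> vecs d (\<mu> ! j)" and a: "\<forall>i\<le>d. a i = smult c (minor d P i)"
    and surj: "surj_at d n a n"
  shows "syz_basis d a \<mu> P"
proof (rule syz_basis_if_indep[OF mu _ surj])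
  have dot: "dotv d a v = smult c (dotv d (minor d P) v)" for v
    unfolding dotv_def smult_sum_right using a by (intro sum.cong) auto
  show "\<forall>i\<le>d. degree (a i) \<le> n"
    using a degree_minor[OF P mu(1)] mu(2) le_trans[OF degree_smult_le] by metis
  show "\<forall>j<d. P j \<in> syz d a (\<mu> ! j)"
    using P dotv_minor_column[of _ d P] unfolding syz_def by (simp add: dot)
  show "poly_indep d P"
    unfolding poly_indep_def
  proof (intro allI impI, rule ccontr)
    fix h j assume h: "(\<Sum>j<d. smult (h j) (P j)) = 0" and j: "j < d" "h j \<noteq> 0"
    define w where "w = vec (Suc d) (\<lambda>r. if r = 0 then 0 else h (r - 1))"
    have w: "w \<in> carrier_vec (Suc d)" by (simp add: w_def)
    have "w \<noteq> 0\<^sub>v (Suc d)"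
    proof
      assume "w = 0\<^sub>v (Suc d)"
      then have "w $ Suc j = 0\<^sub>v (Suc d) $ Suc j" by simp
      then show False using j by (simp add: w_def)
    qed
    moreover have "bordered d P v *\<^sub>v w = 0\<^sub>v (Suc d)" for v
    proof (rule eq_vecI)
      fix i assume "i < dim_vec (0\<^sub>v (Suc d) :: 'a poly vec)"
      then have i: "i \<le> d" by simp
      have "smult (w $ 0) v + (\<Sum>j<d. smult (w $ Suc j) (P j)) = 0" using h by (simp add: w_def)
      then show "(bordered d P v *\<^sub>v w) $ i = 0\<^sub>v (Suc d) $ i"
        unfolding bordered_mult_vec[OF w i] using i by simp
    qed (simp add: bordered_def)
    ultimately have "det (bordered d P v) = 0" for v
      using det_0_iff_vec_prod_zero[OF bordered_carrier] w by blast
    then have "dotv d a v = 0" for v by (simp add: dot det_bordered)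
    moreover obtain u where "dotv d a u = 1" using surj unfolding surj_at_def by (metis degree_1 le0)
    ultimately show False by (metis zero_neq_one)
  qed
qed

section \<open>Homogeneous components\<close>

text \<open>Also meant for inhomogeneous \<open>p\<close>: it takes the component of degree
  \<open>n\<close> and sets s = 1 there, so all \<open>n\<close> together determine
  \<open>p\<close>.\<close>

definition dehom :: "nat \<Rightarrow> 'k::field poly poly \<Rightarrow> 'k poly" where
  "dehom n p = (\<Sum>j\<le>n. monom (coeff (coeff p j) (n - j)) j)"

definition homog :: "nat \<Rightarrow> 'k::field poly \<Rightarrow> 'k poly poly" where
  "homog n q = (\<Sum>j\<le>n. monom (monom (coeff q j) (n - j)) j)"

lemma coeff_dehom: "coeff (dehom n p) j = (if j \<le> n then coeff (coeff p j) (n - j) else 0)"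
proof -
  have "coeff (dehom n p) j = (\<Sum>l\<le>n. if l = j then coeff (coeff p l) (n - l) else 0)"
    unfolding dehom_def coeff_sum by (rule sum.cong) auto
  then show ?thesis by simp
qed

lemma coeff_homog: "coeff (coeff (homog n q) j) i = (if i + j = n then coeff q j else 0)"
proof -
  have "coeff (coeff (homog n q) j) i = (\<Sum>l\<le>n. if l = j then (if n - l = i then coeff q l else 0) else 0)"
    unfolding homog_def coeff_sum by (rule sum.cong) auto
  then show ?thesis by auto
qed

lemma homog_forms: "homog n q \<in> forms n"
  by (simp add: forms_def coeff_homog)

lemma degree_dehom: "degree (dehom n p) \<le> n"
  by (intro degree_le) (simp add: coeff_dehom)

lemma dehom_homog: "degree q \<le> n \<Longrightarrow> dehom n (homog n q) = q"
  by (intro poly_eqI) (auto simp: coeff_dehom coeff_homog coeff_eq_0)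

lemma dehom_homog_other: "m \<noteq> n \<Longrightarrow> dehom m (homog n q) = 0"
  by (intro poly_eqI) (auto simp: coeff_dehom coeff_homog)

lemma homog_dehom: "p \<in> forms n \<Longrightarrow> homog n (dehom n p) = p"
proof (intro poly_eqI)
  fix j i assume "p \<in> forms n"
  then have "coeff (coeff p j) i = 0" if "i + j \<noteq> n" using that unfolding forms_def by blast
  then show "coeff (coeff (homog n (dehom n p)) j) i = coeff (coeff p j) i"
    by (auto simp: coeff_homog coeff_dehom)
qed

lemma dehom_0 [simp]: "dehom n 0 = 0" by (simp add: dehom_def)

lemma dehom_add: "dehom n (p + q) = dehom n p + dehom n q"
  by (intro poly_eqI) (simp add: coeff_dehom)

lemma dehom_diff: "dehom n (p - q) = dehom n p - dehom n q"
  by (intro poly_eqI) (simp add: coeff_dehom)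

lemma dehom_sum: "dehom n (\<Sum>i\<in>I. f i) = (\<Sum>i\<in>I. dehom n (f i))"
  by (induction I rule: infinite_finite_induct) (auto simp: dehom_add)

lemma dehom_smult_const: "dehom n (smult [:c:] p) = smult c (dehom n p)"
  by (intro poly_eqI) (simp add: coeff_dehom)

text \<open>Allows identities in k[s,t] to be checked one homogeneous component at a time.\<close>

lemma eq_0_if_dehom: "(\<And>n. dehom n p = 0) \<Longrightarrow> p = 0"
proof (intro poly_eqI)
  fix j i assume "\<And>n. dehom n p = 0"
  then have "coeff (dehom (i + j) p) j = 0" by simp
  then show "coeff (coeff p j) i = coeff (coeff 0 j) i" by (simp add: coeff_dehom)
qed

lemma dehom_eventually_0: "\<exists>N. \<forall>m>N. dehom m p = 0"
proof (intro exI allI impI poly_eqI)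
  fix m j assume m: "m > degree p + (\<Sum>j\<le>degree p. degree (coeff p j))"
  show "coeff (dehom m p) j = coeff 0 j"
  proof (cases "j \<le> degree p")
    case True
    then have "degree (coeff p j) \<le> (\<Sum>j\<le>degree p. degree (coeff p j))" by (intro member_le_sum) auto
    then have "degree (coeff p j) < m - j" using m True by linarith
    then show ?thesis by (simp add: coeff_dehom coeff_eq_0)
  qed (simp add: coeff_dehom coeff_eq_0)
qed

text \<open>A form of degree m shifts degrees by m, so component k of the product sees only
  component k - m of \<open>p\<close>, and nothing if k is below m.\<close>

lemma dehom_mult:
  assumes "f \<in> forms m"
  shows "dehom k (f * p) = (if m \<le> k then dehom m f * dehom (k - m) p else 0)"
proof (rule poly_eqI)
  fix j
  have f: "coeff (coeff f l) i = (if i + l = m then coeff (dehom m f) l else 0)" for l i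
    using assms unfolding forms_def by (auto simp: coeff_dehom)
  have *: "(\<Sum>i\<le>k - j. coeff (coeff f l) i * coeff (coeff p (j - l)) (k - j - i)) =
    (if m \<le> k then coeff (dehom m f) l * coeff (dehom (k - m) p) (j - l) else 0)" if jk: "j \<le> k" "l \<le> j" for l
  proof (cases "l \<le> m")
    case False
    then show ?thesis by (simp add: f coeff_dehom)
  next
    case True
    have "(\<Sum>i\<le>k - j. coeff (coeff f l) i * coeff (coeff p (j - l)) (k - j - i)) =
      (\<Sum>i\<le>k - j. if i = m - l then coeff (dehom m f) l * coeff (coeff p (j - l)) (k - j - (m - l)) else 0)"
      by (rule sum.cong) (use True in \<open>auto simp: f\<close>)
    also have "\<dots> = (if m - l \<le> k - j then coeff (dehom m f) l * coeff (coeff p (j - l)) (k - j - (m - l)) else 0)"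
      by simp
    also have "\<dots> = (if m \<le> k then coeff (dehom m f) l * coeff (dehom (k - m) p) (j - l) else 0)"
    proof (cases "m \<le> k")
      case mk: True
      then have "m - l \<le> k - j \<longleftrightarrow> j - l \<le> k - m" using True jk by linarith
      moreover have "k - j - (m - l) = k - m - (j - l)" using True jk mk by linarith
      ultimately show ?thesis using mk by (simp add: coeff_dehom)
    qed (use True jk in auto)
    finally show ?thesis .
  qed
  show "coeff (dehom k (f * p)) j = coeff (if m \<le> k then dehom m f * dehom (k - m) p else 0) j"
  proof (cases "j \<le> k")
    case True
    have "coeff (dehom k (f * p)) j = (\<Sum>l\<le>j. \<Sum>i\<le>k - j. coeff (coeff f l) i * coeff (coeff p (j - l)) (k - j - i))"
      using True by (simp add: coeff_dehom coeff_mult coeff_sum)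
    also have "\<dots> = (\<Sum>l\<le>j. if m \<le> k then coeff (dehom m f) l * coeff (dehom (k - m) p) (j - l) else 0)"
      by (rule sum.cong) (use * True in auto)
    finally show ?thesis by (simp add: coeff_mult)
  next
    case False
    then have "coeff (dehom m f) l * coeff (dehom (k - m) p) (j - l) = 0" if "m \<le> k" for l
      using that by (auto simp: coeff_dehom)
    then have "m \<le> k \<Longrightarrow> coeff (dehom m f * dehom (k - m) p) j = 0"
      unfolding coeff_mult by (intro sum.neutral) blast
    then show ?thesis using False by (simp add: coeff_dehom[of k])
  qed
qed

lemma dehom_sum_mult:
  assumes "\<forall>i\<in>I. f i \<in> forms (m i)"
  shows "dehom k (\<Sum>i\<in>I. f i * p i) = (\<Sum>i\<in>I. dehom (m i) (f i) * (if m i \<le> k then dehom (k - m i) (p i) else 0))"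
  unfolding dehom_sum by (rule sum.cong) (use assms in \<open>auto simp: dehom_mult\<close>)

section \<open>Graded resolutions and bases of the dehomogenized syzygies\<close>

definition tuple_vec :: "nat \<Rightarrow> (nat \<Rightarrow> 'k::field poly) \<Rightarrow> 'k poly poly" where
  "tuple_vec d f = (\<Sum>i\<le>d. monom (f i) i)"

lemma coeff_tuple_vec: "coeff (tuple_vec d f) i = (if i \<le> d then f i else 0)"
proof -
  have "coeff (tuple_vec d f) i = (\<Sum>l\<le>d. if l = i then f l else 0)"
    unfolding tuple_vec_def coeff_sum by (rule sum.cong) auto
  then show ?thesis by simp
qed

lemma tuple_vec_vecs: "(\<And>i. i \<le> d \<Longrightarrow> degree (f i) \<le> m) \<Longrightarrow> tuple_vec d f \<in> vecs d m"
  unfolding vecs_iff by (simp add: coeff_tuple_vec)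

lemma dotv_tuple_vec: "dotv d a (tuple_vec d f) = (\<Sum>i\<le>d. a i * f i)"
  by (simp add: dotv_def coeff_tuple_vec)

abbreviation dehoms :: "nat \<Rightarrow> (nat \<Rightarrow> 'k::field poly poly) \<Rightarrow> nat \<Rightarrow> 'k poly" where
  "dehoms n a \<equiv> \<lambda>i. dehom n (a i)"

text \<open>The resolution allows arbitrary coefficients from k[s,t]; feeding it homogenizations of
  polynomials in t gives independence over k[t] and, in the appropriate component, the graded
  combinations.\<close>

lemma syz_basis_if_graded_resolution:
  assumes a: "\<forall>i\<le>d. a i \<in> forms n" and \<mu>: "length \<mu> = d" and res: "graded_resolution d a \<mu> P"
  shows "syz_basis d (dehoms n a) \<mu> (\<lambda>j. tuple_vec d (\<lambda>i. dehom (\<mu> ! j) (P i j)))"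
proof -
  let ?A = "dehoms n a"
  let ?Q = "\<lambda>j. tuple_vec d (\<lambda>i. dehom (\<mu> ! j) (P i j))"
  have P: "\<forall>j\<in>{..<d}. P i j \<in> forms (\<mu> ! j)" if "i \<le> d" for i
    using res that \<mu> unfolding graded_resolution_def by simp
  have inj: "(\<forall>i\<le>d. (\<Sum>j<d. P i j * h j) = 0) \<Longrightarrow> \<forall>j<d. h j = 0" for h
    using res \<mu> unfolding graded_resolution_def by blast
  have ex: "(\<Sum>i\<le>d. a i * g i) = 0 \<longleftrightarrow> (\<exists>h. \<forall>i\<le>d. g i = (\<Sum>j<d. P i j * h j))" for g
    using res \<mu> unfolding graded_resolution_def by blast
  have dehom_a: "dehom k (\<Sum>i\<le>d. a i * g i) = (\<Sum>i\<le>d. ?A i * (if n \<le> k then dehom (k - n) (g i) else 0))" for k g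
    by (rule dehom_sum_mult) (use a in auto)
  have "?Q j \<in> syz d ?A (\<mu> ! j)" if j: "j < d" for j
  proof -
    \<comment> \<open>Column j is the matrix applied to a unit vector, so exactness makes it a
      relation.\<close>
    have "P i j = (\<Sum>l<d. P i l * (if l = j then 1 else 0))" for i
      using j by (simp add: if_distrib[of "(*) _"] cong: if_cong)
    then have "(\<Sum>i\<le>d. a i * P i j) = 0"
      unfolding ex by (intro exI[of _ "\<lambda>l. if l = j then 1 else 0"] allI impI)
    then have "dehom (n + \<mu> ! j) (\<Sum>i\<le>d. a i * P i j) = 0" by simp
    then show ?thesis unfolding syz_def dehom_a by (simp add: dotv_tuple_vec tuple_vec_vecs degree_dehom)
  qed
  moreover have "poly_indep d ?Q"
    unfolding poly_indep_def
  proof (rule allI, rule impI)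
    fix h assume h: "(\<Sum>j<d. smult (h j) (?Q j)) = 0"
    have h_i: "(\<Sum>j<d. dehom (\<mu> ! j) (P i j) * h j) = 0" if "i \<le> d" for i
    proof -
      have "coeff (\<Sum>j<d. smult (h j) (?Q j)) i = 0" unfolding h by simp
      then show ?thesis using that by (simp add: coeff_sum coeff_tuple_vec mult.commute)
    qed
    \<comment> \<open>A common degree in which all products \<open>P i j * H j\<close> below are
      forms; the sum is merely a convenient upper bound.\<close>
    define N where "N = (\<Sum>j<d. \<mu> ! j + degree (h j))"
    have N: "\<mu> ! j + degree (h j) \<le> N" if "j < d" for j
      unfolding N_def using that by (intro member_le_sum) auto
    define H where "H j = homog (N - \<mu> ! j) (h j)" for j
    have H: "dehom (N - \<mu> ! j) (H j) = h j" if "j < d" for j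
      unfolding H_def using N[OF that] by (intro dehom_homog) simp
    have "(\<Sum>j<d. P i j * H j) = 0" if i: "i \<le> d" for i
    proof (rule eq_0_if_dehom)
      fix k
      have "dehom k (\<Sum>j<d. P i j * H j) = (\<Sum>j<d. dehom (\<mu> ! j) (P i j) * (if \<mu> ! j \<le> k then dehom (k - \<mu> ! j) (H j) else 0))"
        by (rule dehom_sum_mult) (use P[OF i] in auto)
      also have "\<dots> = (\<Sum>j<d. dehom (\<mu> ! j) (P i j) * (if k = N then h j else 0))"
      proof (rule sum.cong[OF refl])
        fix j assume "j \<in> {..<d}"
        then have j: "j < d" by simp
        have "dehom (k - \<mu> ! j) (H j) = 0" if "k \<noteq> N" "\<mu> ! j \<le> k"
          unfolding H_def using that N[OF j] by (intro dehom_homog_other) linarith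
        then show "dehom (\<mu> ! j) (P i j) * (if \<mu> ! j \<le> k then dehom (k - \<mu> ! j) (H j) else 0) =
          dehom (\<mu> ! j) (P i j) * (if k = N then h j else 0)"
          using H[OF j] N[OF j] by auto
      qed
      also have "\<dots> = 0" using h_i[OF i] by (cases "k = N") auto
      finally show "dehom k (\<Sum>j<d. P i j * H j) = 0" .
    qed
    then have "\<forall>j<d. H j = 0" by (intro inj) blast
    then show "\<forall>j<d. h j = 0" using H by (metis dehom_0)
  qed
  moreover have "graded_comb d \<mu> ?Q m g"
    if g: "g \<in> syz d ?A m" for g m
  proof -
    have gm: "degree (coeff g i) \<le> m" for i using g unfolding syz_def vecs_iff by blast
    have "(\<Sum>i\<le>d. a i * homog m (coeff g i)) = 0"
    proof (rule eq_0_if_dehom)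
      fix k
      have "(\<Sum>i\<le>d. ?A i * (if n \<le> k then dehom (k - n) (homog m (coeff g i)) else 0)) =
        (if k = n + m then dotv d ?A g else 0)"
        using dehom_homog[OF gm] by (auto simp: dotv_def dehom_homog_other intro!: sum.neutral)
      then show "dehom k (\<Sum>i\<le>d. a i * homog m (coeff g i)) = 0"
        using g unfolding dehom_a syz_def by simp
    qed
    then obtain H where H: "\<forall>i\<le>d. homog m (coeff g i) = (\<Sum>j<d. P i j * H j)" unfolding ex by blast
    define h where "h j = (if \<mu> ! j \<le> m then dehom (m - \<mu> ! j) (H j) else 0)" for j
    have "g = (\<Sum>j<d. smult (h j) (?Q j))"
    proof (rule poly_eqI)
      fix i
      show "coeff g i = coeff (\<Sum>j<d. smult (h j) (?Q j)) i"
      proof (cases "i \<le> d")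
        case True
        have "coeff g i = dehom m (homog m (coeff g i))" by (rule dehom_homog[OF gm, symmetric])
        also have "homog m (coeff g i) = (\<Sum>j<d. P i j * H j)" using H True by blast
        also have "dehom m \<dots> = (\<Sum>j<d. dehom (\<mu> ! j) (P i j) * h j)"
          unfolding h_def by (rule dehom_sum_mult) (use P[OF True] in auto)
        finally show ?thesis using True by (simp add: coeff_sum coeff_tuple_vec mult.commute)
      next
        case False
        then show ?thesis using g by (simp add: syz_def vecs_iff coeff_sum coeff_tuple_vec)
      qed
    qed
    moreover have "i + \<mu> ! j \<le> m" if "coeff (h j) i \<noteq> 0" for i j
      using that by (auto simp: h_def coeff_dehom split: if_splits)
    ultimately show ?thesis by blast
  qed
  ultimately show ?thesis unfolding syz_basis_def by blast
qed

text \<open>An inhomogeneous relation is split into components. Each is a syzygy with a graded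
  expansion, and the finitely many expansions are homogenized and added.\<close>

lemma graded_resolution_if_syz_basis:
  assumes a: "\<forall>i\<le>d. a i \<in> forms n" and \<mu>: "length \<mu> = d"
    and basis: "syz_basis d (dehoms n a) \<mu> Q"
  shows "graded_resolution d a \<mu> (\<lambda>i j. homog (\<mu> ! j) (coeff (Q j) i))"
proof -
  let ?A = "dehoms n a"
  let ?P = "\<lambda>i j. homog (\<mu> ! j) (coeff (Q j) i)"
  have Q: "\<And>j. j < d \<Longrightarrow> Q j \<in> syz d ?A (\<mu> ! j)" and indep: "poly_indep d Q"
    and gen: "\<And>m g. g \<in> syz d ?A m \<Longrightarrow> graded_comb d \<mu> Q m g"
    using basis unfolding syz_basis_def by blast+
  have dQ: "dehom (\<mu> ! j) (?P i j) = coeff (Q j) i" if "j < d" for i j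
    using Q[OF that] unfolding syz_def vecs_iff by (intro dehom_homog) simp
  have dehom_P: "dehom k (\<Sum>j<d. ?P i j * h j) = (\<Sum>j<d. coeff (Q j) i * (if \<mu> ! j \<le> k then dehom (k - \<mu> ! j) (h j) else 0))"
    for k i h
  proof -
    have "dehom k (\<Sum>j<d. ?P i j * h j) = (\<Sum>j<d. dehom (\<mu> ! j) (?P i j) * (if \<mu> ! j \<le> k then dehom (k - \<mu> ! j) (h j) else 0))"
      by (rule dehom_sum_mult) (simp add: homog_forms)
    then show ?thesis using dQ by simp
  qed
  have dehom_a: "dehom k (\<Sum>i\<le>d. a i * g i) = (\<Sum>i\<le>d. ?A i * (if n \<le> k then dehom (k - n) (g i) else 0))" for k g
    by (rule dehom_sum_mult) (use a in auto)
  have inj: "\<forall>j<d. h j = 0" if h: "\<forall>i\<le>d. (\<Sum>j<d. ?P i j * h j) = 0" for h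
  proof (intro allI impI)
    fix j assume j: "j < d"
    show "h j = 0"
    proof (rule eq_0_if_dehom)
      fix l
      define k where "k = \<mu> ! j + l"
      let ?e = "\<lambda>j. if \<mu> ! j \<le> k then dehom (k - \<mu> ! j) (h j) else 0"
      have "(\<Sum>j<d. smult (?e j) (Q j)) = 0"
      proof (rule poly_eqI)
        fix i
        show "coeff (\<Sum>j<d. smult (?e j) (Q j)) i = coeff 0 i"
        proof (cases "i \<le> d")
          case True
          then have "dehom k (\<Sum>j<d. ?P i j * h j) = 0" using h by simp
          then show ?thesis unfolding dehom_P by (simp add: coeff_sum mult.commute)
        next
          case False
          then have "coeff (Q j) i = 0" if "j < d" for j
            using Q[OF that] unfolding syz_def vecs_iff by simp
          then show ?thesis by (simp add: coeff_sum)
        qed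
      qed
      then have "?e j = 0" using indep[unfolded poly_indep_def, rule_format, of ?e j] j by blast
      then show "dehom l (h j) = 0" by (simp add: k_def)
    qed
  qed
  have zero: "(\<Sum>i\<le>d. a i * ?P i j) = 0" if j: "j < d" for j
  proof (rule eq_0_if_dehom)
    fix k
    have "(\<Sum>i\<le>d. ?A i * (if n \<le> k then dehom (k - n) (?P i j) else 0)) =
        (if k = n + \<mu> ! j then dotv d ?A (Q j) else 0)"
      using dQ[OF j] by (auto simp: dotv_def dehom_homog_other intro!: sum.neutral)
    then show "dehom k (\<Sum>i\<le>d. a i * ?P i j) = 0"
      using Q[OF j] unfolding dehom_a syz_def by simp
  qed
  have "\<exists>h. \<forall>i\<le>d. g i = (\<Sum>j<d. ?P i j * h j)" if g: "(\<Sum>i\<le>d. a i * g i) = 0" for g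
  proof -
    have "tuple_vec d (\<lambda>i. dehom m (g i)) \<in> syz d ?A m" for m
    proof -
      have "dehom (n + m) (\<Sum>i\<le>d. a i * g i) = 0" using g by simp
      then show ?thesis
        unfolding dehom_a syz_def by (simp add: dotv_tuple_vec tuple_vec_vecs degree_dehom)
    qed
    then have "\<forall>m. graded_comb d \<mu> Q m (tuple_vec d (\<lambda>i. dehom m (g i)))" using gen by blast
    then obtain h where h: "\<And>m. tuple_vec d (\<lambda>i. dehom m (g i)) = (\<Sum>j<d. smult (h m j) (Q j))"
        "\<And>m j i. j < d \<Longrightarrow> coeff (h m j) i \<noteq> 0 \<Longrightarrow> i + \<mu> ! j \<le> m" by metis
    have "\<forall>i. \<exists>N. \<forall>m>N. dehom m (g i) = 0" using dehom_eventually_0 by blast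
    then obtain N0 where "\<And>i. \<forall>m>N0 i. dehom m (g i) = 0" by metis
    then have N: "dehom m (g i) = 0" if "m > (\<Sum>i\<le>d. N0 i)" "i \<le> d" for m i
      using that member_le_sum[of i "{..d}" N0] by (metis atMost_iff finite_atMost le_less_trans zero_le)
    \<comment> \<open>Above this degree all components of all \<open>g i\<close> vanish, which makes
      the sum in \<open>H\<close> finite.\<close>
    define N where "N = (\<Sum>i\<le>d. N0 i)"
    define H where "H j = (\<Sum>m\<le>N. if \<mu> ! j \<le> m then homog (m - \<mu> ! j) (h m j) else 0)" for j
    have dH: "(if \<mu> ! j \<le> k then dehom (k - \<mu> ! j) (H j) else 0) = (if k \<le> N then h k j else 0)" if j: "j < d" for k j
    proof (cases "\<mu> ! j \<le> k")
      case True
      have "dehom (k - \<mu> ! j) (H j) = (\<Sum>m\<le>N. if m = k then h m j else 0)"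
        unfolding H_def dehom_sum
      proof (rule sum.cong[OF refl])
        fix m
        have "degree (h m j) \<le> m - \<mu> ! j" using h(2)[OF j, of m] by (intro degree_le) force
        then show "dehom (k - \<mu> ! j) (if \<mu> ! j \<le> m then homog (m - \<mu> ! j) (h m j) else 0) = (if m = k then h m j else 0)"
          using True by (cases "m = k") (auto intro!: dehom_homog_other simp: dehom_homog)
      qed
      then show ?thesis using True by simp
    next
      case False
      then have "h k j = 0" using h(2)[OF j, of k] by (intro poly_eqI) force
      then show ?thesis using False by simp
    qed
    have "g i = (\<Sum>j<d. ?P i j * H j)" if i: "i \<le> d" for i
    proof -
      have "g i - (\<Sum>j<d. ?P i j * H j) = 0"
      proof (rule eq_0_if_dehom)
        fix k
        have "dehom k (\<Sum>j<d. ?P i j * H j) = (\<Sum>j<d. coeff (Q j) i * (if k \<le> N then h k j else 0))"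
          unfolding dehom_P by (rule sum.cong) (use dH in auto)
        also have "\<dots> = (if k \<le> N then coeff (\<Sum>j<d. smult (h k j) (Q j)) i else 0)"
          by (simp add: coeff_sum mult.commute)
        also have "\<dots> = dehom k (g i)"
          unfolding h(1)[symmetric] using N[of k i] i by (auto simp: coeff_tuple_vec N_def)
        finally show "dehom k (g i - (\<Sum>j<d. ?P i j * H j)) = 0" by (simp add: dehom_diff)
      qed
      then show ?thesis by simp
    qed
    then show ?thesis by blast
  qed
  moreover have "(\<Sum>i\<le>d. a i * g i) = 0" if "\<forall>i\<le>d. g i = (\<Sum>j<d. ?P i j * h j)" for g h
  proof -
    have "(\<Sum>i\<le>d. a i * g i) = (\<Sum>i\<le>d. \<Sum>j<d. a i * ?P i j * h j)"
      using that by (simp add: sum_distrib_left mult.assoc)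
    also have "\<dots> = (\<Sum>j<d. (\<Sum>i\<le>d. a i * ?P i j) * h j)"
      by (subst sum.swap) (simp add: sum_distrib_right)
    also have "\<dots> = 0" using zero by simp
    finally show ?thesis .
  qed
  ultimately show ?thesis
    unfolding graded_resolution_def \<mu> using inj homog_forms by blast
qed

section \<open>Membership in the stratum as existence of a syzygy basis\<close>

lemma is_unit_if_dvd_powers:
  fixes c :: "'k::field poly poly"
  assumes "c dvd monom (monom 1 N) 0" "c dvd monom (monom 1 0) N"
  shows "is_unit c"
proof -
  have "degree c = 0"
    \<comment> \<open>As a divisor of s^N, \<open>c\<close> does not involve t; as a divisor of t^N,
      it then divides the coefficient 1.\<close>
    using dvd_imp_degree_le[OF assms(1)] by (simp add: monom_eq_0_iff degree_monom_eq)
  then obtain e where e: "c = [:e:]" using degree_eq_zeroE by blast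
  then have "e dvd coeff (monom (monom 1 0) N) N"
    using assms(2) const_poly_dvd_iff by metis
  then show ?thesis unfolding e by (simp add: is_unit_const_poly_iff)
qed

lemma syz_basis_surj:
  assumes "length \<mu> = d" "sum_list \<mu> = n" "\<forall>i\<le>d. degree (a i) \<le> n" "syz_basis d a \<mu> P"
  shows "surj_at d n a n"
  using syz_dim_surj[OF assms(3) syz_basis_dim[OF assms(4)]] hilb_large[OF assms(1,2) order_refl] by simp

text \<open>Both conditions on tuples come for free: a linear relation would be a syzygy of degree
  0, below all parts, and a common divisor divides all forms of degree 2 n, among them s^(2 n) and
  t^(2 n).\<close>

lemma param_tuples_of_type_iff:
  assumes "is_partition_of n d \<mu>"
  shows "a \<in> param_tuples_of_type n d \<mu> \<longleftrightarrow>
    a \<in> form_tuples n d \<and> (\<exists>P. syz_basis d (dehoms n a) \<mu> P)"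
proof
  note len = is_partition_ofD(1)[OF assms]
  assume a: "a \<in> param_tuples_of_type n d \<mu>"
  then have "a \<in> form_tuples n d" "has_type d a \<mu>" unfolding param_tuples_of_type_def param_tuples_def by auto
  moreover from this have "\<forall>i\<le>d. a i \<in> forms n" unfolding form_tuples_def by auto
  ultimately show "a \<in> form_tuples n d \<and> (\<exists>P. syz_basis d (dehoms n a) \<mu> P)"
    using syz_basis_if_graded_resolution[OF _ len] unfolding has_type_def by blast
next
  note len = is_partition_ofD(1)[OF assms] and sum = is_partition_ofD(2)[OF assms]
    and pos = is_partition_ofD(3)[OF assms]
  let ?A = "dehoms n a"
  assume "a \<in> form_tuples n d \<and> (\<exists>P. syz_basis d ?A \<mu> P)"
  then obtain P where aF: "a \<in> form_tuples n d" and P: "syz_basis d ?A \<mu> P" by blast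
  have a: "\<forall>i\<le>d. a i \<in> forms n" using aF unfolding form_tuples_def by auto
  have "has_type d a \<mu>"
    using graded_resolution_if_syz_basis[OF a len P] assms unfolding has_type_def is_partition_of_def by blast
  moreover have "lin_indep_tuple d a"
    unfolding lin_indep_tuple_def
  proof (intro allI impI)
    fix c i assume c: "(\<Sum>i\<le>d. smult [:c i:] (a i)) = 0" and i: "i \<le> d"
    have "dehom n (\<Sum>i\<le>d. smult [:c i:] (a i)) = 0" unfolding c by simp
    then have "dotv d ?A (tuple_vec d (\<lambda>i. [:c i:])) = 0"
      by (simp add: dehom_sum dehom_smult_const dotv_tuple_vec)
    then have "tuple_vec d (\<lambda>i. [:c i:]) \<in> syz d ?A 0"
      unfolding syz_def by (simp add: tuple_vec_vecs)
    moreover have "\<forall>g\<in>syz d ?A 0. graded_comb d \<mu> P 0 g"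
      using P unfolding syz_basis_def by (elim conjE allE[of _ 0])
    ultimately obtain h where h: "tuple_vec d (\<lambda>i. [:c i:]) = (\<Sum>j<d. smult (h j) (P j))"
      "\<forall>j<d. \<forall>i. coeff (h j) i \<noteq> 0 \<longrightarrow> i + \<mu> ! j \<le> 0"
      by meson
    have "h j = 0" if j: "j < d" for j
    proof (rule poly_eqI)
      fix l
      have "1 \<le> \<mu> ! j" using pos j len by simp
      then show "coeff (h j) l = coeff 0 l" using h(2) j by fastforce
    qed
    then have "tuple_vec d (\<lambda>i. [:c i:]) = 0" unfolding h(1) by simp
    then have "coeff (tuple_vec d (\<lambda>i. [:c i:])) i = 0" by simp
    then show "c i = 0" using i by (simp add: coeff_tuple_vec)
  qed
  moreover have "rel_prime_tuple d a"
    unfolding rel_prime_tuple_def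
  proof (intro allI impI)
    fix c assume c: "\<forall>i\<le>d. c dvd a i"
    have surj: "surj_at d n ?A n"
      by (rule syz_basis_surj[OF len sum _ P]) (simp add: degree_dehom)
    have hom: "c dvd homog (n + n) q" if "degree q \<le> n + n" for q
    proof -
      obtain v where v: "v \<in> vecs d n" "dotv d ?A v = q" using surj \<open>degree q \<le> n + n\<close> unfolding surj_at_def by blast
      have dv: "dehom n (homog n (coeff v i)) = coeff v i" for i
        using v(1) unfolding vecs_iff by (intro dehom_homog) simp
      have "(\<Sum>i\<le>d. a i * homog n (coeff v i)) - homog (n + n) q = 0"
      proof (rule eq_0_if_dehom)
        fix k
        have "dehom k (\<Sum>i\<le>d. a i * homog n (coeff v i)) =
            (\<Sum>i\<le>d. ?A i * (if n \<le> k then dehom (k - n) (homog n (coeff v i)) else 0))"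
          by (rule dehom_sum_mult) (use a in auto)
        also have "\<dots> = (if k = n + n then dotv d ?A v else 0)"
          using dv by (auto simp: dotv_def dehom_homog_other intro!: sum.neutral)
        also have "\<dots> = dehom k (homog (n + n) q)"
          unfolding v(2) using \<open>degree q \<le> n + n\<close> by (auto simp: dehom_homog dehom_homog_other)
        finally show "dehom k ((\<Sum>i\<le>d. a i * homog n (coeff v i)) - homog (n + n) q) = 0"
          by (simp add: dehom_diff)
      qed
      moreover have "c dvd (\<Sum>i\<le>d. a i * homog n (coeff v i))" using c by (intro dvd_sum) auto
      ultimately show ?thesis by simp
    qed
    have s: "homog (n + n) 1 = monom (monom 1 (n + n)) (0::nat)"
      by (intro poly_eqI) (auto simp: coeff_homog)
    have t: "homog (n + n) (monom 1 (n + n)) = monom (monom 1 0) (n + n)"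
      by (intro poly_eqI) (auto simp: coeff_homog)
    show "is_unit c"
      using hom[of 1, unfolded s] hom[of "monom 1 (n + n)", unfolded t] is_unit_if_dvd_powers[of c "n + n"]
      by (simp add: degree_monom_eq)
  qed
  ultimately show "a \<in> param_tuples_of_type n d \<mu>"
    using aF unfolding param_tuples_of_type_def param_tuples_def by blast
qed

section \<open>Algebraic dependence of polynomial functions\<close>

text \<open>The rows of the system become polynomials of degree below \<open>card B\<close>, so that
  the dimension bound for polynomials applies.\<close>

lemma underdetermined_system:
  fixes M :: "'a \<Rightarrow> 'b \<Rightarrow> 'k::field"
  assumes "finite A" "finite B" "card B < card A"
  shows "\<exists>c. (\<exists>a\<in>A. c a \<noteq> 0) \<and> (\<forall>b\<in>B. (\<Sum>a\<in>A. c a * M a b) = 0)"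
proof (rule ccontr)
  assume H: "\<not> ?thesis"
  obtain h where h: "bij_betw h {..<card B} B"
    using ex_bij_betw_nat_finite[OF assms(2)] by (auto simp: atLeast0LessThan)
  define w where "w a = (\<Sum>l<card B. monom (M a (h l)) l)" for a
  have coeff_w: "coeff (\<Sum>a\<in>A. smult (c a) (w a)) l = (\<Sum>a\<in>A. c a * M a (h l))" if "l < card B" for c l
    using that by (simp add: coeff_sum w_def coeff_monom_sum)
  have "pv.indep_mod {0} A w"
    unfolding pv.indep_mod_def
  proof (intro allI impI)
    fix c assume "(\<Sum>a\<in>A. smult (c a) (w a)) \<in> {0}"
    then have z: "(\<Sum>a\<in>A. c a * M a (h l)) = 0" if "l < card B" for l
      using coeff_w[OF that, of c] by simp
    have "\<forall>b\<in>B. (\<Sum>a\<in>A. c a * M a b) = 0"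
    proof
      fix b assume "b \<in> B"
      then have "b \<in> h ` {..<card B}" using bij_betw_imp_surj_on[OF h] by simp
      then obtain l where "l < card B" "h l = b" by auto
      then show "(\<Sum>a\<in>A. c a * M a b) = 0" using z[of l] by simp
    qed
    with H show "\<forall>a\<in>A. c a = 0" by meson
  qed
  moreover have "w ` A \<subseteq> {q. degree q \<le> card B - 1}"
    by (auto simp: w_def coeff_monom_sum intro!: degree_le)
  ultimately have "0 + card A \<le> card B - 1 + 1"
    by (intro pv.indep_mod_card_le[OF has_dim_polys pv.has_dim_zero _ assms(1)]) simp_all
  \<comment> \<open>For empty \<open>B\<close> the truncated \<open>card B - 1 + 1\<close> is 1, so
    this case survives the count and is settled separately.\<close>
  then have B: "card B = 0" using assms(3) by simp
  then have "B = {}" using assms(2) by simp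
  moreover have "A \<noteq> {}" using assms(3) by auto
  ultimately have "\<exists>c. (\<exists>a\<in>A. c a \<noteq> 0) \<and> (\<forall>b\<in>B. (\<Sum>a\<in>A. c a * M a b) = 0)"
    by (intro exI[of _ "\<lambda>_. 1"]) auto
  with H show False by contradiction
qed

text \<open>Each exponent is bounded separately instead of the total degree: the monomials are then
  indexed by a box, counted by a power of N + 1.\<close>

inductive_set mono_span :: "('p \<Rightarrow> 'k::field) set \<Rightarrow> nat \<Rightarrow> ('p \<Rightarrow> 'k) set"
  for Y :: "('p \<Rightarrow> 'k) set" and N :: nat where
  zero: "(\<lambda>_. 0) \<in> mono_span Y N"
| step: "f \<in> mono_span Y N \<Longrightarrow> \<forall>y\<in>Y. b y \<le> N \<Longrightarrow> (\<lambda>p. c * (\<Prod>y\<in>Y. y p ^ b y) + f p) \<in> mono_span Y N"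

lemma mono_span_mono: "f \<in> mono_span Y N \<Longrightarrow> N \<le> N' \<Longrightarrow> f \<in> mono_span Y N'"
  by (induction rule: mono_span.induct) (auto intro!: mono_span.intros intro: le_trans)

lemma mono_span_add: "f \<in> mono_span Y N \<Longrightarrow> g \<in> mono_span Y N \<Longrightarrow> (\<lambda>p. f p + g p) \<in> mono_span Y N"
  by (induction rule: mono_span.induct) (auto simp: add.assoc intro: mono_span.intros)

lemma mono_span_monomial:
  assumes "\<forall>y\<in>Y. b y \<le> N"
  shows "(\<lambda>p. c * (\<Prod>y\<in>Y. y p ^ b y)) \<in> mono_span Y N"
  using mono_span.step[OF mono_span.zero assms, of c] by simp

lemma mono_span_monomial_mult:
  assumes "g \<in> mono_span Y N'" "\<forall>y\<in>Y. b y \<le> N"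
  shows "(\<lambda>p. c * (\<Prod>y\<in>Y. y p ^ b y) * g p) \<in> mono_span Y (N + N')"
  using assms(1)
proof induction
  case zero
  then show ?case by (simp add: mono_span.zero)
next
  case (step f b' c')
  have "(\<lambda>p. (c * c') * (\<Prod>y\<in>Y. y p ^ (b y + b' y)) + c * (\<Prod>y\<in>Y. y p ^ b y) * f p) \<in> mono_span Y (N + N')"
    using step assms(2) by (intro mono_span.step) (auto intro: add_mono)
  then show ?case by (simp add: power_add prod.distrib algebra_simps)
qed

lemma mono_span_mult:
  assumes "f \<in> mono_span Y N" "g \<in> mono_span Y N'"
  shows "(\<lambda>p. f p * g p) \<in> mono_span Y (N + N')"
  using assms(1)
proof induction
  case zero
  then show ?case by (simp add: mono_span.zero)
next
  case (step f b c)
  show ?case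
    using mono_span_add[OF mono_span_monomial_mult[OF assms(2) step.hyps(2), of c] step.IH]
    by (simp add: distrib_right)
qed

lemma mono_span_const: "(\<lambda>_. c) \<in> mono_span Y N"
  using mono_span_monomial[of Y "\<lambda>_. 0" N c] by simp

lemma mono_span_power: "f \<in> mono_span Y N \<Longrightarrow> (\<lambda>p. f p ^ e) \<in> mono_span Y (e * N)"
  by (induction e) (auto intro: mono_span_const dest: mono_span_mult)

lemma mono_span_prod:
  "finite I \<Longrightarrow> (\<And>i. i \<in> I \<Longrightarrow> f i \<in> mono_span Y N) \<Longrightarrow> (\<lambda>p. \<Prod>i\<in>I. f i p) \<in> mono_span Y (card I * N)"
  by (induction I rule: finite_induct) (auto intro: mono_span_const dest: mono_span_mult)

lemma polyfuns_mono_span: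
  assumes "finite Y" "f \<in> polyfuns Y"
  shows "\<exists>N. f \<in> mono_span Y N"
  using assms(2)
proof induction
  case (const c)
  then show ?case using mono_span_const by blast
next
  case (coord x)
  have "(\<lambda>p. 1 * (\<Prod>y\<in>Y. y p ^ (if y = x then 1 else 0))) \<in> mono_span Y 1"
    by (rule mono_span_monomial) auto
  moreover have "(\<Prod>y\<in>Y. y p ^ (if y = x then 1 else 0)) = x p" for p
  proof -
    have "(\<Prod>y\<in>Y. y p ^ (if y = x then 1 else 0)) = (\<Prod>y\<in>Y. if y = x then y p else 1)"
      by (rule prod.cong) auto
    then show ?thesis using coord assms(1) by simp
  qed
  ultimately show ?case by (intro exI[of _ 1]) simp
next
  case (add f g)
  then obtain N N' where "f \<in> mono_span Y N" "g \<in> mono_span Y N'" by blast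
  then have "f \<in> mono_span Y (max N N')" "g \<in> mono_span Y (max N N')"
    using mono_span_mono by (metis max.cobounded1, metis max.cobounded2)
  then show ?case using mono_span_add by blast
next
  case (mult f g)
  then show ?case using mono_span_mult by blast
qed

lemma mono_span_coeffs:
  assumes "finite Y" "f \<in> mono_span Y N"
  shows "\<exists>M. \<forall>p. f p = (\<Sum>v\<in>Y \<rightarrow>\<^sub>E {..N}. M v * (\<Prod>y\<in>Y. y p ^ v y))"
  using assms(2)
proof induction
  case zero
  show ?case by (rule exI[of _ "\<lambda>_. 0"]) simp
next
  case (step f b c)
  then obtain M where M: "\<And>p. f p = (\<Sum>v\<in>Y \<rightarrow>\<^sub>E {..N}. M v * (\<Prod>y\<in>Y. y p ^ v y))" by blast
  let ?b = "restrict b Y"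
  let ?M = "\<lambda>v. (if v = ?b then c else 0) + M v"
  have fin: "finite (Y \<rightarrow>\<^sub>E {..N})" using assms(1) by (intro finite_PiE) auto
  have b: "?b \<in> Y \<rightarrow>\<^sub>E {..N}" using step.hyps(2) by auto
  have "(\<Sum>v\<in>Y \<rightarrow>\<^sub>E {..N}. ?M v * (\<Prod>y\<in>Y. y p ^ v y)) = c * (\<Prod>y\<in>Y. y p ^ b y) + f p" for p
  proof -
    have "(\<Sum>v\<in>Y \<rightarrow>\<^sub>E {..N}. ?M v * (\<Prod>y\<in>Y. y p ^ v y)) =
      (\<Sum>v\<in>Y \<rightarrow>\<^sub>E {..N}. if v = ?b then c * (\<Prod>y\<in>Y. y p ^ v y) else 0) + f p"
      unfolding M sum.distrib[symmetric] by (rule sum.cong) (auto simp: distrib_right)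
    then show ?thesis using fin b by simp
  qed
  then show ?case by (intro exI[of _ ?M]) simp
qed

text \<open>Products of the \<open>f i\<close> with exponents at most N number (N + 1)^m, whereas
  the monomials needed to write them number about a constant times N^(card Y), fewer for large
  N.\<close>

lemma algebraically_dependent:
  fixes f :: "nat \<Rightarrow> 'p \<Rightarrow> 'k::field"
  assumes "finite Y" "card Y < m" "\<And>i. i < m \<Longrightarrow> f i \<in> polyfuns Y"
  shows "\<exists>N c. (\<exists>u\<in>{..<m} \<rightarrow>\<^sub>E {..N}. c u \<noteq> 0) \<and>
    (\<forall>p. (\<Sum>u\<in>{..<m} \<rightarrow>\<^sub>E {..N}. c u * (\<Prod>i<m. f i p ^ u i)) = 0)"
proof -
  have "\<forall>i. \<exists>N. i < m \<longrightarrow> f i \<in> mono_span Y N" using polyfuns_mono_span[OF assms(1,3)] by blast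
  then obtain N0 where N0: "\<And>i. i < m \<Longrightarrow> f i \<in> mono_span Y (N0 i)" by metis
  define \<delta> where "\<delta> = (\<Sum>i<m. N0 i)"
  have f: "f i \<in> mono_span Y \<delta>" if "i < m" for i
    using N0[OF that] by (rule mono_span_mono) (use that in \<open>auto simp: \<delta>_def intro!: member_le_sum\<close>)
  \<comment> \<open>Chosen so that N' + 1 is at most K (N + 1) and K^(card Y) equals N; the
    monomials then number at most N (N + 1)^(card Y), which is below (N + 1)^m.\<close>
  define K where "K = m * \<delta> + 1"
  define N where "N = K ^ card Y"
  define N' where "N' = m * (N * \<delta>)"
  let ?A = "{..<m} \<rightarrow>\<^sub>E {..N}" and ?B = "Y \<rightarrow>\<^sub>E {..N'}"
  have "(\<lambda>p. \<Prod>i<m. f i p ^ u i) \<in> mono_span Y N'" if "u \<in> ?A" for u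
  proof -
    have "(\<lambda>p. f i p ^ u i) \<in> mono_span Y (N * \<delta>)" if i: "i \<in> {..<m}" for i
    proof -
      have "u i * \<delta> \<le> N * \<delta>" using \<open>u \<in> ?A\<close> i by (intro mult_le_mono1) auto
      then show ?thesis using mono_span_mono[OF mono_span_power[OF f]] i by blast
    qed
    then show ?thesis unfolding N'_def using mono_span_prod[of "{..<m}"] by fastforce
  qed
  then have "\<forall>u. \<exists>M. u \<in> ?A \<longrightarrow> (\<forall>p. (\<Prod>i<m. f i p ^ u i) = (\<Sum>v\<in>?B. M v * (\<Prod>y\<in>Y. y p ^ v y)))"
    using mono_span_coeffs[OF assms(1)] by meson
  from choice[OF this] obtain M where
    M: "\<And>u p. u \<in> ?A \<Longrightarrow> (\<Prod>i<m. f i p ^ u i) = (\<Sum>v\<in>?B. M u v * (\<Prod>y\<in>Y. y p ^ v y))"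
    by auto
  have "card ?B = (N' + 1) ^ card Y" using assms(1) by (simp add: card_PiE)
  also have "\<dots> \<le> (K * (N + 1)) ^ card Y" by (intro power_mono) (auto simp: N'_def K_def algebra_simps)
  also have "\<dots> = N * (N + 1) ^ card Y" by (simp only: power_mult_distrib N_def)
  also have "\<dots> < (N + 1) * (N + 1) ^ card Y" by simp
  also have "\<dots> = (N + 1) ^ (card Y + 1)" by simp
  also have "\<dots> \<le> (N + 1) ^ m" using assms(2) by (intro power_increasing) auto
  also have "\<dots> = card ?A" by (simp add: card_PiE)
  finally have lt: "card ?B < card ?A" .
  have "finite ?A" "finite ?B" using assms(1) by (auto intro!: finite_PiE)
  from underdetermined_system[OF this lt, of M]
  obtain c where c: "(\<exists>u\<in>?A. c u \<noteq> 0) \<and> (\<forall>v\<in>?B. (\<Sum>u\<in>?A. c u * M u v) = 0)" ..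
  have "(\<Sum>u\<in>?A. c u * (\<Prod>i<m. f i p ^ u i)) = 0" for p
  proof -
    have "(\<Sum>u\<in>?A. c u * (\<Prod>i<m. f i p ^ u i)) =
      (\<Sum>u\<in>?A. \<Sum>v\<in>?B. c u * M u v * (\<Prod>y\<in>Y. y p ^ v y))"
      by (rule sum.cong) (simp_all add: M sum_distrib_left mult.assoc)
    also have "\<dots> = (\<Sum>v\<in>?B. (\<Sum>u\<in>?A. c u * M u v) * (\<Prod>y\<in>Y. y p ^ v y))"
      by (subst sum.swap) (simp add: sum_distrib_right)
    also have "\<dots> = 0" using c by simp
    finally show ?thesis .
  qed
  then show ?thesis using c by blast
qed

lemma prime_vanishingD:
  "prime_vanishing X Z \<Longrightarrow> f \<in> polyfuns X \<Longrightarrow> g \<in> polyfuns X \<Longrightarrow> \<forall>z\<in>Z. f z * g z = 0 \<Longrightarrow>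
    \<not> (\<forall>z\<in>Z. f z = 0) \<Longrightarrow> \<forall>z\<in>Z. g z = 0"
  unfolding prime_vanishing_def by meson

lemma sum_PiE_Suc:
  "(\<Sum>u\<in>{..<Suc m} \<rightarrow>\<^sub>E {..N}. F u) = (\<Sum>e\<le>N. \<Sum>u\<in>{..<m} \<rightarrow>\<^sub>E {..N :: nat}. F (u(m := e)))"
proof -
  let ?E = "{..<m} \<rightarrow>\<^sub>E {..N}"
  have "{..<Suc m} \<rightarrow>\<^sub>E {..N} = (\<lambda>(e, u). u(m := e)) ` ({..N} \<times> ?E)"
    unfolding lessThan_Suc using PiE_insert_eq[of m "{..<m}" "\<lambda>_. {..N}"] by simp
  moreover have "inj_on (\<lambda>(e, u). u(m := e)) ({..N} \<times> ?E)"
    using inj_combinator[of m "{..<m}" "\<lambda>_. {..N}"] by simp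
  ultimately have "(\<Sum>u\<in>{..<Suc m} \<rightarrow>\<^sub>E {..N}. F u) = (\<Sum>(e, u)\<in>{..N} \<times> ?E. F (u(m := e)))"
    by (simp add: sum.reindex o_def case_prod_unfold)
  then show ?thesis by (simp add: sum.cartesian_product)
qed

text \<open>
  In a relation among the \<open>f i\<close> holding on \<open>Z (Suc m)\<close>, the lowest power of \<open>f m\<close> can be cancelled
  because \<open>Z (Suc m)\<close> is irreducible; restricting to \<open>Z m\<close>, where \<open>f m\<close> vanishes, leaves a relation
  among the previous functions.
\<close>

lemma chain_algebraically_independent:
  assumes "\<And>i. i \<le> m \<Longrightarrow> prime_vanishing X (Z i)" "\<And>i. i < m \<Longrightarrow> Z i \<subseteq> Z (Suc i)"
    "\<And>i. i < m \<Longrightarrow> f i \<in> polyfuns X" "\<And>i z. i < m \<Longrightarrow> z \<in> Z i \<Longrightarrow> f i z = 0"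
    "\<And>i. i < m \<Longrightarrow> \<exists>z\<in>Z (Suc i). f i z \<noteq> 0"
    "\<And>z. z \<in> Z m \<Longrightarrow> (\<Sum>u\<in>{..<m} \<rightarrow>\<^sub>E {..N}. c u * (\<Prod>i<m. f i z ^ u i)) = 0"
  shows "\<forall>u\<in>{..<m} \<rightarrow>\<^sub>E {..N :: nat}. c u = 0"
  using assms
proof (induction m arbitrary: c)
  case 0
  obtain z where "z \<in> Z 0" using "0.prems"(1)[of 0] unfolding prime_vanishing_def by auto
  then show ?case using "0.prems"(6)[of z] by simp
next
  case (Suc m)
  \<comment> \<open>The coefficient of \<open>f m ^ e\<close> in the relation, a polynomial in the
    earlier functions.\<close>
  define G where "G e z = (\<Sum>u\<in>{..<m} \<rightarrow>\<^sub>E {..N}. c (u(m := e)) * (\<Prod>i<m. f i z ^ u i))" for e z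
  have rel: "(\<Sum>e\<le>N. f m z ^ e * G e z) = 0" if "z \<in> Z (Suc m)" for z
  proof -
    have "(\<Sum>e\<le>N. f m z ^ e * G e z) =
      (\<Sum>e\<le>N. \<Sum>u\<in>{..<m} \<rightarrow>\<^sub>E {..N}. c (u(m := e)) * (\<Prod>i<Suc m. f i z ^ (u(m := e)) i))"
      unfolding G_def sum_distrib_left by (intro sum.cong refl) (simp add: mult_ac)
    then show ?thesis using Suc.prems(6)[OF that] unfolding sum_PiE_Suc by simp
  qed
  have G_poly: "G e \<in> polyfuns X" for e
    unfolding G_def using Suc.prems(3)
    by (intro polyfuns_sum polyfuns.mult polyfuns_prod polyfuns_power polyfuns.const) auto
  have "\<forall>u\<in>{..<m} \<rightarrow>\<^sub>E {..N}. c (u(m := e)) = 0" if "e \<le> N" for e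
    using that
  proof (induction e rule: less_induct)
    case (less e)
    have G0: "G e' z = 0" if "e' < e" for e' z
    proof -
      have "e' \<le> N" using that less.prems by simp
      note less.IH[OF that this]
      then show ?thesis unfolding G_def by (intro sum.neutral ballI) (metis mult_zero_left)
    qed
    \<comment> \<open>The relation divided by \<open>f m ^ e\<close>, its lower coefficients already
      being zero; where \<open>f m\<close> vanishes, only \<open>G e\<close> remains.\<close>
    define H where "H z = (\<Sum>e'\<in>{e..N}. f m z ^ (e' - e) * G e' z)" for z
    have fm: "f m \<in> polyfuns X" using Suc.prems(3) by simp
    have H_poly: "H \<in> polyfuns X"
      unfolding H_def using fm G_poly by (intro polyfuns_sum polyfuns.mult polyfuns_power) auto
    have "f m z ^ e * H z = 0" if "z \<in> Z (Suc m)" for z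
    proof -
      have "(\<Sum>e'\<le>N. f m z ^ e' * G e' z) = (\<Sum>e'\<in>{e..N}. f m z ^ e' * G e' z)"
        using less.prems by (intro sum.mono_neutral_right) (auto simp: G0)
      also have "\<dots> = f m z ^ e * H z"
        unfolding H_def sum_distrib_left by (rule sum.cong) (auto simp flip: mult.assoc power_add)
      finally show ?thesis using rel[OF that] by simp
    qed
    moreover have "\<not> (\<forall>z\<in>Z (Suc m). f m z ^ e = 0)" using Suc.prems(5)[of m] by auto
    ultimately have H0: "\<forall>z\<in>Z (Suc m). H z = 0"
      by (intro prime_vanishingD[OF Suc.prems(1)[OF order_refl] polyfuns_power[OF fm, of e] H_poly]) simp_all
    have "G e z = 0" if z: "z \<in> Z m" for z
    proof -
      have fz: "f m z = 0" using Suc.prems(4)[of m z] z by simp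
      have "H z = (\<Sum>e'\<in>{e..N}. if e' = e then G e z else 0)"
        unfolding H_def fz by (rule sum.cong) auto
      then have "H z = G e z" using less.prems by simp
      then show ?thesis using H0 Suc.prems(2)[of m] z by auto
    qed
    then show ?case
      unfolding G_def using Suc.prems(1-5) by (intro Suc.IH) (simp_all del: fun_upd_apply)
  qed
  then show ?case
    unfolding lessThan_Suc using PiE_insert_eq[of m "{..<m}" "\<lambda>_. {..N}"] by auto
qed

section \<open>Krull dimension\<close>

definition closed_chain :: "'p topology \<Rightarrow> nat \<Rightarrow> (nat \<Rightarrow> 'p set) \<Rightarrow> bool" where
  "closed_chain T m C \<longleftrightarrow> (\<forall>i\<le>m. closedin T (C i) \<and> irreducible_space (subtopology T (C i))) \<and>
     (\<forall>i<m. C i \<subset> C (Suc i))"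

lemma krull_dim_eqI:
  assumes "closed_chain T D C" "\<And>m C. closed_chain T m C \<Longrightarrow> m \<le> D"
  shows "krull_dim T = ereal (real D)"
  unfolding krull_dim_def
proof (rule antisym)
  show "Sup {ereal (real m) |m. \<exists>C. (\<forall>i\<le>m. closedin T (C i) \<and> irreducible_space (subtopology T (C i))) \<and>
      (\<forall>i<m. C i \<subset> C (Suc i))} \<le> ereal (real D)"
    using assms(2) unfolding closed_chain_def by (intro Sup_least) auto
  show "ereal (real D) \<le> Sup {ereal (real m) |m. \<exists>C. (\<forall>i\<le>m. closedin T (C i) \<and> irreducible_space (subtopology T (C i))) \<and>
      (\<forall>i<m. C i \<subset> C (Suc i))}"
    using assms(1) unfolding closed_chain_def by (intro Sup_upper) auto
qed

lemma closed_chain_zariski: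
  assumes "P \<subseteq> S"
  shows "closed_chain (subtopology (zariski S X) P) m C \<longleftrightarrow>
    (\<forall>i\<le>m. closedin (subtopology (zariski S X) P) (C i) \<and> prime_vanishing X (C i)) \<and> (\<forall>i<m. C i \<subset> C (Suc i))"
proof -
  have "irreducible_space (subtopology (subtopology (zariski S X) P) D) \<longleftrightarrow> prime_vanishing X D"
    if "closedin (subtopology (zariski S X) P) D" for D
  proof -
    have D: "D \<subseteq> P" using that unfolding closedin_zariski_subtopology[OF assms] by blast
    then have "P \<inter> D = D" by blast
    then show ?thesis
      unfolding subtopology_subtopology using irreducible_space_zariski[of D S X] D assms by simp
  qed
  then show ?thesis unfolding closed_chain_def by blast
qed

text \<open>Functions separating consecutive members of the chain are independent on its top. Pulled
  back to fewer parameters they satisfy a relation, which holds on \<open>W\<close> and by density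
  on \<open>P\<close>.\<close>

lemma closed_chain_length_le:
  fixes \<phi> :: "'q \<Rightarrow> 'p" and X :: "('p \<Rightarrow> 'k::field) set"
  assumes PS: "P \<subseteq> S" and dense: "\<And>f. f \<in> polyfuns X \<Longrightarrow> \<forall>w\<in>W. f w = 0 \<Longrightarrow> \<forall>p\<in>P. f p = 0"
    and param: "W \<subseteq> range \<phi>" "\<And>x. x \<in> X \<Longrightarrow> (\<lambda>q. x (\<phi> q)) \<in> polyfuns Y" "finite Y" "card Y \<le> D"
    and chain: "closed_chain (subtopology (zariski S X) P) m C"
  shows "m \<le> D"
proof (rule ccontr)
  assume "\<not> m \<le> D"
  then have m: "card Y < m" using param(4) by simp
  note C = chain[unfolded closed_chain_zariski[OF PS]]
  have "\<exists>f\<in>polyfuns X. (\<forall>z\<in>C i. f z = 0) \<and> (\<exists>z\<in>C (Suc i). f z \<noteq> 0)" if "i < m" for i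
  proof -
    obtain z where z: "z \<in> C (Suc i)" "z \<notin> C i" using C \<open>i < m\<close> by blast
    have "closedin (subtopology (zariski S X) P) (C (Suc i))" "closedin (subtopology (zariski S X) P) (C i)"
      using C \<open>i < m\<close> by auto
    then have "z \<in> P" "\<forall>z\<in>P - C i. \<exists>f\<in>polyfuns X. f z \<noteq> 0 \<and> (\<forall>y\<in>C i. f y = 0)"
      using z(1) unfolding closedin_zariski_subtopology[OF PS] by blast+
    then show ?thesis using z by blast
  qed
  then obtain f where f: "\<And>i. i < m \<Longrightarrow> f i \<in> polyfuns X" "\<And>i z. i < m \<Longrightarrow> z \<in> C i \<Longrightarrow> f i z = 0"
    "\<And>i. i < m \<Longrightarrow> \<exists>z\<in>C (Suc i). f i z \<noteq> 0" by metis
  have "(\<lambda>q. f i (\<phi> q)) \<in> polyfuns Y" if "i < m" for i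
    using polyfuns_compose[OF f(1)[OF that], of \<phi> Y] param(2) by blast
  then obtain N c where c: "\<exists>u\<in>{..<m} \<rightarrow>\<^sub>E {..N}. c u \<noteq> 0"
    "\<And>q. (\<Sum>u\<in>{..<m} \<rightarrow>\<^sub>E {..N}. c u * (\<Prod>i<m. f i (\<phi> q) ^ u i)) = 0"
    using algebraically_dependent[OF param(3) m, of "\<lambda>i q. f i (\<phi> q)"] by blast
  define F where "F p = (\<Sum>u\<in>{..<m} \<rightarrow>\<^sub>E {..N}. c u * (\<Prod>i<m. f i p ^ u i))" for p
  have "F \<in> polyfuns X"
    unfolding F_def using f(1) by (intro polyfuns_sum polyfuns.mult polyfuns_prod polyfuns_power polyfuns.const) auto
  moreover have "\<forall>w\<in>W. F w = 0" using param(1) c(2) unfolding F_def by blast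
  ultimately have "\<forall>p\<in>P. F p = 0" by (rule dense)
  moreover have "C m \<subseteq> P" using C unfolding closedin_zariski_subtopology[OF PS] by blast
  ultimately have F0: "F z = 0" if "z \<in> C m" for z using that by blast
  have "\<forall>u\<in>{..<m} \<rightarrow>\<^sub>E {..N}. c u = 0"
    by (rule chain_algebraically_independent[of m X C f]) (use C f F0 in \<open>auto simp: F_def\<close>)
  then show False using c(1) by blast
qed

text \<open>A function \<open>g\<close> supported in \<open>U\<close> makes \<open>f * g\<close>
  vanish on all of \<open>P\<close>, and primeness removes \<open>g\<close>.\<close>

lemma prime_vanishing_dense_open:
  assumes "prime_vanishing X P" "P \<subseteq> S" "openin (zariski S X) U" "P \<inter> U \<noteq> {}" "f \<in> polyfuns X"
    "\<forall>w\<in>P \<inter> U. f w = 0"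
  shows "\<forall>p\<in>P. f p = 0"
proof -
  obtain u where u: "u \<in> P" "u \<in> U" using assms(4) by blast
  then obtain g where g: "g \<in> polyfuns X" "g u \<noteq> 0" "\<forall>y\<in>S. g y \<noteq> 0 \<longrightarrow> y \<in> U"
    using assms(3) unfolding openin_zariski_iff by blast
  have "\<forall>z\<in>P. f z * g z = 0"
  proof
    fix z assume z: "z \<in> P"
    show "f z * g z = 0"
    proof (cases "g z = 0")
      case False
      then have "z \<in> P \<inter> U" using g(3) assms(2) z by blast
      then show ?thesis using assms(6) by simp
    qed simp
  qed
  then have "(\<forall>z\<in>P. f z = 0) \<or> (\<forall>z\<in>P. g z = 0)"
    using assms(1,5) g(1) unfolding prime_vanishing_def by blast
  then show ?thesis using g(2) u(1) by blast
qed

text \<open>\<open>independence_is_open\<close> for an arbitrary finite index set; openness of the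
  rank conditions and of the neighbourhoods in the slice derives from it.\<close>

lemma independence_openin:
  fixes w :: "'i \<Rightarrow> 'p \<Rightarrow> 'q \<Rightarrow> 'k::field"
  assumes "finite I" "\<And>i q. i \<in> I \<Longrightarrow> (\<lambda>p. w i p q) \<in> polyfuns X"
  shows "openin (zariski S X) {p \<in> S. \<forall>c. (\<forall>q. (\<Sum>i\<in>I. c i * w i p q) = 0) \<longrightarrow> (\<forall>i\<in>I. c i = 0)}"
    (is "openin _ {p \<in> S. ?ind p}")
proof -
  obtain h where h: "bij_betw h {..<card I} I"
    using ex_bij_betw_nat_finite[OF assms(1)] by (auto simp: atLeast0LessThan)
  have hI: "h l \<in> I" if "l < card I" for l using bij_betw_apply[OF h] that by simp
  let ?g = "the_inv_into {..<card I} h"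
  have g: "?g (h l) = l" if "l < card I" for l
    using h that by (intro the_inv_into_f_f) (auto simp: bij_betw_def)
  have re: "(\<Sum>i\<in>I. F i) = (\<Sum>l<card I. F (h l))" for F :: "'i \<Rightarrow> 'k"
    using sum.reindex_bij_betw[OF h, of F] by simp
  have ind: "?ind p \<longleftrightarrow> (\<forall>c. (\<forall>q. (\<Sum>l<card I. c l * w (h l) p q) = 0) \<longrightarrow> (\<forall>l<card I. c l = 0))" for p
  proof
    assume L: "?ind p"
    show "\<forall>c. (\<forall>q. (\<Sum>l<card I. c l * w (h l) p q) = 0) \<longrightarrow> (\<forall>l<card I. c l = 0)"
    proof (intro allI impI)
      fix c l assume c: "\<forall>q. (\<Sum>l<card I. c l * w (h l) p q) = 0" and l: "l < card I"
      have "(\<Sum>i\<in>I. c (?g i) * w i p q) = 0" for q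
        unfolding re using c g by simp
      then have "c (?g (h l)) = 0" using L[rule_format, of "\<lambda>i. c (?g i)" "h l"] hI[OF l] by blast
      then show "c l = 0" using g[OF l] by simp
    qed
  next
    assume R: "\<forall>c. (\<forall>q. (\<Sum>l<card I. c l * w (h l) p q) = 0) \<longrightarrow> (\<forall>l<card I. c l = 0)"
    show "?ind p"
    proof (intro allI impI ballI)
      fix c i assume c: "\<forall>q. (\<Sum>i\<in>I. c i * w i p q) = 0" and i: "i \<in> I"
      have "\<forall>l<card I. c (h l) = 0" using R[rule_format, of "\<lambda>l. c (h l)"] c unfolding re by blast
      moreover have "i \<in> h ` {..<card I}" using bij_betw_imp_surj_on[OF h] i by simp
      then obtain l where "l < card I" "h l = i" by auto
      ultimately show "c i = 0" by blast
    qed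
  qed
  show ?thesis
    unfolding openin_zariski_iff
  proof (intro conjI ballI)
    fix p0 assume "p0 \<in> {p \<in> S. ?ind p}"
    then have ind0: "?ind p0" by blast
    have "\<exists>f\<in>polyfuns X. f p0 \<noteq> 0 \<and>
      (\<forall>p c. f p \<noteq> 0 \<longrightarrow> (\<forall>q. (\<Sum>l<card I. c l * w (h l) p q) = 0) \<longrightarrow> (\<forall>l<card I. c l = 0))"
    proof (rule independence_is_open)
      show "(\<lambda>p. w (h l) p q) \<in> polyfuns X" if "l < card I" for l q using assms(2) hI[OF that] by blast
      show "\<forall>l<card I. c l = 0" if "\<forall>q. (\<Sum>l<card I. c l * w (h l) p0 q) = 0" for c
        using ind0[unfolded ind] that by blast
    qed
    then show "\<exists>f\<in>polyfuns X. f p0 \<noteq> 0 \<and> (\<forall>y\<in>S. f y \<noteq> 0 \<longrightarrow> y \<in> {p \<in> S. ?ind p})"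
      unfolding ind by blast
  qed blast
qed

section \<open>The strata are locally closed\<close>

lemma coeff_polyfuns_dehom:
  assumes "i \<le> d"
  shows "coeff_polyfuns (form_coords n d) (\<lambda>a. dehom n (a i))"
  unfolding coeff_polyfuns_def coeff_dehom
proof
  fix j
  show "(\<lambda>a. if j \<le> n then coeff (coeff (a i) j) (n - j) else 0) \<in> polyfuns (form_coords n d)"
  proof (cases "j \<le> n")
    case True
    then have "(\<lambda>a. coeff (coeff (a i) j) (n - j)) \<in> form_coords n d" using assms unfolding form_coords_def by blast
    then have "(\<lambda>a. coeff (coeff (a i) j) (n - j)) \<in> polyfuns (form_coords n d)" by (rule polyfuns.coord)
    then show ?thesis using True by simp
  qed (simp add: polyfuns.const)
qed

lemma coeff_polyfuns_dotv: "coeff_polyfuns (form_coords n d) (\<lambda>a. dotv d (dehoms n a) v)"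
  unfolding dotv_def
  by (intro coeff_polyfuns_sum coeff_polyfuns_mult coeff_polyfuns_const coeff_polyfuns_dehom) simp

lemma injective_openin:
  assumes "finite I"
  shows "openin (form_zariski n d) {a \<in> form_tuples n d.
    \<forall>c. dotv d (dehoms n a) (\<Sum>i\<in>I. smult [:c i:] (e i)) = 0 \<longrightarrow> (\<forall>i\<in>I. c i = (0 :: 'k::field))}"
proof -
  have "(\<forall>q. (\<Sum>i\<in>I. c i * coeff (dotv d (dehoms n a) (e i)) q) = 0) \<longleftrightarrow>
      dotv d (dehoms n a) (\<Sum>i\<in>I. smult [:c i:] (e i)) = 0" for a and c :: "_ \<Rightarrow> 'k"
    by (simp add: poly_eq_iff dotv_sum dotv_smult coeff_sum)
  note eq = this
  show ?thesis
    unfolding form_zariski_def eq[symmetric]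
    by (rule independence_openin[OF assms]) (use coeff_polyfuns_dotv in \<open>auto simp: coeff_polyfuns_def\<close>)
qed

text \<open>The tuples \<open>a\<close> for which \<open>g \<mapsto> \<Sum>i. a i * g i\<close> has rank at least \<open>r\<close> in degree \<open>m\<close>.\<close>

definition rank_ge :: "nat \<Rightarrow> nat \<Rightarrow> nat \<Rightarrow> nat \<Rightarrow> (nat \<Rightarrow> 'k::field poly poly) set" where
  "rank_ge n d m r = (\<Union>e\<in>{e. e ` {..<r} \<subseteq> vecs d m}. {a \<in> form_tuples n d.
     \<forall>c. dotv d (dehoms n a) (\<Sum>l<r. smult [:c l:] (e l)) = 0 \<longrightarrow> (\<forall>l\<in>{..<r}. c l = 0)})"

lemma rank_ge_openin: "openin (form_zariski n d) (rank_ge n d m r)"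
  unfolding rank_ge_def by (intro openin_Union) (auto intro!: injective_openin)

lemma syz_has_dim:
  obtains k where "vv.has_dim (syz d a m) k" "k \<le> (d + 1) * (m + 1)"
  using vv.has_dim_mono[OF has_dim_vecs syz_subspace syz_subset] by blast

lemma sum_smult_vecs:
  "(\<And>i. i \<in> I \<Longrightarrow> e i \<in> vecs d m) \<Longrightarrow> (\<Sum>i\<in>I. smult [:c i:] (e i)) \<in> vecs d m"
  by (intro vv.subspace_sum[OF vecs_subspace] vv.subspace_scale[OF vecs_subspace])

text \<open>The rank is (d + 1)(m + 1) - k, and a complement of the syzygies supplies a witnessing
  family.\<close>

lemma rank_ge_iff:
  assumes "a \<in> form_tuples n d" "vv.has_dim (syz d (dehoms n a) m) k"
  shows "a \<in> rank_ge n d m r \<longleftrightarrow> k + r \<le> (d + 1) * (m + 1)"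
proof
  assume "a \<in> rank_ge n d m r"
  then obtain e where e: "e ` {..<r} \<subseteq> vecs d m"
    "\<And>c. dotv d (dehoms n a) (\<Sum>l<r. smult [:c l:] (e l)) = 0 \<Longrightarrow> \<forall>l\<in>{..<r}. c l = 0"
    unfolding rank_ge_def by blast
  have "vv.indep_mod (syz d (dehoms n a) m) {..<r} e"
    unfolding vv.indep_mod_def syz_def using e(2) by simp
  then show "k + r \<le> (d + 1) * (m + 1)"
    using vv.indep_mod_card_le[OF has_dim_vecs assms(2) syz_subset finite_lessThan _ e(1)] by simp
next
  assume r: "k + r \<le> (d + 1) * (m + 1)"
  let ?s = "(d + 1) * (m + 1) - k"
  obtain e where e: "e ` {..<?s} \<subseteq> vecs d m" "vv.indep_mod (syz d (dehoms n a) m) {..<?s} e"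
    using vv.complement_family_exists[OF has_dim_vecs assms(2) syz_subset] by blast
  have sub: "{..<r} \<subseteq> {..<?s}" using r by auto
  have "\<forall>l\<in>{..<r}. c l = 0" if c: "dotv d (dehoms n a) (\<Sum>l<r. smult [:c l:] (e l)) = 0" for c
  proof -
    let ?c = "\<lambda>l. if l < r then c l else 0"
    have "(\<Sum>l<?s. smult [:?c l:] (e l)) = (\<Sum>l<r. smult [:c l:] (e l))"
      using sub by (intro sum.mono_neutral_cong_right) auto
    moreover have "(\<Sum>l<?s. smult [:?c l:] (e l)) \<in> vecs d m"
      by (rule sum_smult_vecs) (use e(1) in blast)
    ultimately have "(\<Sum>l<?s. smult [:?c l:] (e l)) \<in> syz d (dehoms n a) m"
      using c unfolding syz_def by simp
    then have z: "\<forall>l\<in>{..<?s}. ?c l = 0"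
      using e(2)[unfolded vv.indep_mod_def, THEN spec, of ?c] by (rule rev_mp)
    show ?thesis
    proof
      fix l assume "l \<in> {..<r}"
      then show "c l = 0" using bspec[OF z, of l] sub by auto
    qed
  qed
  moreover have "e ` {..<r} \<subseteq> vecs d m" by (rule subset_trans[OF image_mono[OF sub] e(1)])
  ultimately show "a \<in> rank_ge n d m r" using assms(1) unfolding rank_ge_def by (intro UN_I[of e]) simp_all
qed

lemma hilb_le: "hilb d \<mu> m \<le> d * (m + 1)"
proof -
  have "hilb d \<mu> m \<le> (\<Sum>j<d. m + 1)" unfolding hilb_def by (rule sum_mono) simp
  then show ?thesis by simp
qed

text \<open>2 n + 1 is the dimension of the target, so this rank is full.\<close>

lemma surj_at_iff_rank_ge:
  assumes "a \<in> form_tuples n d"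
  shows "surj_at d n (dehoms n a) n \<longleftrightarrow> a \<in> rank_ge n d n (n + n + 1)"
proof -
  obtain k where k: "vv.has_dim (syz d (dehoms n a) n) k" "k \<le> (d + 1) * (n + 1)"
    using syz_has_dim by blast
  have deg: "\<forall>i\<le>d. degree (dehoms n a i) \<le> n" by (simp add: degree_dehom)
  show ?thesis
    unfolding rank_ge_iff[OF assms k(1)]
  proof
    assume "surj_at d n (dehoms n a) n"
    note * = surj_syz_dim[OF deg this]
    then show "k + (n + n + 1) \<le> (d + 1) * (n + 1)" using vv.has_dim_unique[OF k(1) *(1)] by simp
  next
    assume "k + (n + n + 1) \<le> (d + 1) * (n + 1)"
    then show "surj_at d n (dehoms n a) n" by (rule syz_dim_surj[OF deg k(1)])
  qed
qed

text \<open>Both bounds together prescribe the rank exactly, hence the dimensions from which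
  \<open>syz_basis_exists\<close> builds a basis. The lower bounds are open conditions, the upper
  ones closed.\<close>

lemma type_iff_ranks:
  assumes part: "is_partition_of n d \<mu>" and a: "a \<in> form_tuples n d"
  shows "a \<in> param_tuples_of_type n d \<mu> \<longleftrightarrow>
    (\<forall>m\<le>n. a \<in> rank_ge n d m ((d + 1) * (m + 1) - hilb d \<mu> m)) \<and>
    (\<forall>m\<le>n. a \<notin> rank_ge n d m ((d + 1) * (m + 1) - hilb d \<mu> m + 1))"
proof -
  note mu = is_partition_ofD(1,4,3,2)[OF part]
  have le: "hilb d \<mu> m \<le> (d + 1) * (m + 1)" for m using hilb_le[of d \<mu> m] by simp
  have ranks: "a \<in> rank_ge n d m ((d + 1) * (m + 1) - hilb d \<mu> m) \<and>
      a \<notin> rank_ge n d m ((d + 1) * (m + 1) - hilb d \<mu> m + 1) \<longleftrightarrow>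
      vv.has_dim (syz d (dehoms n a) m) (hilb d \<mu> m)" for m
  proof -
    obtain k where k: "vv.has_dim (syz d (dehoms n a) m) k" "k \<le> (d + 1) * (m + 1)"
      using syz_has_dim by blast
    have "vv.has_dim (syz d (dehoms n a) m) (hilb d \<mu> m) \<longleftrightarrow> k = hilb d \<mu> m"
      using vv.has_dim_unique[OF k(1)] k(1) by blast
    then show ?thesis unfolding rank_ge_iff[OF a k(1)] using le[of m] by linarith
  qed
  have "a \<in> param_tuples_of_type n d \<mu> \<longleftrightarrow> (\<forall>m\<le>n. vv.has_dim (syz d (dehoms n a) m) (hilb d \<mu> m))"
  proof
    assume "a \<in> param_tuples_of_type n d \<mu>"
    then obtain P where "syz_basis d (dehoms n a) \<mu> P" unfolding param_tuples_of_type_iff[OF part] by blast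
    then show "\<forall>m\<le>n. vv.has_dim (syz d (dehoms n a) m) (hilb d \<mu> m)" using syz_basis_dim by blast
  next
    assume "\<forall>m\<le>n. vv.has_dim (syz d (dehoms n a) m) (hilb d \<mu> m)"
    then have "\<exists>P. syz_basis d (dehoms n a) \<mu> P"
      by (intro syz_basis_exists(2)[OF mu]) (simp_all add: degree_dehom)
    then show "a \<in> param_tuples_of_type n d \<mu>" unfolding param_tuples_of_type_iff[OF part] using a by blast
  qed
  then show ?thesis unfolding ranks[symmetric] by blast
qed

lemma topspace_form_zariski: "topspace (form_zariski n d) = form_tuples n d"
  unfolding form_zariski_def by simp

lemma type_subset: "param_tuples_of_type n d \<mu> \<subseteq> form_tuples n d"
  unfolding param_tuples_of_type_def param_tuples_def by blast

lemma type_locally_closed: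
  assumes part: "is_partition_of n d \<mu>"
  shows "\<exists>V. closedin (form_zariski n d) V \<and>
    openin (subtopology (form_zariski n d) V) (param_tuples_of_type n d \<mu> :: (nat \<Rightarrow> 'k::field poly poly) set)"
proof -
  let ?F = "form_tuples n d :: (nat \<Rightarrow> 'k poly poly) set"
  define r where "r m = (d + 1) * (m + 1) - hilb d \<mu> m" for m
  define V where "V = ?F - (\<Union>m\<le>n. rank_ge n d m (r m + 1))"
  define U where "U = (\<Inter>m\<le>n. rank_ge n d m (r m) :: (nat \<Rightarrow> 'k poly poly) set)"
  have "openin (form_zariski n d) (\<Union>m\<le>n. rank_ge n d m (r m + 1) :: (nat \<Rightarrow> 'k poly poly) set)"
    by (intro openin_Union) (auto intro: rank_ge_openin)
  then have "closedin (form_zariski n d) V"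
    unfolding V_def topspace_form_zariski[symmetric] by (rule closedin_diff[OF closedin_topspace])
  moreover have "openin (form_zariski n d) U"
    unfolding U_def by (intro openin_INT2) (auto intro: rank_ge_openin)
  moreover have "param_tuples_of_type n d \<mu> = V \<inter> U"
  proof (rule Set.set_eqI)
    fix a :: "nat \<Rightarrow> 'k poly poly"
    show "a \<in> param_tuples_of_type n d \<mu> \<longleftrightarrow> a \<in> V \<inter> U"
    proof (cases "a \<in> ?F")
      case True
      then show ?thesis unfolding type_iff_ranks[OF part True] V_def U_def r_def by auto
    next
      case False
      then show ?thesis using type_subset unfolding V_def by blast
    qed
  qed
  ultimately show ?thesis by (metis openin_subtopology_Int2)
qed

section \<open>Parametrization by maximal minors\<close>

definition para :: "nat \<Rightarrow> nat \<Rightarrow> 'k::field \<Rightarrow> (nat \<Rightarrow> 'k poly poly) \<Rightarrow> nat \<Rightarrow> 'k poly poly" where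
  "para n d c P = (\<lambda>i\<in>{..d}. homog n (smult c (minor d P i)))"

definition syz_columns :: "nat \<Rightarrow> nat list \<Rightarrow> (nat \<Rightarrow> 'k::field poly poly) set" where
  "syz_columns d \<mu> = {P. \<forall>j<d. P j \<in> vecs d (\<mu> ! j)}"

lemma para_form_tuples: "para n d c P \<in> form_tuples n d"
  unfolding para_def form_tuples_def by (auto simp: homog_forms)

lemma form_tuple_eqI:
  assumes "a \<in> form_tuples n d" "b \<in> form_tuples n d" "\<And>i. i \<le> d \<Longrightarrow> dehom n (a i) = dehom n (b i)"
  shows "a = b"
proof (rule PiE_ext)
  show "a \<in> {..d} \<rightarrow>\<^sub>E forms n" "b \<in> {..d} \<rightarrow>\<^sub>E forms n" using assms unfolding form_tuples_def by blast+
  fix i assume i: "i \<in> {..d}"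
  then have "a i \<in> forms n" "b i \<in> forms n" using assms unfolding form_tuples_def by auto
  then show "a i = b i" using assms(3)[of i] i homog_dehom by (metis atMost_iff)
qed

lemma dehom_para:
  assumes "length \<mu> = d" "sum_list \<mu> = n" "P \<in> syz_columns d \<mu>" "i \<le> d"
  shows "dehom n (para n d c P i) = smult c (minor d P i)"
proof -
  have "degree (smult c (minor d P i)) \<le> n"
    using degree_minor[of d P \<mu> i] assms le_trans[OF degree_smult_le] unfolding syz_columns_def by blast
  then show ?thesis using assms(4) unfolding para_def by (simp add: dehom_homog)
qed

lemma coeff_polyfuns_minor:
  assumes "\<And>j i. j < d \<Longrightarrow> coeff_polyfuns Y (\<lambda>p. coeff (P p j) i)"
  shows "coeff_polyfuns Y (\<lambda>p. minor d (P p) i)"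
  unfolding minor_def det_def'[OF bordered_carrier]
proof (intro coeff_polyfuns_sum coeff_polyfuns_mult coeff_polyfuns_const coeff_polyfuns_prod)
  fix p r assume p: "p \<in> {p. p permutes {0..<Suc d}}" and r: "r \<in> {0..<Suc d}"
  then have "p r < Suc d" using permutes_in_image[of p "{0..<Suc d}" r] by simp
  then have *: "bordered d Q (monom 1 i) $$ (r, p r) = coeff (if p r = 0 then monom 1 i else Q (p r - 1)) r" for Q
    using r by (simp add: bordered_def)
  show "coeff_polyfuns Y (\<lambda>x. bordered d (P x) (monom 1 i) $$ (r, p r))"
    unfolding * using assms[of "p r - 1" r] \<open>p r < Suc d\<close> by (cases "p r = 0") (simp_all add: coeff_polyfuns_const)
qed

lemma para_polyfuns:
  assumes "c \<in> polyfuns Y" "\<And>j i. j < d \<Longrightarrow> coeff_polyfuns Y (\<lambda>p. coeff (P p j) i)" "x \<in> form_coords n d"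
  shows "(\<lambda>p. x (para n d (c p) (P p))) \<in> polyfuns Y"
proof -
  obtain i j where x: "x = (\<lambda>a. coeff (coeff (a i) j) (n - j))" "i \<le> d" "j \<le> n"
    using assms(3) unfolding form_coords_def by blast
  have "x (para n d (c p) (P p)) = coeff (smult (c p) (minor d (P p) i)) j" for p
    using x by (simp add: para_def coeff_homog)
  moreover have "coeff_polyfuns Y (\<lambda>p. smult (c p) (minor d (P p) i))"
    by (intro coeff_polyfuns_smult assms coeff_polyfuns_minor)
  ultimately show ?thesis unfolding coeff_polyfuns_def by simp
qed

text \<open>In the parameter space full rank is the only condition left: columns of the right
  degrees are automatically syzygies of their minors, and full rank makes them a basis.\<close>

lemma para_of_type:
  assumes part: "is_partition_of n d \<mu>" and P: "P \<in> syz_columns d \<mu>"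
    and surj: "para n d c P \<in> rank_ge n d n (n + n + 1)"
  shows "para n d c P \<in> param_tuples_of_type n d \<mu>"
proof -
  note mu = is_partition_ofD(1,2)[OF part]
  have "syz_basis d (dehoms n (para n d c P)) \<mu> P"
  proof (rule syz_basis_of_minors[OF mu])
    show "surj_at d n (dehoms n (para n d c P)) n"
      using surj surj_at_iff_rank_ge[OF para_form_tuples] by blast
  qed (use P dehom_para[OF mu P] in \<open>auto simp: syz_columns_def\<close>)
  then show ?thesis unfolding param_tuples_of_type_iff[OF part] using para_form_tuples by blast
qed

lemma type_surj:
  assumes part: "is_partition_of n d \<mu>" and a: "a \<in> param_tuples_of_type n d \<mu>"
  shows "surj_at d n (dehoms n a) n"
proof -
  note mu = is_partition_ofD(1,2)[OF part]
  obtain P where P: "syz_basis d (dehoms n a) \<mu> P" using a unfolding param_tuples_of_type_iff[OF part] by blast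
  show ?thesis by (rule syz_basis_surj[OF mu _ P]) (simp add: degree_dehom)
qed

lemma type_is_para:
  assumes part: "is_partition_of n d \<mu>" and a: "a \<in> param_tuples_of_type n d \<mu>"
    and P: "\<forall>j<d. P j \<in> syz d (dehoms n a) (\<mu> ! j)" "poly_indep d P"
  shows "\<exists>c. a = para n d c P"
proof -
  note mu = is_partition_ofD(1,2)[OF part]
  have deg: "\<forall>i\<le>d. degree (dehoms n a i) \<le> n" by (simp add: degree_dehom)
  obtain c where c: "\<forall>i\<le>d. dehom n (a i) = smult c (minor d P i)"
    using hilbert_burch[OF mu deg type_surj[OF part a] P] by blast
  have col: "P \<in> syz_columns d \<mu>" using P(1) unfolding syz_columns_def syz_def by blast
  have "a = para n d c P"
  proof (rule form_tuple_eqI[OF _ para_form_tuples])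
    show "a \<in> form_tuples n d" using a type_subset by blast
  qed (use c dehom_para[OF mu col] in simp)
  then show ?thesis by blast
qed

section \<open>Lines in the parameter space and irreducibility\<close>

definition para_line ::
    "nat \<Rightarrow> nat \<Rightarrow> 'k::field \<Rightarrow> (nat \<Rightarrow> 'k poly poly) \<Rightarrow> 'k \<Rightarrow> (nat \<Rightarrow> 'k poly poly) \<Rightarrow> 'k \<Rightarrow> nat \<Rightarrow> 'k poly poly" where
  "para_line n d c P c' Q t = para n d (c + t * (c' - c)) (\<lambda>j. P j + smult [:t:] (Q j - P j))"

lemma para_line_polyfuns:
  assumes "x \<in> form_coords n d"
  shows "(\<lambda>t. x (para_line n d c P c' Q t)) \<in> polyfuns {\<lambda>t. t}"
  unfolding para_line_def
proof (rule para_polyfuns[OF _ _ assms])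
  have id: "(\<lambda>t. t) \<in> polyfuns {\<lambda>t. t :: 'a}" by (rule polyfuns.coord) simp
  show "(\<lambda>t. c + t * (c' - c)) \<in> polyfuns {\<lambda>t. t}"
    by (intro polyfuns.add polyfuns.mult polyfuns.const id)
  fix j i
  have "coeff_polyfuns {\<lambda>t. t} (\<lambda>t. coeff (P j) i + smult t (coeff (Q j - P j) i))"
    by (intro coeff_polyfuns_add coeff_polyfuns_const coeff_polyfuns_smult id)
  then show "coeff_polyfuns {\<lambda>t. t} (\<lambda>t. coeff (P j + smult [:t:] (Q j - P j)) i)" by simp
qed

lemma para_line_in_open:
  assumes "openin (form_zariski n d) U" "para_line n d c P c' Q t0 \<in> U"
  shows "finite {t. para_line n d c P c' Q t \<notin> U}"
proof (rule path_in_open[where \<gamma> = "para_line n d c P c' Q" and ?t0.0 = t0])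
  show "openin (zariski (form_tuples n d) (form_coords n d)) U" using assms(1) unfolding form_zariski_def .
qed (simp_all add: assms(2) para_line_polyfuns, simp add: para_line_def para_form_tuples)

text \<open>All matrices on the line have columns of the right degrees, so leaving the stratum means
  losing full rank, and full rank holds at t = 0.\<close>

lemma para_line_of_type:
  assumes part: "is_partition_of n d \<mu>" and P: "P \<in> syz_columns d \<mu>" and Q: "Q \<in> syz_columns d \<mu>"
    and start: "para n d c P \<in> param_tuples_of_type n d \<mu>"
  shows "finite {t. para_line n d c P c' Q t \<notin> param_tuples_of_type n d \<mu>}"
proof (rule finite_subset)
  have "(\<lambda>j. P j + smult [:t:] (Q j - P j)) \<in> syz_columns d \<mu>" for t
    using P Q unfolding syz_columns_def
    by (auto intro!: vv.subspace_add[OF vecs_subspace] vv.subspace_scale[OF vecs_subspace] vv.subspace_diff[OF vecs_subspace])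
  then show "{t. para_line n d c P c' Q t \<notin> param_tuples_of_type n d \<mu>} \<subseteq>
      {t. para_line n d c P c' Q t \<notin> rank_ge n d n (n + n + 1)}"
    unfolding para_line_def using para_of_type[OF part] by blast
  have "para_line n d c P c' Q 0 \<in> rank_ge n d n (n + n + 1)"
    using type_surj[OF part start] surj_at_iff_rank_ge[OF para_form_tuples[of n d c P]] by (simp add: para_line_def)
  then show "finite {t. para_line n d c P c' Q t \<notin> rank_ge n d n (n + n + 1)}"
    by (rule para_line_in_open[OF rank_ge_openin])
qed

text \<open>Kept general in \<open>A\<close>, to serve for the whole stratum and for the coordinate
  subspaces of the slice.\<close>

definition para_set :: "nat \<Rightarrow> nat \<Rightarrow> nat list \<Rightarrow> (nat \<Rightarrow> 'k::field poly poly) set \<Rightarrow> (nat \<Rightarrow> 'k poly poly) set" where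
  "para_set n d \<mu> A = {a \<in> param_tuples_of_type n d \<mu>. \<exists>c. \<exists>P\<in>A. a = para n d c P}"

lemma prime_vanishing_para_set:
  fixes A :: "(nat \<Rightarrow> 'k::field poly poly) set"
  assumes inf: "infinite (UNIV :: 'k set)" and part: "is_partition_of n d \<mu>"
    and A: "A \<subseteq> syz_columns d \<mu>" "\<And>P Q t. P \<in> A \<Longrightarrow> Q \<in> A \<Longrightarrow> (\<lambda>j. P j + smult [:t:] (Q j - P j)) \<in> A"
    and ne: "para_set n d \<mu> A \<noteq> {}"
  shows "prime_vanishing (form_coords n d) (para_set n d \<mu> A)"
proof (rule prime_vanishing_if_paths[OF inf ne])
  fix z1 z2 assume z1: "z1 \<in> para_set n d \<mu> A" and z2: "z2 \<in> para_set n d \<mu> A"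
  obtain c P where cP: "P \<in> A" "z1 = para n d c P" using z1 unfolding para_set_def by blast
  obtain c' Q where cQ: "Q \<in> A" "z2 = para n d c' Q" using z2 unfolding para_set_def by blast
  let ?\<gamma> = "para_line n d c P c' Q"
  have "?\<gamma> t \<in> para_set n d \<mu> A" if "?\<gamma> t \<in> param_tuples_of_type n d \<mu>" for t
    using that A(2)[OF cP(1) cQ(1), of t] unfolding para_set_def para_line_def by blast
  then have "{t. ?\<gamma> t \<notin> para_set n d \<mu> A} \<subseteq> {t. ?\<gamma> t \<notin> param_tuples_of_type n d \<mu>}" by blast
  moreover have "finite {t. ?\<gamma> t \<notin> param_tuples_of_type n d \<mu>}"
    using A(1) cP cQ z1 by (intro para_line_of_type[OF part]) (auto simp: para_set_def)
  ultimately have "finite {t. ?\<gamma> t \<notin> para_set n d \<mu> A}" by (rule finite_subset)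
  moreover have "?\<gamma> 0 = z1" "?\<gamma> 1 = z2" using cP cQ by (simp_all add: para_line_def one_pCons[symmetric] pCons_one)
  ultimately show "\<exists>\<gamma>. (\<forall>x\<in>form_coords n d. (\<lambda>t. x (\<gamma> t)) \<in> polyfuns {\<lambda>t. t}) \<and>
      \<gamma> 0 = z1 \<and> \<gamma> 1 = z2 \<and> finite {t. \<gamma> t \<notin> para_set n d \<mu> A}"
    using para_line_polyfuns by (intro exI[of _ ?\<gamma>] conjI ballI)
qed

lemma para_set_all:
  assumes part: "is_partition_of n d \<mu>"
  shows "para_set n d \<mu> (syz_columns d \<mu>) = param_tuples_of_type n d \<mu>"
proof -
  have "\<exists>c. \<exists>P\<in>syz_columns d \<mu>. a = para n d c P" if a: "a \<in> param_tuples_of_type n d \<mu>" for a :: "nat \<Rightarrow> 'a poly poly"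
  proof -
    obtain P where P: "syz_basis d (dehoms n a) \<mu> P" using a unfolding param_tuples_of_type_iff[OF part] by blast
    then have P': "\<forall>j<d. P j \<in> syz d (dehoms n a) (\<mu> ! j)" "poly_indep d P" unfolding syz_basis_def by blast+
    moreover have "P \<in> syz_columns d \<mu>" using P'(1) unfolding syz_columns_def syz_def by blast
    ultimately show ?thesis using type_is_para[OF part a P'] by blast
  qed
  then show ?thesis unfolding para_set_def by blast
qed

text \<open>
  A point of the stratum: \<open>a i = \<plusminus> t ^ (\<mu>\<^sub>i\<^sub>+\<^sub>1 + \<dots> + \<mu>\<^sub>d)\<close>, up to powers of \<open>s\<close>, with the syzygies
  \<open>e\<^sub>j + t ^ \<mu>\<^sub>j e\<^sub>j\<^sub>+\<^sub>1\<close>.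
\<close>

lemma type_nonempty:
  assumes part: "is_partition_of n d \<mu>" and d: "1 \<le> d"
  shows "param_tuples_of_type n d \<mu> \<noteq> ({} :: (nat \<Rightarrow> 'k::field poly poly) set)"
proof -
  note mu = is_partition_ofD(1-3)[OF part]
  define b where "b i = monom ((-1) ^ i :: 'k) (\<Sum>l\<in>{i..<d}. \<mu> ! l)" for i
  define P where "P j = monom 1 j + monom (monom (1 :: 'k) (\<mu> ! j)) (Suc j)" for j
  define a where "a = (\<lambda>i\<in>{..d}. homog n (b i))"
  have sum: "(\<Sum>l\<in>{0..<d}. \<mu> ! l) = n" using mu by (simp add: sum_list_sum_nth)
  have deg: "degree (b i) \<le> n" for i
  proof -
    have "degree (b i) \<le> (\<Sum>l\<in>{i..<d}. \<mu> ! l)" unfolding b_def by (rule degree_monom_le)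
    also have "\<dots> \<le> (\<Sum>l\<in>{0..<d}. \<mu> ! l)" by (rule sum_mono2) auto
    finally show ?thesis unfolding sum .
  qed
  have A: "dehom n (a i) = b i" if "i \<le> d" for i using that deg by (simp add: a_def dehom_homog)
  have dot: "dotv d (dehoms n a) v = dotv d b v" for v
    unfolding dotv_def by (rule sum.cong) (use A in auto)
  have "surj_at d n (dehoms n a) n"
    unfolding surj_at_def dot
  proof (intro allI impI)
    fix q :: "'k poly" assume q: "degree q \<le> n + n"
    \<comment> \<open>In q = t^n q1 + q0 the first part is reached through \<open>b 0\<close>, which
      is t^n, the second through the constant \<open>b d\<close>, whose sign (-1)^d is undone in
      \<open>v\<close>.\<close>
    define q1 where "q1 = poly_shift n q"
    define q0 where "q0 = poly_cutoff n q"
    have q01: "q = monom 1 n * q1 + q0"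
      by (intro poly_eqI) (auto simp: q1_def q0_def coeff_poly_shift coeff_poly_cutoff coeff_monom_mult)
    have "degree q1 \<le> n"
      using q by (intro degree_le) (auto simp: q1_def coeff_poly_shift coeff_eq_0)
    moreover have "degree q0 \<le> n"
      by (intro degree_le) (auto simp: q0_def coeff_poly_cutoff)
    moreover define v where "v = monom q1 0 + monom (smult ((-1) ^ d) q0) d"
    ultimately have "v \<in> vecs d n"
      using d degree_smult_le[of "(-1) ^ d" q0] unfolding vecs_iff by (auto simp: coeff_monom)
    moreover have "dotv d b v = q"
    proof -
      have "dotv d b (monom q1 0) = monom 1 n * q1"
        using sum by (subst dotv_monom) (simp_all add: b_def atLeast0LessThan)
      moreover have "dotv d b (monom (smult ((-1) ^ d) q0) d) = q0"
        by (subst dotv_monom) (simp_all add: b_def smult_monom monom_0 flip: power_add mult_2)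
      ultimately show ?thesis unfolding v_def q01 dotv_add by simp
    qed
    ultimately show "\<exists>v\<in>vecs d n. dotv d b v = q" by blast
  qed
  moreover have "\<forall>j<d. P j \<in> syz d (dehoms n a) (\<mu> ! j)"
  proof (intro allI impI)
    fix j assume j: "j < d"
    have "P j \<in> vecs d (\<mu> ! j)"
      using j unfolding P_def vecs_iff by (auto simp: coeff_monom degree_monom_le)
    moreover have "dotv d b (P j) = 0"
    proof -
      have "(\<Sum>l\<in>{j..<d}. \<mu> ! l) = (\<Sum>l\<in>{Suc j..<d}. \<mu> ! l) + \<mu> ! j" using j by (simp add: sum.atLeast_Suc_lessThan)
      then have "b j + b (Suc j) * monom 1 (\<mu> ! j) = 0"
        by (simp add: b_def mult_monom add_monom)
      then show ?thesis using j by (simp add: P_def dotv_add dotv_monom)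
    qed
    ultimately show "P j \<in> syz d (dehoms n a) (\<mu> ! j)" unfolding syz_def by (simp add: dot)
  qed
  moreover have "poly_indep d P"
  proof (rule poly_indep_if_const_coeffs, intro allI impI)
    fix c j assume c: "\<forall>r. (\<Sum>j<d. c j * coeff (coeff (P j) r) 0) = 0" and j: "j < d"
    have "(\<Sum>i<d. c i * coeff (coeff (P i) j) 0) = (\<Sum>i<d. if i = j then c i else 0)"
    proof (rule sum.cong[OF refl])
      fix i assume "i \<in> {..<d}"
      then have "1 \<le> \<mu> ! i" using mu by simp
      then show "c i * coeff (coeff (P i) j) 0 = (if i = j then c i else 0)" by (auto simp: P_def)
    qed
    then show "c j = 0" using c j by simp
  qed
  ultimately have "syz_basis d (dehoms n a) \<mu> P"
    using mu by (intro syz_basis_if_indep) (auto simp: degree_dehom)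
  moreover have "a \<in> form_tuples n d" by (auto simp: a_def form_tuples_def homog_forms)
  ultimately show ?thesis using param_tuples_of_type_iff[OF part] by blast
qed

lemma type_prime_vanishing:
  assumes "infinite (UNIV :: 'k::field set)" "is_partition_of n d \<mu>" "1 \<le> d"
  shows "prime_vanishing (form_coords n d) (param_tuples_of_type n d \<mu> :: (nat \<Rightarrow> 'k poly poly) set)"
  unfolding para_set_all[OF assms(2), symmetric]
proof (rule prime_vanishing_para_set[OF assms(1,2) order_refl])
  show "para_set n d \<mu> (syz_columns d \<mu>) \<noteq> ({} :: (nat \<Rightarrow> 'k poly poly) set)"
    unfolding para_set_all[OF assms(2)] by (rule type_nonempty[OF assms(2,3)])
qed (auto simp: syz_columns_def intro!: vv.subspace_add[OF vecs_subspace] vv.subspace_scale[OF vecs_subspace] vv.subspace_diff[OF vecs_subspace])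

section \<open>A slice of the parametrization\<close>

text \<open>A combination without constant terms is t times a syzygy; expanding that syzygy in the
  basis gives a second expression, and independence over k[t] compares them at t = 0.\<close>

lemma syz_basis_const_coeffs:
  assumes mu: "length \<mu> = d" "sum_list \<mu> = n" "1 \<le> n" and P: "syz_basis d a \<mu> P"
    and c: "\<forall>r. (\<Sum>j<d. c j * coeff (coeff (P j) r) 0) = 0"
  shows "\<forall>j<d. c j = 0"
proof -
  let ?g = "\<Sum>j<d. smult [:c j:] (P j)"
  have syz: "P j \<in> syz d a n" if "j < d" for j
  proof (rule syz_mono)
    show "P j \<in> syz d a (\<mu> ! j)" using P that unfolding syz_basis_def by blast
    show "\<mu> ! j \<le> n" using mu elem_le_sum_list[of j \<mu>] that by simp
  qed
  have "?g \<in> syz d a n"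
    by (intro vv.subspace_sum[OF syz_subspace] vv.subspace_scale[OF syz_subspace] syz) simp
  moreover have "\<forall>r. coeff (coeff ?g r) 0 = 0" using c by (simp add: coeff_sum)
  ultimately have "?g \<in> smult [:0, 1:] ` syz d a (n - 1)" using mu(3) by (rule syz_div_x)
  then obtain g' where g': "g' \<in> syz d a (n - 1)" "?g = smult [:0, 1:] g'" by blast
  have "\<forall>g\<in>syz d a (n - 1). graded_comb d \<mu> P (n - 1) g"
    using P unfolding syz_basis_def by (elim conjE allE[of _ "n - 1"])
  then obtain h where h: "g' = (\<Sum>j<d. smult (h j) (P j))" using g'(1) by meson
  have "(\<Sum>j<d. smult ([:c j:] - [:0, 1:] * h j) (P j)) = ?g - smult [:0, 1:] g'"
    unfolding h smult_sum_right smult_diff_left sum_subtractf by simp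
  then have z: "(\<Sum>j<d. smult ([:c j:] - [:0, 1:] * h j) (P j)) = 0" using g'(2) by simp
  have indep: "poly_indep d P" using P unfolding syz_basis_def by blast
  show ?thesis
  proof (intro allI impI)
    fix j assume "j < d"
    then have "[:c j:] - [:0, 1:] * h j = 0"
      using indep[unfolded poly_indep_def, THEN spec, of "\<lambda>j. [:c j:] - [:0, 1:] * h j"] z by blast
    then have "coeff ([:c j:] - [:0, 1:] * h j) 0 = 0" by simp
    then show "c j = 0" by simp
  qed
qed

text \<open>
  The columns \<open>P0 j\<close> are perturbed inside a complement, spanned by the \<open>e j l\<close>, of the syzygies of
  \<open>a0\<close> in degree \<open>\<mu>\<^sub>j\<close>; near \<open>a0\<close> this picks exactly one syzygy matrix for each tuple in the stratum.
\<close>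

locale slice =
  fixes n d :: nat and \<mu> :: "nat list" and a0 :: "nat \<Rightarrow> 'k::field poly poly" and c0 :: 'k
    and P0 :: "nat \<Rightarrow> 'k poly poly" and q :: "nat \<Rightarrow> nat" and e :: "nat \<Rightarrow> nat \<Rightarrow> 'k poly poly"
  assumes inf: "infinite (UNIV :: 'k set)" and part: "is_partition_of n d \<mu>" and d: "1 \<le> d"
    and basis: "syz_basis d (dehoms n a0) \<mu> P0" and a0: "a0 = para n d c0 P0"
    and q: "\<And>j. j < d \<Longrightarrow> q j + hilb d \<mu> (\<mu> ! j) = (d + 1) * (\<mu> ! j + 1)"
    and e_vecs: "\<And>j l. j < d \<Longrightarrow> l < q j \<Longrightarrow> e j l \<in> vecs d (\<mu> ! j)"
    and e_indep: "\<And>j. j < d \<Longrightarrow> vv.indep_mod (syz d (dehoms n a0) (\<mu> ! j)) {..<q j} (e j)"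
begin

definition I :: "(nat \<times> nat) set" where "I = Sigma {..<d} (\<lambda>j. {..<q j})"

definition col :: "(nat \<times> nat \<Rightarrow> 'k) \<Rightarrow> nat \<Rightarrow> 'k poly poly" where
  "col x j = P0 j + (\<Sum>l<q j. smult [:x (j, l):] (e j l))"

text \<open>Adjoins \<open>P0 j\<close> as vector number \<open>q j\<close>; the columns
  \<open>col x j\<close> are then the combinations \<open>comb c j\<close> with last coefficient
  1.\<close>

definition ext :: "nat \<Rightarrow> nat \<Rightarrow> 'k poly poly" where
  "ext j l = (if l < q j then e j l else P0 j)"

definition comb :: "(nat \<times> nat \<Rightarrow> 'k) \<Rightarrow> nat \<Rightarrow> 'k poly poly" where
  "comb c j = (\<Sum>l\<le>q j. smult [:c (j, l):] (ext j l))"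

abbreviation M :: "(nat \<Rightarrow> 'k poly poly) set" where "M \<equiv> param_tuples_of_type n d \<mu>"
abbreviation F :: "(nat \<Rightarrow> 'k poly poly) set" where "F \<equiv> form_tuples n d"
abbreviation X :: "((nat \<Rightarrow> 'k poly poly) \<Rightarrow> 'k) set" where "X \<equiv> form_coords n d"

text \<open>For \<open>a\<close> in the stratum, whose syzygies have the same dimension as those of
  \<open>a0\<close>, this means that the \<open>e j l\<close> still span a complement of
  them.\<close>

definition U1 :: "nat \<Rightarrow> (nat \<Rightarrow> 'k poly poly) set" where
  "U1 j = {a \<in> F. \<forall>c. dotv d (dehoms n a) (\<Sum>l\<in>{..<q j}. smult [:c l:] (e j l)) = 0 \<longrightarrow> (\<forall>l\<in>{..<q j}. c l = 0)}"

text \<open>It will make the constant terms of the columns found for \<open>a\<close> independent.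
  As these columns vary with \<open>a\<close>, the condition is imposed on all combinations at once:
  independence of one finite family depending polynomially on \<open>a\<close>, hence open.\<close>

definition U2 :: "(nat \<Rightarrow> 'k poly poly) set" where
  "U2 = {a \<in> F. \<forall>c. (\<forall>j<d. dotv d (dehoms n a) (comb c j) = 0) \<and>
     (\<forall>r. (\<Sum>j<d. coeff (coeff (comb c j) r) 0) = 0) \<longrightarrow> (\<forall>p\<in>Sigma {..<d} (\<lambda>j. {..q j}). c p = 0)}"

section \<open>The base point, the columns of the slice, and a neighbourhood\<close>

lemmas mu = is_partition_ofD(1-3)[OF part]

lemma n_pos: "1 \<le> n"
proof -
  have "1 \<le> \<mu> ! 0" using mu d by simp
  also have "\<dots> \<le> n" using mu elem_le_sum_list[of 0 \<mu>] d by simp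
  finally show ?thesis .
qed

lemma P0_syz: "j < d \<Longrightarrow> P0 j \<in> syz d (dehoms n a0) (\<mu> ! j)"
  using basis unfolding syz_basis_def by blast

lemma P0_vecs: "j < d \<Longrightarrow> P0 j \<in> vecs d (\<mu> ! j)"
  using P0_syz syz_subset by blast

lemma a0_F: "a0 \<in> F" unfolding a0 by (rule para_form_tuples)

lemma a0_M: "a0 \<in> M" unfolding param_tuples_of_type_iff[OF part] using a0_F basis by blast

lemma comb_eq: "comb c j = smult [:c (j, q j):] (P0 j) + (\<Sum>l<q j. smult [:c (j, l):] (e j l))"
proof -
  have "{..q j} = insert (q j) {..<q j}" by auto
  then show ?thesis unfolding comb_def by (simp add: ext_def)
qed

lemma e_sum_vecs: "j < d \<Longrightarrow> (\<Sum>l<q j. smult [:c l:] (e j l)) \<in> vecs d (\<mu> ! j)"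
  by (intro sum_smult_vecs e_vecs) auto

lemma col_vecs: "j < d \<Longrightarrow> col x j \<in> vecs d (\<mu> ! j)"
  unfolding col_def by (rule vv.subspace_add[OF vecs_subspace P0_vecs e_sum_vecs])

lemma col_columns: "col x \<in> syz_columns d \<mu>"
  unfolding syz_columns_def using col_vecs by blast

lemma P0_columns: "P0 \<in> syz_columns d \<mu>"
  unfolding syz_columns_def using P0_vecs by blast

lemma dotv_para_col:
  assumes "j < d"
  shows "dotv d (dehoms n (para n d c (col x))) (col x j) = 0"
proof -
  have "dotv d (dehoms n (para n d c (col x))) (col x j) = smult c (dotv d (minor d (col x)) (col x j))"
    unfolding dotv_def smult_sum_right using dehom_para[OF mu(1,2) col_columns] by (intro sum.cong) auto
  then show ?thesis using dotv_minor_column[OF assms, of "col x"] by simp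
qed

lemma col_zero: "(\<And>p. x p = 0) \<Longrightarrow> col x = P0"
  by (rule ext) (simp add: col_def)

lemma col_line: "(\<lambda>j. col x j + smult [:t:] (col y j - col x j)) = col (\<lambda>p. x p + t * (y p - x p))"
proof
  fix j
  have "smult [:t:] (col y j - col x j) = (\<Sum>l<q j. smult [:t * (y (j, l) - x (j, l)):] (e j l))"
    unfolding col_def add_diff_cancel_left sum_subtractf[symmetric] smult_sum_right
    by (rule sum.cong) (simp_all add: smult_diff_left[symmetric])
  then show "col x j + smult [:t:] (col y j - col x j) = col (\<lambda>p. x p + t * (y p - x p)) j"
    unfolding col_def by (simp add: add.assoc sum.distrib[symmetric] smult_add_left[symmetric])
qed

lemma U1_openin: "openin (form_zariski n d) (U1 j)"
  unfolding U1_def by (rule injective_openin) simp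

lemma U1_D: "a \<in> U1 j \<Longrightarrow> dotv d (dehoms n a) (\<Sum>l<q j. smult [:c l:] (e j l)) = 0 \<Longrightarrow> l < q j \<Longrightarrow> c l = 0"
  unfolding U1_def by blast

lemma a0_U1:
  assumes j: "j < d"
  shows "a0 \<in> U1 j"
proof -
  have "\<forall>l\<in>{..<q j}. c l = 0" if "dotv d (dehoms n a0) (\<Sum>l\<in>{..<q j}. smult [:c l:] (e j l)) = 0" for c
  proof -
    have "(\<Sum>l<q j. smult [:c l:] (e j l)) \<in> syz d (dehoms n a0) (\<mu> ! j)"
      using that e_sum_vecs[OF j] unfolding syz_def by simp
    then show ?thesis using e_indep[OF j, unfolded vv.indep_mod_def, THEN spec, of c] by (rule rev_mp)
  qed
  then show ?thesis using a0_F unfolding U1_def by simp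
qed

lemma U2_openin: "openin (form_zariski n d) U2"
proof -
  let ?J = "Sigma {..<d} (\<lambda>j. {..q j})"
  \<comment> \<open>Test coordinates for the vector with index p = (j, l): \<open>Inl\<close> reads
    the coefficients of its pairing with \<open>a\<close>, kept apart for each column j,
    \<open>Inr\<close> the constant terms, added over all columns.\<close>
  define w where "w p a z = (case z of Inl (j', s) \<Rightarrow> if fst p = j' then coeff (dotv d (dehoms n a) (ext (fst p) (snd p))) s else 0
    | Inr r \<Rightarrow> coeff (coeff (ext (fst p) (snd p)) r) 0)" for p a and z :: "nat \<times> nat + nat"
  have sum_J: "(\<Sum>p\<in>?J. G p) = (\<Sum>j<d. \<Sum>l\<le>q j. G (j, l))" for G :: "nat \<times> nat \<Rightarrow> 'k"
    by (simp add: sum.Sigma)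
  have inl: "(\<Sum>p\<in>?J. c p * w p a (Inl (j', s))) = (if j' < d then coeff (dotv d (dehoms n a) (comb c j')) s else 0)" for c a j' s
  proof -
    have "(\<Sum>p\<in>?J. c p * w p a (Inl (j', s))) = (\<Sum>j<d. if j = j' then coeff (dotv d (dehoms n a) (comb c j)) s else 0)"
      unfolding sum_J
      by (rule sum.cong) (simp_all add: w_def comb_def dotv_sum dotv_smult coeff_sum)
    then show ?thesis by simp
  qed
  have inr: "(\<Sum>p\<in>?J. c p * w p a (Inr r)) = (\<Sum>j<d. coeff (coeff (comb c j) r) 0)" for c a r
    unfolding sum_J by (simp add: w_def comb_def coeff_sum)
  have "(\<forall>z. (\<Sum>p\<in>?J. c p * w p a z) = 0) \<longleftrightarrow> (\<forall>j<d. dotv d (dehoms n a) (comb c j) = 0) \<and>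
     (\<forall>r. (\<Sum>j<d. coeff (coeff (comb c j) r) 0) = 0)" for c a
  proof -
    have "(\<forall>z. (\<Sum>p\<in>?J. c p * w p a z) = 0) \<longleftrightarrow>
      (\<forall>j s. (\<Sum>p\<in>?J. c p * w p a (Inl (j, s))) = 0) \<and> (\<forall>r. (\<Sum>p\<in>?J. c p * w p a (Inr r)) = 0)"
      by (metis old.sum.exhaust surj_pair)
    then show ?thesis unfolding inl inr by (auto simp: poly_eq_iff)
  qed
  note eq = this
  show ?thesis
    unfolding U2_def form_zariski_def eq[symmetric]
  proof (rule independence_openin)
    fix p z
    show "(\<lambda>a. w p a z) \<in> polyfuns X"
    proof (cases z)
      case (Inl js)
      obtain j' s where "js = (j', s)" by fastforce
      then show ?thesis using Inl coeff_polyfuns_dotv[of n d "ext (fst p) (snd p)"]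
        by (cases "fst p = j'") (auto simp: w_def coeff_polyfuns_def intro: polyfuns.const)
    qed (simp add: w_def polyfuns.const)
  qed simp
qed

lemma a0_U2: "a0 \<in> U2"
proof -
  have "\<forall>p\<in>Sigma {..<d} (\<lambda>j. {..q j}). c p = 0"
    if dot: "\<forall>j<d. dotv d (dehoms n a0) (comb c j) = 0" and const: "\<forall>r. (\<Sum>j<d. coeff (coeff (comb c j) r) 0) = 0" for c
  proof -
    have e0: "c (j, l) = 0" if jl: "j < d" "l < q j" for j l
    proof (rule U1_D[OF a0_U1[OF jl(1)] _ jl(2)])
      show "dotv d (dehoms n a0) (\<Sum>l<q j. smult [:c (j, l):] (e j l)) = 0"
        using dot[rule_format, OF jl(1)] P0_syz[OF jl(1)] by (simp add: comb_eq dotv_add dotv_smult syz_def)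
    qed
    have "comb c j = smult [:c (j, q j):] (P0 j)" if "j < d" for j
      unfolding comb_eq using e0 that by simp
    then have "\<forall>r. (\<Sum>j<d. c (j, q j) * coeff (coeff (P0 j) r) 0) = 0" using const by simp
    then have "\<forall>j<d. c (j, q j) = 0" by (rule syz_basis_const_coeffs[OF mu(1,2) n_pos basis])
    then have "c (j, l) = 0" if "j < d" "l \<le> q j" for j l
      using e0 that by (cases "l = q j") auto
    then show ?thesis by auto
  qed
  then show ?thesis using a0_F unfolding U2_def by blast
qed

text \<open>By \<open>U1\<close> each \<open>P0 j\<close> can be corrected by the
  \<open>e j l\<close> to a syzygy of \<open>a\<close>, which is a column of the slice. By
  \<open>U2\<close> the corrected columns are independent, so Hilbert--Burch recovers
  \<open>a\<close>.\<close>

lemma near_a0_is_para: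
  assumes a: "a \<in> M" "\<And>j. j < d \<Longrightarrow> a \<in> U1 j" "a \<in> U2"
  shows "\<exists>c x. a = para n d c (col x)"
proof -
  let ?A = "dehoms n a"
  obtain P where P: "syz_basis d ?A \<mu> P" using a(1) unfolding param_tuples_of_type_iff[OF part] by blast
  have "\<exists>c. P0 j - (\<Sum>l<q j. smult [:c l:] (e j l)) \<in> syz d ?A (\<mu> ! j)" if j: "j < d" for j
  proof -
    have "vv.indep_mod (syz d ?A (\<mu> ! j)) {..<q j} (e j)"
      unfolding vv.indep_mod_def syz_def using U1_D[OF a(2)[OF j]] by simp
    moreover have "e j ` {..<q j} \<subseteq> vecs d (\<mu> ! j)" using e_vecs[OF j] by auto
    moreover have "(d + 1) * (\<mu> ! j + 1) \<le> hilb d \<mu> (\<mu> ! j) + card {..<q j}" using q[OF j] by simp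
    ultimately have "vv.gen_mod (syz d ?A (\<mu> ! j)) {..<q j} (e j) (vecs d (\<mu> ! j))"
      by (rule vv.gen_mod_if_card[OF has_dim_vecs syz_basis_dim[OF P] syz_subset finite_lessThan])
    then show ?thesis using P0_vecs[OF j] unfolding vv.gen_mod_def by (rule bspec)
  qed
  then obtain c where c: "\<And>j. j < d \<Longrightarrow> P0 j - (\<Sum>l<q j. smult [:c j l:] (e j l)) \<in> syz d ?A (\<mu> ! j)" by metis
  define x where "x p = - c (fst p) (snd p)" for p
  have "col x j = P0 j - (\<Sum>l<q j. smult [:c j l:] (e j l))" for j
    by (simp add: col_def x_def sum_negf[symmetric] flip: minus_pCons)
  then have syz: "\<forall>j<d. col x j \<in> syz d ?A (\<mu> ! j)" using c by simp
  have "poly_indep d (col x)"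
  proof (rule poly_indep_if_const_coeffs, intro allI impI)
    fix t j assume t: "\<forall>r. (\<Sum>j<d. t j * coeff (coeff (col x j) r) 0) = 0" and j: "j < d"
    \<comment> \<open>The columns scaled by \<open>t\<close>, in the coordinates of
      \<open>comb\<close>.\<close>
    define b where "b p = (if snd p < q (fst p) then t (fst p) * x p else t (fst p))" for p
    have comb: "comb b i = smult [:t i:] (col x i)" for i
      unfolding comb_eq col_def by (simp add: b_def smult_add_right smult_sum_right mult.commute)
    have "\<forall>j<d. dotv d ?A (comb b j) = 0" using syz unfolding comb syz_def by (simp add: dotv_smult)
    moreover have "\<forall>r. (\<Sum>j<d. coeff (coeff (comb b j) r) 0) = 0" using t unfolding comb by simp
    ultimately have "\<forall>p\<in>Sigma {..<d} (\<lambda>j. {..q j}). b p = 0" using a(3) unfolding U2_def by blast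
    then have "b (j, q j) = 0" using j by simp
    then show "t j = 0" by (simp add: b_def)
  qed
  then show ?thesis using type_is_para[OF part a(1) syz] by blast
qed

section \<open>The upper bound for chains\<close>

definition Y :: "('k \<times> (nat \<times> nat \<Rightarrow> 'k) \<Rightarrow> 'k) set" where
  "Y = insert fst ((\<lambda>p z. snd z p) ` I)"

lemma finite_I: "finite I" unfolding I_def by simp

lemma chain_le:
  assumes "closed_chain (subtopology (form_zariski n d) M) m C"
  shows "m \<le> 1 + card I"
proof -
  \<comment> \<open>The slice covers only this neighbourhood of \<open>a0\<close>; it suffices
    because it is dense in the irreducible \<open>M\<close>.\<close>
  let ?U = "F \<inter> (\<Inter>j<d. U1 j) \<inter> U2"
  have U: "openin (zariski F X) ?U"
  proof -
    have "openin (form_zariski n d) (\<Inter>j<d. U1 j)"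
      using d by (intro openin_INT2) (auto intro: U1_openin simp: lessThan_empty_iff)
    then have "openin (form_zariski n d) ((\<Inter>j<d. U1 j) \<inter> U2)" using U2_openin by (rule openin_Int)
    moreover from this have "(\<Inter>j<d. U1 j) \<inter> U2 \<subseteq> F" using openin_subset unfolding topspace_form_zariski[symmetric] by blast
    then have "?U = (\<Inter>j<d. U1 j) \<inter> U2" by blast
    ultimately show ?thesis unfolding form_zariski_def by simp
  qed
  show ?thesis
  proof (rule closed_chain_length_le[OF type_subset _ _ _ _ _ assms[unfolded form_zariski_def]])
    show "\<forall>p\<in>M. f p = 0" if "f \<in> polyfuns X" "\<forall>w\<in>M \<inter> ?U. f w = 0" for f
      by (rule prime_vanishing_dense_open[OF type_prime_vanishing[OF inf part d] type_subset U _ that])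
        (use a0_M a0_F a0_U1 a0_U2 in blast)
    show "M \<inter> ?U \<subseteq> range (\<lambda>z. para n d (fst z) (col (snd z)))"
    proof
      fix a assume "a \<in> M \<inter> ?U"
      then obtain c x where "a = para n d c (col x)" using near_a0_is_para[of a] by blast
      then show "a \<in> range (\<lambda>z. para n d (fst z) (col (snd z)))" by (intro image_eqI[of _ _ "(c, x)"]) simp_all
    qed
    show "(\<lambda>z. x (para n d (fst z) (col (snd z)))) \<in> polyfuns Y" if "x \<in> X" for x
    proof (rule para_polyfuns[OF _ _ that])
      show "fst \<in> polyfuns Y" by (rule polyfuns.coord) (simp add: Y_def)
      fix j i assume j: "j < d"
      have "(\<lambda>z. snd z (j, l)) \<in> polyfuns Y" if "l < q j" for l
        using j that by (intro polyfuns.coord) (auto simp: Y_def I_def)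
      then have "coeff_polyfuns Y (\<lambda>z. coeff (P0 j) i + (\<Sum>l<q j. smult (snd z (j, l)) (coeff (e j l) i)))"
        by (intro coeff_polyfuns_add coeff_polyfuns_const coeff_polyfuns_sum coeff_polyfuns_smult) auto
      then show "coeff_polyfuns Y (\<lambda>z. coeff (col (snd z) j) i)" by (simp add: col_def coeff_sum)
    qed
    show "finite Y" unfolding Y_def using finite_I by simp
    show "card Y \<le> 1 + card I"
      unfolding Y_def using card_insert_le_m1 card_image_le[OF finite_I] card_insert_if
      by (metis (no_types, lifting) Suc_eq_plus1_left Suc_le_mono card_insert_le finite_I finite_imageI le_SucI le_trans)
  qed
qed

section \<open>A chain of full length\<close>

lemma point_closed:
  "closedin (subtopology (zariski F X) M) {a0}"
  unfolding closedin_zariski_subtopology[OF type_subset]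
proof (intro conjI ballI)
  show "{a0} \<subseteq> M" using a0_M by simp
  fix z assume z: "z \<in> M - {a0}"
  then have "z \<in> F" using type_subset by blast
  then obtain i where i: "i \<le> d" "dehom n (z i) \<noteq> dehom n (a0 i)"
    using form_tuple_eqI[OF _ a0_F, of z] z by blast
  then obtain j where j: "coeff (dehom n (z i)) j \<noteq> coeff (dehom n (a0 i)) j" by (auto simp: poly_eq_iff)
  have "(\<lambda>a. coeff (dehom n (a i)) j - coeff (dehom n (a0 i)) j) \<in> polyfuns X"
    using coeff_polyfuns_dehom[OF i(1)] unfolding coeff_polyfuns_def by (intro polyfuns_diff polyfuns.const) blast
  then show "\<exists>f\<in>polyfuns X. f z \<noteq> 0 \<and> (\<forall>y\<in>{a0}. f y = 0)"
    by (intro bexI[of _ "\<lambda>a. coeff (dehom n (a i)) j - coeff (dehom n (a0 i)) j"]) (use j in simp_all)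
qed

text \<open>The 1 + \<open>card I\<close> steps are: from the point to its scalar multiples, then
  freeing the slice coordinates one by one.\<close>

lemma chain_exists: "\<exists>C. closed_chain (subtopology (form_zariski n d) M) (1 + card I) C"
proof -
  obtain idx where idx: "bij_betw idx {..<card I} I"
    using ex_bij_betw_nat_finite[OF finite_I] by (auto simp: atLeast0LessThan)
  have idx_inj: "idx s = idx t \<longleftrightarrow> s = t" if "s < card I" "t < card I" for s t
    using idx that by (auto simp: bij_betw_def inj_on_def)
  have idx_ex: "\<exists>s<card I. idx s = p" if "p \<in> I" for p
    using bij_betw_imp_surj_on[OF idx] that by (metis imageE lessThan_iff)
  have idx_I: "idx s \<in> I" if "s < card I" for s
    using bij_betw_apply[OF idx] that by simp
  \<comment> \<open>Only the first i coordinates are free; these matrices form an affine space, so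
    their images are irreducible.\<close>
  define A where "A i = {col x | x. \<forall>s. i \<le> s \<and> s < card I \<longrightarrow> x (idx s) = 0}" for i
  define Z where "Z i = para_set n d \<mu> (A i)" for i
  \<comment> \<open>The shift by one makes room for the point below \<open>Z 0\<close>, where only
    the scalar varies.\<close>
  define C where "C i = (case i of 0 \<Rightarrow> {a0} | Suc i \<Rightarrow> zclosure X M (Z i))" for i
  have C0: "C 0 = {a0}" and CS: "C (Suc i) = zclosure X M (Z i)" for i by (simp_all add: C_def)
  have P0_A: "P0 \<in> A i" for i
    unfolding A_def using col_zero[of "\<lambda>_. 0"] by (intro CollectI exI[of _ "\<lambda>_. 0"]) simp
  have a0_Z: "a0 \<in> Z i" for i unfolding Z_def para_set_def using a0_M a0 P0_A by blast
  have Z_M: "Z i \<subseteq> M" for i unfolding Z_def para_set_def by blast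
  have pZ: "prime_vanishing X (Z i)" for i
    unfolding Z_def
  proof (rule prime_vanishing_para_set[OF inf part])
    show "A i \<subseteq> syz_columns d \<mu>" unfolding A_def using col_columns by blast
    show "(\<lambda>j. P j + smult [:t:] (Q j - P j)) \<in> A i" if PQ: "P \<in> A i" "Q \<in> A i" for P Q t
    proof -
      obtain x y where "P = col x" "\<forall>s. i \<le> s \<and> s < card I \<longrightarrow> x (idx s) = 0"
        "Q = col y" "\<forall>s. i \<le> s \<and> s < card I \<longrightarrow> y (idx s) = 0" using PQ unfolding A_def by blast
      then show ?thesis unfolding A_def using col_line[of x t y]
        by (intro CollectI exI[of _ "\<lambda>p. x p + t * (y p - x p)"]) simp
    qed
    show "para_set n d \<mu> (A i) \<noteq> {}" using a0_Z unfolding Z_def by blast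
  qed
  have "closed_chain (subtopology (zariski F X) M) (1 + card I) C"
    unfolding closed_chain_zariski[OF type_subset]
  proof (intro conjI allI impI)
    fix i assume "i \<le> 1 + card I"
    show "closedin (subtopology (zariski F X) M) (C i)"
      using point_closed closedin_zclosure[OF type_subset] by (cases i) (auto simp: C0 CS)
    show "prime_vanishing X (C i)"
      using pZ prime_vanishing_zclosure[OF pZ Z_M] by (cases i) (auto simp: C0 CS prime_vanishing_def[of X "{a0}"])
  next
    fix i assume i: "i < 1 + card I"
    show "C i \<subset> C (Suc i)"
    proof (cases i)
      case 0
      have sub: "{a0} \<subseteq> zclosure X M (Z 0)" using subset_zclosure[OF Z_M] a0_Z by blast
      \<comment> \<open>Changing the scalar alone moves the point, because \<open>a0\<close> is not
        zero.\<close>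
      let ?\<gamma> = "para_line n d c0 P0 (c0 + 1) P0"
      have \<gamma>: "?\<gamma> t = para n d (c0 + t) P0" for t by (simp add: para_line_def)
      have "finite {t. ?\<gamma> t \<notin> M}"
        using para_line_of_type[OF part P0_columns P0_columns] a0 a0_M by simp
      then have "finite ({0} \<union> {t. ?\<gamma> t \<notin> M})" by simp
      from ex_new_if_finite[OF inf this] obtain t where t: "t \<noteq> 0" "?\<gamma> t \<in> M" by auto
      have "?\<gamma> t \<in> Z 0" using t(2) P0_A unfolding Z_def para_set_def \<gamma> by blast
      moreover have "?\<gamma> t \<noteq> a0"
      proof
        assume eq: "?\<gamma> t = a0"
        have "dehom n (a0 i) = 0" if "i \<le> d" for i
        proof -
          have "dehom n (para n d (c0 + t) P0 i) = dehom n (para n d c0 P0 i)"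
            using eq a0 unfolding \<gamma> by simp
          then have "smult (c0 + t) (minor d P0 i) = smult c0 (minor d P0 i)"
            unfolding dehom_para[OF mu(1,2) P0_columns that] .
          then have "smult t (minor d P0 i) = 0" by (simp add: smult_add_left)
          then show ?thesis using t(1) dehom_para[OF mu(1,2) P0_columns that, of c0] a0 by simp
        qed
        then have "dotv d (dehoms n a0) v = 0" for v unfolding dotv_def by (intro sum.neutral) simp
        then show False using type_surj[OF part a0_M] unfolding surj_at_def
          by (metis degree_1 le0 zero_neq_one)
      qed
      ultimately show ?thesis using sub subset_zclosure[OF Z_M[of 0], of X] unfolding 0 C0 CS by blast
    next
      case (Suc i')
      then have i': "i' < card I" using i by simp
      obtain j l where jl: "idx i' = (j, l)" by fastforce
      have jl': "j < d" "l < q j" using idx_I[OF i'] unfolding jl I_def by auto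
      \<comment> \<open>The coordinates of column j freed before (j, l). Together with
        \<open>P0 j\<close>, of index \<open>q j\<close>, they give the span containing column j for
        all points of \<open>Z i'\<close>.\<close>
      define T where "T = {s. s < i' \<and> fst (idx s) = j}"
      define K where "K = insert (q j) (snd ` idx ` T)"
      have T: "idx s = (j, snd (idx s))" "snd (idx s) < q j" "snd (idx s) \<noteq> l" if "s \<in> T" for s
      proof -
        have s: "s < i'" "fst (idx s) = j" using that unfolding T_def by auto
        show 1: "idx s = (j, snd (idx s))" using s(2) by (metis prod.collapse)
        show "snd (idx s) < q j" using idx_I[of s] s i' unfolding I_def by auto
        show "snd (idx s) \<noteq> l" using 1 idx_inj[of s i'] s(1) i' jl by auto
      qed
      have "\<forall>s\<in>T. snd (idx s) < q j \<and> snd (idx s) \<noteq> l" using T(2,3) by blast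
      then have K_sub: "K \<subseteq> {..q j}" "l \<notin> K"
        unfolding K_def image_image using jl'(2) by (auto intro: less_imp_le)
      have finK: "finite K" using K_sub(1) finite_subset by blast
      \<comment> \<open>Outside \<open>U\<close>, some nontrivial combination of these vectors is a
        syzygy: a closed condition that holds on \<open>Z i'\<close> but not on all of
        \<open>Z (Suc i')\<close>.\<close>
      define U where "U = {a \<in> F. \<forall>c. dotv d (dehoms n a) (\<Sum>k\<in>K. smult [:c k:] (ext j k)) = 0 \<longrightarrow> (\<forall>k\<in>K. c k = 0)}"
      have U_open: "openin (zariski F X) U"
        using injective_openin[OF finK] unfolding U_def form_zariski_def by blast
      have disj: "a \<notin> U" if a: "a \<in> Z i'" for a
      proof
        assume aU: "a \<in> U"
        obtain c x where x: "a = para n d c (col x)" "\<forall>s. i' \<le> s \<and> s < card I \<longrightarrow> x (idx s) = 0"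
          using a unfolding Z_def para_set_def A_def by blast
        define b where "b k = (if k = q j then 1 else x (j, k))" for k
        have "(\<Sum>k\<in>K. smult [:b k:] (ext j k)) = (\<Sum>k\<le>q j. smult [:b k:] (ext j k))"
        proof (rule sum.mono_neutral_left[OF _ K_sub(1)])
          show "\<forall>k\<in>{..q j} - K. smult [:b k:] (ext j k) = 0"
          proof
            fix k assume k: "k \<in> {..q j} - K"
            then have kq: "k < q j" "k \<noteq> q j" unfolding K_def by auto
            then obtain s where s: "s < card I" "idx s = (j, k)" using idx_ex[of "(j, k)"] jl' unfolding I_def by auto
            have "\<not> s < i'" using s(2) k unfolding K_def T_def by force
            then have "x (j, k) = 0" using x(2) s by (metis not_less)
            then show "smult [:b k:] (ext j k) = 0" using kq by (simp add: b_def)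
          qed
        qed simp
        also have "\<dots> = col x j"
        proof -
          have "{..q j} = insert (q j) {..<q j}" by auto
          then show ?thesis by (simp add: col_def b_def ext_def pCons_one)
        qed
        finally have "dotv d (dehoms n a) (\<Sum>k\<in>K. smult [:b k:] (ext j k)) = dotv d (dehoms n a) (col x j)" by simp
        also have "\<dots> = 0" unfolding x(1) by (rule dotv_para_col[OF jl'(1)])
        finally have "b (q j) = 0" using aU unfolding U_def K_def by blast
        then show False by (simp add: b_def)
      qed
      \<comment> \<open>The unit vector in the newly freed direction; a nonzero step along it, off a
        finite set of parameters, gives a point in \<open>U\<close>.\<close>
      define x1 where "x1 p = (if p = (j, l) then 1 else 0 :: 'k)" for p
      let ?\<gamma> = "para_line n d c0 P0 c0 (col x1)"
      have \<gamma>: "?\<gamma> t = para n d c0 (col (\<lambda>p. t * x1 p))" for t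
        unfolding para_line_def using col_line[of "\<lambda>_. 0" t x1] col_zero[of "\<lambda>_. 0"] by simp
      have "finite {t. ?\<gamma> t \<notin> M}"
        using para_line_of_type[OF part P0_columns col_columns] a0 a0_M by simp
      moreover have "finite {t. ?\<gamma> t \<notin> U1 j}"
      proof (rule para_line_in_open[OF U1_openin])
        show "?\<gamma> 0 \<in> U1 j" using a0_U1[OF jl'(1)] a0 by (simp add: para_line_def)
      qed
      ultimately have "finite ({0} \<union> {t. ?\<gamma> t \<notin> M} \<union> {t. ?\<gamma> t \<notin> U1 j})" by simp
      from ex_new_if_finite[OF inf this]
      obtain t where t: "t \<noteq> 0" "?\<gamma> t \<in> M" "?\<gamma> t \<in> U1 j" by auto
      define x where "x p = t * x1 p" for p
      define b where "b = para n d c0 (col x)"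
      have b: "b \<in> M" "b \<in> U1 j" using t unfolding \<gamma> b_def x_def by simp_all
      have "col x \<in> A (Suc i')"
      proof -
        have "x (idx s) = 0" if "Suc i' \<le> s" "s < card I" for s
          using idx_inj[of s i'] that i' jl by (auto simp: x_def x1_def)
        then show ?thesis unfolding A_def by blast
      qed
      then have bZ: "b \<in> Z (Suc i')" using b(1) unfolding Z_def para_set_def b_def by blast
      have bU: "b \<in> U"
        unfolding U_def
      proof (intro CollectI conjI allI impI)
        show "b \<in> F" unfolding b_def by (rule para_form_tuples)
        fix c assume c: "dotv d (dehoms n b) (\<Sum>k\<in>K. smult [:c k:] (ext j k)) = 0"
        define c' where "c' k = (if k \<in> K then c k else 0)" for k
        \<comment> \<open>Subtracting \<open>c (q j)\<close> times the syzygy \<open>col x j\<close>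
          leaves a combination of the \<open>e j k\<close> alone, so \<open>U1 j\<close> applies. As
          \<open>l\<close> is not in \<open>K\<close>, the coefficient at \<open>l\<close> is
          \<open>- c (q j) * t\<close>.\<close>
        define c'' where "c'' k = c' k - c (q j) * x (j, k)" for k
        have qK: "q j \<in> K" unfolding K_def by simp
        have "(\<Sum>k\<in>K. smult [:c k:] (ext j k)) = (\<Sum>k\<le>q j. smult [:c' k:] (ext j k))"
          using K_sub(1) by (intro sum.mono_neutral_cong_left) (auto simp: c'_def)
        also have "\<dots> = smult [:c (q j):] (P0 j) + (\<Sum>k<q j. smult [:c' k:] (e j k))"
        proof -
          have "{..q j} = insert (q j) {..<q j}" by auto
          then show ?thesis using qK by (simp add: ext_def c'_def)
        qed
        also have "\<dots> = smult [:c (q j):] (col x j) + (\<Sum>k<q j. smult [:c'' k:] (e j k))"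
        proof -
          have "(\<Sum>k<q j. smult [:c' k:] (e j k)) =
              (\<Sum>k<q j. smult [:c (q j):] (smult [:x (j, k):] (e j k)) + smult [:c'' k:] (e j k))"
            by (rule sum.cong) (simp_all add: c''_def smult_add_left[symmetric])
          then show ?thesis unfolding col_def sum.distrib smult_add_right smult_sum_right by simp
        qed
        finally have "dotv d (dehoms n b) (smult [:c (q j):] (col x j) + (\<Sum>k<q j. smult [:c'' k:] (e j k))) = 0"
          using c by simp
        moreover have "dotv d (dehoms n b) (col x j) = 0" unfolding b_def by (rule dotv_para_col[OF jl'(1)])
        ultimately have "dotv d (dehoms n b) (\<Sum>k<q j. smult [:c'' k:] (e j k)) = 0"
          by (simp add: dotv_add dotv_smult)
        then have c'': "c'' k = 0" if "k < q j" for k using U1_D[OF b(2) _ that] by blast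
        have "c (q j) * t = 0" using c''[OF jl'(2)] K_sub(2) by (simp add: c''_def c'_def x_def x1_def)
        then have cq: "c (q j) = 0" using t(1) by simp
        show "\<forall>k\<in>K. c k = 0"
        proof
          fix k assume k: "k \<in> K"
          show "c k = 0"
          proof (cases "k = q j")
            case False
            then have "k < q j" using k K_sub(1) by fastforce
            then show ?thesis using c''[of k] k cq by (simp add: c''_def c'_def)
          qed (simp add: cq)
        qed
      qed
      have "b \<in> zclosure X M (Z (Suc i'))" using bZ subset_zclosure[OF Z_M] by blast
      moreover have "b \<notin> zclosure X M (Z i')"
      proof -
        obtain f where f: "f \<in> polyfuns X" "f b \<noteq> 0" "\<forall>y\<in>F. f y \<noteq> 0 \<longrightarrow> y \<in> U"
          using U_open bU unfolding openin_zariski_iff by blast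
        have "f z = 0" if "z \<in> Z i'" for z
          using f(3) disj[OF that] that Z_M type_subset by blast
        then show ?thesis using f(1,2) unfolding zclosure_def by blast
      qed
      moreover have "zclosure X M (Z i') \<subseteq> zclosure X M (Z (Suc i'))"
      proof -
        have "A i' \<subseteq> A (Suc i')" unfolding A_def by (auto dest: Suc_leD)
        then have "Z i' \<subseteq> Z (Suc i')" unfolding Z_def para_set_def by blast
        then show ?thesis unfolding zclosure_def by blast
      qed
      ultimately show ?thesis unfolding Suc CS by blast
    qed
  qed
  then show ?thesis unfolding form_zariski_def by blast
qed

lemma krull_dim_type: "krull_dim (subtopology (form_zariski n d) M) = ereal (real (1 + card I))"
  using chain_exists chain_le krull_dim_eqI by metis

end

section \<open>The dimension count\<close>

lemma sum_square_split:
  fixes d :: nat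
  shows "(\<Sum>j<d. \<Sum>i<d. f i j) = (\<Sum>j<d. f j j) + (\<Sum>i<d. \<Sum>j<i. f i j + f j i :: real)"
proof (induction d)
  case (Suc d)
  have "(\<Sum>j<Suc d. \<Sum>i<Suc d. f i j) = (\<Sum>j<d. \<Sum>i<d. f i j) + (\<Sum>j<d. f d j) + (\<Sum>i<d. f i d) + f d d"
    by (simp add: sum.distrib)
  then show ?case unfolding Suc.IH by (simp add: sum.distrib)
qed simp

text \<open>In the sum of the \<open>hilb d \<mu> (\<mu> ! j)\<close> a pair j < i contributes 2 +
  max(0, \<mu>_i - \<mu>_j - 1) and each diagonal term 1, in total d^2 plus the sum of the maxima.
  Finally 1 + (d + 1)(n + d) - d^2 = (d + 1)(n + 1).\<close>

lemma dimension_count: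
  assumes mu: "length \<mu> = d" "sorted \<mu>" "sum_list \<mu> = n"
    and q: "\<And>j. j < d \<Longrightarrow> q j + hilb d \<mu> (\<mu> ! j) = (d + 1) * (\<mu> ! j + 1)"
  shows "1 + real (\<Sum>j<d. q j) =
    (real d + 1) * (real n + 1) - (\<Sum>i<d. \<Sum>j<i. max 0 (real (\<mu> ! i) - real (\<mu> ! j) - 1))"
proof -
  let ?h = "\<lambda>i j. real (\<mu> ! j + 1 - \<mu> ! i)"
  let ?S = "\<Sum>i<d. \<Sum>j<i. max 0 (real (\<mu> ! i) - real (\<mu> ! j) - 1)"
  have "(\<Sum>j<d. \<Sum>i<d. ?h i j) = (\<Sum>j<d. ?h j j) + (\<Sum>i<d. \<Sum>j<i. ?h i j + ?h j i)"
    by (rule sum_square_split)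
  also have "(\<Sum>i<d. \<Sum>j<i. ?h i j + ?h j i) = (\<Sum>i<d. \<Sum>j<i. 2 + max 0 (real (\<mu> ! i) - real (\<mu> ! j) - 1))"
  proof (intro sum.cong refl)
    fix i j assume "i \<in> {..<d}" "j \<in> {..<i}"
    then have "\<mu> ! j \<le> \<mu> ! i" using sorted_nth_mono[OF mu(2), of j i] mu(1) by simp
    then show "?h i j + ?h j i = 2 + max 0 (real (\<mu> ! i) - real (\<mu> ! j) - 1)"
      by (cases "\<mu> ! i = \<mu> ! j") (auto simp: of_nat_diff max_def)
  qed
  also have "\<dots> = 2 * (\<Sum>i<d. real i) + ?S" by (simp add: sum.distrib sum_distrib_left mult.commute)
  also have "2 * (\<Sum>i<d. real i) = real d * (real d - 1)" by (induction d) (simp_all add: algebra_simps)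
  finally have h: "(\<Sum>j<d. real (hilb d \<mu> (\<mu> ! j))) = real d * real d + ?S"
    by (simp add: hilb_def algebra_simps)
  have s: "(\<Sum>j<d. \<mu> ! j) = n" using mu by (simp add: sum_list_sum_nth atLeast0LessThan)
  have "(\<Sum>j<d. q j) + (\<Sum>j<d. hilb d \<mu> (\<mu> ! j)) = (\<Sum>j<d. (d + 1) * (\<mu> ! j + 1))"
    unfolding sum.distrib[symmetric] by (rule sum.cong) (use q in auto)
  also have "\<dots> = (d + 1) * (n + d)"
    unfolding sum_distrib_left[symmetric] sum.distrib s by simp
  finally have "real ((\<Sum>j<d. q j) + (\<Sum>j<d. hilb d \<mu> (\<mu> ! j))) = real ((d + 1) * (n + d))" by simp
  then have "real (\<Sum>j<d. q j) + (\<Sum>j<d. real (hilb d \<mu> (\<mu> ! j))) = (real d + 1) * (real n + real d)"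
    by (simp add: algebra_simps)
  then show ?thesis unfolding h by (simp add: algebra_simps)
qed

theorem theorem3p3:
  fixes n d :: nat and \<mu> :: "nat list"
  assumes "infinite (UNIV :: 'k::field set)"
    and "2 \<le> d" and "d \<le> n"
    and "is_partition_of n d \<mu>"
  shows "(\<exists>V. closedin (form_zariski n d) V \<and>
      openin (subtopology (form_zariski n d) V)
        (param_tuples_of_type n d \<mu> :: (nat \<Rightarrow> 'k poly poly) set)) \<and>
    irreducible_space (subtopology (form_zariski n d)
      (param_tuples_of_type n d \<mu> :: (nat \<Rightarrow> 'k poly poly) set)) \<and>
    krull_dim (subtopology (form_zariski n d)
      (param_tuples_of_type n d \<mu> :: (nat \<Rightarrow> 'k poly poly) set)) =
      ereal ((real d + 1) * (real n + 1)
        - (\<Sum>i<d. \<Sum>j<i. max 0 (real (\<mu> ! i) - real (\<mu> ! j) - 1)))"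
proof (intro conjI)
  let ?M = "param_tuples_of_type n d \<mu> :: (nat \<Rightarrow> 'k poly poly) set"
  have d: "1 \<le> d" using assms(2) by simp
  show "\<exists>V. closedin (form_zariski n d) V \<and> openin (subtopology (form_zariski n d) V) ?M"
    by (rule type_locally_closed[OF assms(4)])
  show "irreducible_space (subtopology (form_zariski n d) ?M)"
    unfolding form_zariski_def irreducible_space_zariski[OF type_subset]
    by (rule type_prime_vanishing[OF assms(1,4) d])
  obtain a0 where a0: "a0 \<in> ?M" using type_nonempty[OF assms(4) d] by blast
  obtain P0 where P0: "syz_basis d (dehoms n a0) \<mu> P0"
    using a0 unfolding param_tuples_of_type_iff[OF assms(4)] by blast
  have "\<forall>j<d. P0 j \<in> syz d (dehoms n a0) (\<mu> ! j)" "poly_indep d P0" using P0 unfolding syz_basis_def by simp_all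
  from type_is_para[OF assms(4) a0 this] obtain c0 where c0: "a0 = para n d c0 P0" ..
  define q where "q j = (d + 1) * (\<mu> ! j + 1) - hilb d \<mu> (\<mu> ! j)" for j
  have q: "q j + hilb d \<mu> (\<mu> ! j) = (d + 1) * (\<mu> ! j + 1)" for j
    using hilb_le[of d \<mu> "\<mu> ! j"] by (simp add: q_def)
  have "\<exists>e. e ` {..<q j} \<subseteq> vecs d (\<mu> ! j) \<and> vv.indep_mod (syz d (dehoms n a0) (\<mu> ! j)) {..<q j} e" for j
    unfolding q_def by (rule vv.complement_family_exists[OF has_dim_vecs syz_basis_dim[OF P0] syz_subset]) blast
  then obtain e where e: "\<And>j. e j ` {..<q j} \<subseteq> vecs d (\<mu> ! j)"
    "\<And>j. vv.indep_mod (syz d (dehoms n a0) (\<mu> ! j)) {..<q j} (e j)" by metis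
  interpret slice n d \<mu> a0 c0 P0 q e
    by unfold_locales (use assms d P0 c0 q e in auto)
  have "real (1 + card I) = 1 + real (\<Sum>j<d. q j)" by (simp add: I_def)
  also have "\<dots> = (real d + 1) * (real n + 1) - (\<Sum>i<d. \<Sum>j<i. max 0 (real (\<mu> ! i) - real (\<mu> ! j) - 1))"
    by (rule dimension_count[OF is_partition_ofD(1,4,2)[OF assms(4)] q])
  finally show "krull_dim (subtopology (form_zariski n d) ?M) = ereal ((real d + 1) * (real n + 1)
        - (\<Sum>i<d. \<Sum>j<i. max 0 (real (\<mu> ! i) - real (\<mu> ! j) - 1)))"
    unfolding krull_dim_type by simp
qed

end
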